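(* Let $(\mathcal C,\mathbb E,\mathfrak s)$ be an extriangulated category with Auslander–Reiten translations $\tau$ and $\tau^{-1}$, and let $\mathcal X$ be a strongly functorially finite subcategory of $\mathcal C$ satisfying $\tau\underline{\mathcal X}=\overline{\mathcal X}$. Assume that there are functorial isomorphisms $\mathbb E(A,B)\simeq \mathsf D\,\overline{\mathrm{Hom}}_{\mathcal C}(B,\tau A)\simeq\mathsf D\,\underline{\mathrm{Hom}}_{\mathcal C}(\tau^{-1}B,A)$ for all $A,B\in\mathcal C$, where $\mathsf D=\mathrm{Hom}_k(-,k)$. For $A,C\in\mathcal C$ let $\mathbb E'(C,A)$ be the collection of those $\delta\in\mathbb E(C,A)$ whose $\mathbb E$-triangle $A\xrightarrow{f}B\xrightarrow{g}C\overset{\delta}{\dashrightarrow}$ has $f$ $\mathcal X$-monic, and for $\delta\in\mathbb E'(C,A)$ put $\mathfrak s'(\delta)=[A\xrightarrow{f}B\xrightarrow{g}C]$. Then $(\mathcal C,\mathbb E',\mathfrak s')$ is a Frobenius extriangulated category.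
   Context: Conventions: $k$ is a field; all categories are Krull–Schmidt $k$-linear categories; all subcategories are full and closed under isomorphisms, direct sums and direct summands. Extriangulated category $(\mathcal C,\mathbb E,\mathfrak s)$ (Nakaoka–Palu): $\mathcal C$ is an additive category. (ET1) $\mathbb E:\mathcal C^{op}\times\mathcal C\to\mathrm{Ab}$ is a biadditive functor; elements $\delta\in\mathbb E(C,A)$ are called $\mathbb E$-extensions; for $a:A\to A'$, $c:C'\to C$ write $a_*\delta=\mathbb E(C,a)(\delta)$, $c^*\delta=\mathbb E(c,A)(\delta)$. A morphism $(a,c):\delta\to\delta'$ from $\delta\in\mathbb E(C,A)$ to $\delta'\in\mathbb E(C',A')$ is a pair $a:A\to A'$, $c:C\to C'$ with $a_*\delta=c^*\delta'$. (ET2) $\mathfrak s$ is an additive realization: it assigns to each $\delta\in\mathbb E(C,A)$ an equivalence class $\mathfrak s(\delta)=[A\xrightarrow{x}B\xrightarrow{y}C]$ of sequences ($A\to B\to C$ and $A\to B'\to C$ are equivalent if there is an isomorphism $B\to B'$ compatible with $\mathrm{id}_A,\mathrm{id}_C$), such that every morphism $(a,c):\delta\to\delta'$ is realized by some $b:B\to B'$ with $bx=x'a$, $y'b=cy$ (where $\mathfrak s(\delta')=[A'\xrightarrow{x'}B'\xrightarrow{y'}C']$), $\mathfrak s(0)=[A\to A\oplus C\to C]$, and $\mathfrak s(\delta\oplus\delta')=\mathfrak s(\delta)\oplus\mathfrak s(\delta')$. (ET3) If $\delta,\delta'$ are realized by $A\xrightarrow{x}B\xrightarrow{y}C$ and $A'\xrightarrow{x'}B'\xrightarrow{y'}C'$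 and $bx=x'a$, then there is $c$ with $(a,c):\delta\to\delta'$ a morphism and $cy=y'b$. (ET3)$^{op}$ Dually, if $cy=y'b$ then there is $a$ with $(a,c):\delta\to\delta'$ a morphism and $bx=x'a$. (ET4) If $\delta\in\mathbb E(D,A)$ is realized by $A\xrightarrow{f}B\xrightarrow{f'}D$ and $\delta'\in\mathbb E(F,B)$ by $B\xrightarrow{g}C\xrightarrow{g'}F$, then there are an object $E$, morphisms $h':C\to E$, $d:D\to E$, $e:E\to F$ with $h'g=df'$, $eh'=g'$, and $\delta''\in\mathbb E(E,A)$ realized by $A\xrightarrow{gf}C\xrightarrow{h'}E$ such that $D\xrightarrow{d}E\xrightarrow{e}F$ realizes $f'_*\delta'$, $d^*\delta''=\delta$ and $f_*\delta''=e^*\delta'$. (ET4)$^{op}$ If $\delta\in\mathbb E(B,D)$ is realized by $D\xrightarrow{f'}A\xrightarrow{f}B$ and $\delta'\in\mathbb E(C,F)$ by $F\xrightarrow{g'}B\xrightarrow{g}C$, then there are an object $E$, morphisms $d:D\to E$, $e:E\to F$, $h':E\to A$ with $h'd=f'$, $fh'=g'e$, and $\delta''\in\mathbb E(C,E)$ realized by $E\xrightarrow{h'}A\xrightarrow{gf}C$ such that $D\xrightarrow{d}E\xrightarrow{e}F$ realizes $g'^*\delta$, $e_*\delta''=\delta'$ and $d_*\delta=g^*\delta''$. If $A\xrightarrow{x}B\xrightarrow{y}C$ realizes $\delta\in\mathbb E(C,A)$, one calls $A\xrightarrow{x}B\xrightarrow{y}C\overset{\delta}{\dashrightarrow}$ an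 $\mathbb E$-triangle. In the claim, $\mathbb E'$ carries the functoriality inherited from $\mathbb E$ (i.e. $\mathbb E'(C,a)(\delta)=a_*\delta$, $\mathbb E'(c,A)(\delta)=c^*\delta$) and the addition inherited from $\mathbb E$; that these are well defined on $\mathbb E'$ is part of the assertion. Projectives: $P$ is projective if for every $\mathbb E$-triangle $A\to B\xrightarrow{y}C\dashrightarrow$ every morphism $P\to C$ factors through $y$ (equivalently $\mathbb E(P,-)=0$); injectives are dual. $\mathcal P$, $\mathcal I$ denote the subcategories of projective and injective objects. An extriangulated category has enough projectives if each object $C$ admits an $\mathbb E$-triangle $A\to P\to C\dashrightarrow$ with $P$ projective; enough injectives is dual. It is Frobenius if it has enough projectives and enough injectives and the projectives coincide with the injectives. $\underline{\mathrm{Hom}}_{\mathcal C}(A,B)$ (resp. $\overline{\mathrm{Hom}}_{\mathcal C}(A,B)$) is $\mathrm{Hom}_{\mathcal C}(A,B)$ modulo morphisms factoring through $\mathcal P$ (resp. $\mathcal I$). Source morphism $f:A\to B$: $f$ is not a section, every $u:A\to C$ that is not a section factors through $f$, and $\phi f=f$ implies $\phi$ is an automorphism; sink morphisms are dual. An Auslander–Reiten $\mathbb E$-triangle is an $\mathbb E$-triangle $A\xrightarrow{f}B\xrightarrow{g}C\dashrightarrow$ with $f$ a source and $g$ a sink morphism; then $A$, $C$ are indecomposable and one writes $A=\tau C$, $C=\tau^{-1}A$. That $\mathcal C$ has Auslander–Reiten translations $\tau,\tau^{-1}$ means that every indecomposable non-projective object is the end term, and every indecomposable non-injective object the starting term,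 of an Auslander–Reiten $\mathbb E$-triangle; $\tau$ and $\tau^{-1}$ are extended additively, being zero on projectives, respectively on injectives, and in the functorial isomorphisms are regarded as functors $\mathcal C/\mathcal P\to\mathcal C/\mathcal I$ and $\mathcal C/\mathcal I\to\mathcal C/\mathcal P$ (quotients by the ideals of morphisms factoring through $\mathcal P$, resp. $\mathcal I$). $\underline{\mathcal X}:=\mathcal X\setminus\mathcal P$, $\overline{\mathcal X}:=\mathcal X\setminus\mathcal I$ (with $\mathcal P,\mathcal I$ taken with respect to $\mathbb E$), read on indecomposable objects: the condition $\tau\underline{\mathcal X}=\overline{\mathcal X}$ means that $\tau$ maps the isomorphism classes of indecomposable objects of $\mathcal X$ not in $\mathcal P$ onto the isomorphism classes of indecomposable objects of $\mathcal X$ not in $\mathcal I$. A left $\mathcal X$-approximation of $A$ is a morphism $A\to X$ with $X\in\mathcal X$ through which every morphism from $A$ to an object of $\mathcal X$ factors; right $\mathcal X$-approximations are dual. A morphism $f:A\to B$ is $\mathcal X$-monic if $\mathcal C(f,X):\mathcal C(B,X)\to\mathcal C(A,X)$ is surjective for all $X\in\mathcal X$. $\mathcal X$ is strongly functorially finite if for each $C\in\mathcal C$ there are $\mathbb E$-triangles $K\to X\xrightarrow{g}C\dashrightarrow$ with $g$ a right $\mathcal X$-approximation of $C$, and $C\xrightarrow{f}X'\to L\dashrightarrow$ with $f$ a left $\mathcal X$-approximation of $C$. *)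

theory Defs
  imports "HOL-Algebra.Module" "HOL-Algebra.AbelCoset"
begin

section \<open>Linear categories\<close>

text \<open>
  The Hom-sets are modules over a ring \<open>K\<close>, which the locale below requires to be a field.  They are
  pairwise disjoint, so a morphism determines its source and target, and composition
  (\<open>g \<bullet> f\<close> is \<open>f\<close> followed by \<open>g\<close>) needs no object arguments.  The fields \<open>mult\<close> and
  \<open>one\<close> of the Hom-modules are not used.
\<close>

record ('o, 'm, 'k) lin_cat =
  Obj :: "'o set"
  Hom :: "'o \<Rightarrow> 'o \<Rightarrow> ('k, 'm) module"
  Ident :: "'o \<Rightarrow> 'm"
  Comp :: "'m \<Rightarrow> 'm \<Rightarrow> 'm"  (infixl \<open>\<bullet>\<index>\<close> 75)

abbreviation mor :: "('o, 'm, 'k) lin_cat \<Rightarrow> 'o \<Rightarrow> 'o \<Rightarrow> 'm set"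
  where "mor \<C> A B \<equiv> carrier (Hom \<C> A B)"

locale linear_category =
  fixes K :: "'k ring" and \<C> :: "('o, 'm, 'k) lin_cat"
  assumes field_K: "field K"
    and Hom_module: "\<lbrakk>A \<in> Obj \<C>; B \<in> Obj \<C>\<rbrakk> \<Longrightarrow> module K (Hom \<C> A B)"
    and Hom_disjoint:
      "\<lbrakk>A \<in> Obj \<C>; B \<in> Obj \<C>; A' \<in> Obj \<C>; B' \<in> Obj \<C>; f \<in> mor \<C> A B; f \<in> mor \<C> A' B'\<rbrakk>
       \<Longrightarrow> A = A' \<and> B = B'"
    and Ident_mor: "A \<in> Obj \<C> \<Longrightarrow> Ident \<C> A \<in> mor \<C> A A"
    and Comp_mor:
      "\<lbrakk>A \<in> Obj \<C>; B \<in> Obj \<C>; C \<in> Obj \<C>; f \<in> mor \<C> A B; g \<in> mor \<C> B C\<rbrakk>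
       \<Longrightarrow> g \<bullet>\<^bsub>\<C>\<^esub> f \<in> mor \<C> A C"
    and Ident_left:
      "\<lbrakk>A \<in> Obj \<C>; B \<in> Obj \<C>; f \<in> mor \<C> A B\<rbrakk> \<Longrightarrow> Ident \<C> B \<bullet>\<^bsub>\<C>\<^esub> f = f"
    and Ident_right:
      "\<lbrakk>A \<in> Obj \<C>; B \<in> Obj \<C>; f \<in> mor \<C> A B\<rbrakk> \<Longrightarrow> f \<bullet>\<^bsub>\<C>\<^esub> Ident \<C> A = f"
    and Comp_assoc:
      "\<lbrakk>A \<in> Obj \<C>; B \<in> Obj \<C>; C \<in> Obj \<C>; D \<in> Obj \<C>;
        f \<in> mor \<C> A B; g \<in> mor \<C> B C; h \<in> mor \<C> C D\<rbrakk>
       \<Longrightarrow> h \<bullet>\<^bsub>\<C>\<^esub> (g \<bullet>\<^bsub>\<C>\<^esub> f) = (h \<bullet>\<^bsub>\<C>\<^esub> g) \<bullet>\<^bsub>\<C>\<^esub> f"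
    and Comp_add_left:
      "\<lbrakk>A \<in> Obj \<C>; B \<in> Obj \<C>; C \<in> Obj \<C>; f \<in> mor \<C> A B; g \<in> mor \<C> B C; g' \<in> mor \<C> B C\<rbrakk>
       \<Longrightarrow> (g \<oplus>\<^bsub>Hom \<C> B C\<^esub> g') \<bullet>\<^bsub>\<C>\<^esub> f = (g \<bullet>\<^bsub>\<C>\<^esub> f) \<oplus>\<^bsub>Hom \<C> A C\<^esub> (g' \<bullet>\<^bsub>\<C>\<^esub> f)"
    and Comp_add_right:
      "\<lbrakk>A \<in> Obj \<C>; B \<in> Obj \<C>; C \<in> Obj \<C>; f \<in> mor \<C> A B; f' \<in> mor \<C> A B; g \<in> mor \<C> B C\<rbrakk>
       \<Longrightarrow> g \<bullet>\<^bsub>\<C>\<^esub> (f \<oplus>\<^bsub>Hom \<C> A B\<^esub> f') = (g \<bullet>\<^bsub>\<C>\<^esub> f) \<oplus>\<^bsub>Hom \<C> A C\<^esub> (g \<bullet>\<^bsub>\<C>\<^esub> f')"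
    and Comp_smult_left:
      "\<lbrakk>A \<in> Obj \<C>; B \<in> Obj \<C>; C \<in> Obj \<C>; r \<in> carrier K; f \<in> mor \<C> A B; g \<in> mor \<C> B C\<rbrakk>
       \<Longrightarrow> (r \<odot>\<^bsub>Hom \<C> B C\<^esub> g) \<bullet>\<^bsub>\<C>\<^esub> f = r \<odot>\<^bsub>Hom \<C> A C\<^esub> (g \<bullet>\<^bsub>\<C>\<^esub> f)"
    and Comp_smult_right:
      "\<lbrakk>A \<in> Obj \<C>; B \<in> Obj \<C>; C \<in> Obj \<C>; r \<in> carrier K; f \<in> mor \<C> A B; g \<in> mor \<C> B C\<rbrakk>
       \<Longrightarrow> g \<bullet>\<^bsub>\<C>\<^esub> (r \<odot>\<^bsub>Hom \<C> A B\<^esub> f) = r \<odot>\<^bsub>Hom \<C> A C\<^esub> (g \<bullet>\<^bsub>\<C>\<^esub> f)"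

definition isomorphism :: "('o, 'm, 'k) lin_cat \<Rightarrow> 'o \<Rightarrow> 'o \<Rightarrow> 'm \<Rightarrow> bool" where
  "isomorphism \<C> A B f \<longleftrightarrow> f \<in> mor \<C> A B \<and>
     (\<exists>g \<in> mor \<C> B A. g \<bullet>\<^bsub>\<C>\<^esub> f = Ident \<C> A \<and> f \<bullet>\<^bsub>\<C>\<^esub> g = Ident \<C> B)"

definition isomorphic :: "('o, 'm, 'k) lin_cat \<Rightarrow> 'o \<Rightarrow> 'o \<Rightarrow> bool" where
  "isomorphic \<C> A B \<longleftrightarrow> A \<in> Obj \<C> \<and> B \<in> Obj \<C> \<and> (\<exists>f. isomorphism \<C> A B f)"

definition iso_closure :: "('o, 'm, 'k) lin_cat \<Rightarrow> 'o set \<Rightarrow> 'o set" where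
  "iso_closure \<C> S = {B. \<exists>A \<in> S. isomorphic \<C> A B}"

definition zero_object :: "('o, 'm, 'k) lin_cat \<Rightarrow> 'o \<Rightarrow> bool" where
  "zero_object \<C> Z \<longleftrightarrow> Z \<in> Obj \<C> \<and>
     (\<forall>A \<in> Obj \<C>. mor \<C> Z A = {\<zero>\<^bsub>Hom \<C> Z A\<^esub>} \<and> mor \<C> A Z = {\<zero>\<^bsub>Hom \<C> A Z\<^esub>})"

definition biproduct ::
  "('o, 'm, 'k) lin_cat \<Rightarrow> 'o \<Rightarrow> 'o \<Rightarrow> 'o \<Rightarrow> 'm \<Rightarrow> 'm \<Rightarrow> 'm \<Rightarrow> 'm \<Rightarrow> bool" where
  "biproduct \<C> A B S i j p q \<longleftrightarrow>
     A \<in> Obj \<C> \<and> B \<in> Obj \<C> \<and> S \<in> Obj \<C> \<and>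
     i \<in> mor \<C> A S \<and> j \<in> mor \<C> B S \<and> p \<in> mor \<C> S A \<and> q \<in> mor \<C> S B \<and>
     p \<bullet>\<^bsub>\<C>\<^esub> i = Ident \<C> A \<and> q \<bullet>\<^bsub>\<C>\<^esub> j = Ident \<C> B \<and>
     p \<bullet>\<^bsub>\<C>\<^esub> j = \<zero>\<^bsub>Hom \<C> B A\<^esub> \<and> q \<bullet>\<^bsub>\<C>\<^esub> i = \<zero>\<^bsub>Hom \<C> A B\<^esub> \<and>
     (i \<bullet>\<^bsub>\<C>\<^esub> p) \<oplus>\<^bsub>Hom \<C> S S\<^esub> (j \<bullet>\<^bsub>\<C>\<^esub> q) = Ident \<C> S"

definition direct_sum :: "('o, 'm, 'k) lin_cat \<Rightarrow> 'o \<Rightarrow> 'o \<Rightarrow> 'o \<Rightarrow> bool" where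
  "direct_sum \<C> A B S \<longleftrightarrow> (\<exists>i j p q. biproduct \<C> A B S i j p q)"

locale additive_category = linear_category K \<C>
  for K :: "'k ring" and \<C> :: "('o, 'm, 'k) lin_cat" +
  assumes zero_exists: "\<exists>Z. zero_object \<C> Z"
    and direct_sum_exists: "\<lbrakk>A \<in> Obj \<C>; B \<in> Obj \<C>\<rbrakk> \<Longrightarrow> \<exists>S. direct_sum \<C> A B S"

text \<open>The ring \<open>End(A)\<close> is nonzero and its non-units are closed under addition.\<close>

definition local_End :: "('o, 'm, 'k) lin_cat \<Rightarrow> 'o \<Rightarrow> bool" where
  "local_End \<C> A \<longleftrightarrow> A \<in> Obj \<C> \<and> Ident \<C> A \<noteq> \<zero>\<^bsub>Hom \<C> A A\<^esub> \<and>
     (\<forall>f \<in> mor \<C> A A. \<forall>g \<in> mor \<C> A A.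
        \<not> isomorphism \<C> A A f \<and> \<not> isomorphism \<C> A A g \<longrightarrow>
        \<not> isomorphism \<C> A A (f \<oplus>\<^bsub>Hom \<C> A A\<^esub> g))"

inductive finite_direct_sum ::
    "('o, 'm, 'k) lin_cat \<Rightarrow> ('o \<Rightarrow> bool) \<Rightarrow> 'o \<Rightarrow> bool"
  for \<C> :: "('o, 'm, 'k) lin_cat" and Q :: "'o \<Rightarrow> bool" where
  empty: "zero_object \<C> Z \<Longrightarrow> finite_direct_sum \<C> Q Z"
| summand: "\<lbrakk>Q A; finite_direct_sum \<C> Q B; direct_sum \<C> A B S\<rbrakk> \<Longrightarrow> finite_direct_sum \<C> Q S"

locale krull_schmidt_category = additive_category K \<C>
  for K :: "'k ring" and \<C> :: "('o, 'm, 'k) lin_cat" +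
  assumes krull_schmidt: "A \<in> Obj \<C> \<Longrightarrow> finite_direct_sum \<C> (local_End \<C>) A"

definition indecomposable :: "('o, 'm, 'k) lin_cat \<Rightarrow> 'o \<Rightarrow> bool" where
  "indecomposable \<C> A \<longleftrightarrow> A \<in> Obj \<C> \<and> \<not> zero_object \<C> A \<and>
     (\<forall>B C. direct_sum \<C> B C A \<longrightarrow> zero_object \<C> B \<or> zero_object \<C> C)"

text \<open>A full subcategory is given by its set of objects.\<close>

definition subcategory :: "('o, 'm, 'k) lin_cat \<Rightarrow> 'o set \<Rightarrow> bool" where
  "subcategory \<C> \<X> \<longleftrightarrow> \<X> \<subseteq> Obj \<C> \<and>
     (\<forall>A B. A \<in> \<X> \<and> isomorphic \<C> A B \<longrightarrow> B \<in> \<X>) \<and>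
     (\<forall>Z. zero_object \<C> Z \<longrightarrow> Z \<in> \<X>) \<and>
     (\<forall>A B S. direct_sum \<C> A B S \<longrightarrow> (S \<in> \<X> \<longleftrightarrow> A \<in> \<X> \<and> B \<in> \<X>))"


section \<open>Extriangulated categories\<close>

text \<open>
  \<open>Ext \<E> C A\<close> is the abelian group \<open>\<E>(C, A)\<close>, whose addition is the field \<open>mult\<close> and whose zero is
  the field \<open>one\<close> of the monoid record; \<open>ExtMap \<E> c a\<close> is \<open>\<E>(c, a) : \<E>(C, A) \<rightarrow> \<E>(C', A')\<close>
  for \<open>c : C' \<rightarrow> C\<close> and \<open>a : A \<rightarrow> A'\<close>.
\<close>

record ('o, 'm, 'e) bifunctor =
  Ext :: "'o \<Rightarrow> 'o \<Rightarrow> 'e monoid"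
  ExtMap :: "'m \<Rightarrow> 'm \<Rightarrow> 'e \<Rightarrow> 'e"

abbreviation ext :: "('o, 'm, 'e) bifunctor \<Rightarrow> 'o \<Rightarrow> 'o \<Rightarrow> 'e set"
  where "ext \<E> C A \<equiv> carrier (Ext \<E> C A)"

definition push ::
  "('o, 'm, 'k) lin_cat \<Rightarrow> ('o, 'm, 'e) bifunctor \<Rightarrow> 'o \<Rightarrow> 'm \<Rightarrow> 'e \<Rightarrow> 'e" where
  "push \<C> \<E> C a \<delta> = ExtMap \<E> (Ident \<C> C) a \<delta>"

definition pull ::
  "('o, 'm, 'k) lin_cat \<Rightarrow> ('o, 'm, 'e) bifunctor \<Rightarrow> 'o \<Rightarrow> 'm \<Rightarrow> 'e \<Rightarrow> 'e" where
  "pull \<C> \<E> A c \<delta> = ExtMap \<E> c (Ident \<C> A) \<delta>"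

definition biadditive_functor ::
  "('o, 'm, 'k) lin_cat \<Rightarrow> ('o, 'm, 'e) bifunctor \<Rightarrow> bool" where
  "biadditive_functor \<C> \<E> \<longleftrightarrow>
     (\<forall>C \<in> Obj \<C>. \<forall>A \<in> Obj \<C>. comm_group (Ext \<E> C A)) \<and>
     (\<forall>C \<in> Obj \<C>. \<forall>A \<in> Obj \<C>. \<forall>C' \<in> Obj \<C>. \<forall>A' \<in> Obj \<C>.
        \<forall>c \<in> mor \<C> C' C. \<forall>a \<in> mor \<C> A A'. ExtMap \<E> c a \<in> hom (Ext \<E> C A) (Ext \<E> C' A')) \<and>
     (\<forall>C \<in> Obj \<C>. \<forall>A \<in> Obj \<C>. \<forall>\<delta> \<in> ext \<E> C A. ExtMap \<E> (Ident \<C> C) (Ident \<C> A) \<delta> = \<delta>) \<and>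
     (\<forall>C \<in> Obj \<C>. \<forall>A \<in> Obj \<C>. \<forall>C' \<in> Obj \<C>. \<forall>A' \<in> Obj \<C>. \<forall>C'' \<in> Obj \<C>. \<forall>A'' \<in> Obj \<C>.
        \<forall>c \<in> mor \<C> C' C. \<forall>a \<in> mor \<C> A A'. \<forall>c' \<in> mor \<C> C'' C'. \<forall>a' \<in> mor \<C> A' A''.
        \<forall>\<delta> \<in> ext \<E> C A.
          ExtMap \<E> (c \<bullet>\<^bsub>\<C>\<^esub> c') (a' \<bullet>\<^bsub>\<C>\<^esub> a) \<delta> = ExtMap \<E> c' a' (ExtMap \<E> c a \<delta>)) \<and>
     (\<forall>C \<in> Obj \<C>. \<forall>A \<in> Obj \<C>. \<forall>C' \<in> Obj \<C>. \<forall>A' \<in> Obj \<C>.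
        \<forall>c \<in> mor \<C> C' C. \<forall>a \<in> mor \<C> A A'. \<forall>a' \<in> mor \<C> A A'. \<forall>\<delta> \<in> ext \<E> C A.
          ExtMap \<E> c (a \<oplus>\<^bsub>Hom \<C> A A'\<^esub> a') \<delta> =
          ExtMap \<E> c a \<delta> \<otimes>\<^bsub>Ext \<E> C' A'\<^esub> ExtMap \<E> c a' \<delta>) \<and>
     (\<forall>C \<in> Obj \<C>. \<forall>A \<in> Obj \<C>. \<forall>C' \<in> Obj \<C>. \<forall>A' \<in> Obj \<C>.
        \<forall>c \<in> mor \<C> C' C. \<forall>c' \<in> mor \<C> C' C. \<forall>a \<in> mor \<C> A A'. \<forall>\<delta> \<in> ext \<E> C A.
          ExtMap \<E> (c \<oplus>\<^bsub>Hom \<C> C' C\<^esub> c') a \<delta> =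
          ExtMap \<E> c a \<delta> \<otimes>\<^bsub>Ext \<E> C' A'\<^esub> ExtMap \<E> c' a \<delta>)"

text \<open>
  A triple \<open>(x, B, y)\<close> with \<open>x : A \<rightarrow> B\<close> and \<open>y : B \<rightarrow> C\<close> stands for the sequence
  \<open>A \<rightarrow> B \<rightarrow> C\<close>; \<open>seq_class \<C> A C (x, B, y)\<close> is its equivalence class.
\<close>

definition sequences :: "('o, 'm, 'k) lin_cat \<Rightarrow> 'o \<Rightarrow> 'o \<Rightarrow> ('m \<times> 'o \<times> 'm) set" where
  "sequences \<C> A C = {(x, B, y). B \<in> Obj \<C> \<and> x \<in> mor \<C> A B \<and> y \<in> mor \<C> B C}"

definition seq_class ::
  "('o, 'm, 'k) lin_cat \<Rightarrow> 'o \<Rightarrow> 'o \<Rightarrow> 'm \<times> 'o \<times> 'm \<Rightarrow> ('m \<times> 'o \<times> 'm) set" where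
  "seq_class \<C> A C = (\<lambda>(x, B, y). {(x', B', y'). (x', B', y') \<in> sequences \<C> A C \<and>
     (\<exists>b. isomorphism \<C> B B' b \<and> b \<bullet>\<^bsub>\<C>\<^esub> x = x' \<and> y' \<bullet>\<^bsub>\<C>\<^esub> b = y)})"

text \<open>
  A realization is a function assigning to \<open>C\<close>, \<open>A\<close> and \<open>\<delta> \<in> \<E>(C, A)\<close> an equivalence class of
  sequences; \<open>(x, B, y) \<in> \<s> C A \<delta>\<close> says that \<open>A \<rightarrow> B \<rightarrow> C\<close> realizes \<open>\<delta>\<close>.
\<close>

type_synonym ('o, 'm, 'e) realization = "'o \<Rightarrow> 'o \<Rightarrow> 'e \<Rightarrow> ('m \<times> 'o \<times> 'm) set"

locale extriangulated_category = additive_category K \<C>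
  for K :: "'k ring" and \<C> :: "('o, 'm, 'k) lin_cat" +
  fixes \<E> :: "('o, 'm, 'e) bifunctor" and \<s> :: "('o, 'm, 'e) realization"
  assumes ET1: "biadditive_functor \<C> \<E>"
    and ET2_class:
      "\<lbrakk>C \<in> Obj \<C>; A \<in> Obj \<C>; \<delta> \<in> ext \<E> C A\<rbrakk>
       \<Longrightarrow> \<exists>t \<in> sequences \<C> A C. \<s> C A \<delta> = seq_class \<C> A C t"
    and ET2_morphism:
      "\<lbrakk>A \<in> Obj \<C>; C \<in> Obj \<C>; A' \<in> Obj \<C>; C' \<in> Obj \<C>;
        \<delta> \<in> ext \<E> C A; \<delta>' \<in> ext \<E> C' A'; a \<in> mor \<C> A A'; c \<in> mor \<C> C C';
        push \<C> \<E> C a \<delta> = pull \<C> \<E> A' c \<delta>';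
        (x, B, y) \<in> \<s> C A \<delta>; (x', B', y') \<in> \<s> C' A' \<delta>'\<rbrakk>
       \<Longrightarrow> \<exists>b \<in> mor \<C> B B'. b \<bullet>\<^bsub>\<C>\<^esub> x = x' \<bullet>\<^bsub>\<C>\<^esub> a \<and> y' \<bullet>\<^bsub>\<C>\<^esub> b = c \<bullet>\<^bsub>\<C>\<^esub> y"
    and ET2_zero:
      "biproduct \<C> A C S i j p q
       \<Longrightarrow> \<s> C A \<one>\<^bsub>Ext \<E> C A\<^esub> = seq_class \<C> A C (i, S, q)"
    \<comment> \<open>\<open>\<delta> \<oplus> \<delta>'\<close> is the element of \<open>\<E>(C \<oplus> C', A \<oplus> A')\<close> with components \<open>(\<delta>, 0, 0, \<delta>')\<close>\<close>
    and ET2_sum: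
      "\<lbrakk>biproduct \<C> A A' SA iA jA pA qA; biproduct \<C> B B' SB iB jB pB qB;
        biproduct \<C> C C' SC iC jC pC qC;
        \<delta> \<in> ext \<E> C A; \<delta>' \<in> ext \<E> C' A';
        (x, B, y) \<in> \<s> C A \<delta>; (x', B', y') \<in> \<s> C' A' \<delta>'\<rbrakk>
       \<Longrightarrow> \<s> SC SA (ExtMap \<E> pC iA \<delta> \<otimes>\<^bsub>Ext \<E> SC SA\<^esub> ExtMap \<E> qC jA \<delta>') =
           seq_class \<C> SA SC
             ((iB \<bullet>\<^bsub>\<C>\<^esub> x \<bullet>\<^bsub>\<C>\<^esub> pA) \<oplus>\<^bsub>Hom \<C> SA SB\<^esub> (jB \<bullet>\<^bsub>\<C>\<^esub> x' \<bullet>\<^bsub>\<C>\<^esub> qA), SB,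
              (iC \<bullet>\<^bsub>\<C>\<^esub> y \<bullet>\<^bsub>\<C>\<^esub> pB) \<oplus>\<^bsub>Hom \<C> SB SC\<^esub> (jC \<bullet>\<^bsub>\<C>\<^esub> y' \<bullet>\<^bsub>\<C>\<^esub> qB))"
    and ET3:
      "\<lbrakk>A \<in> Obj \<C>; C \<in> Obj \<C>; A' \<in> Obj \<C>; C' \<in> Obj \<C>;
        \<delta> \<in> ext \<E> C A; \<delta>' \<in> ext \<E> C' A';
        (x, B, y) \<in> \<s> C A \<delta>; (x', B', y') \<in> \<s> C' A' \<delta>';
        a \<in> mor \<C> A A'; b \<in> mor \<C> B B'; b \<bullet>\<^bsub>\<C>\<^esub> x = x' \<bullet>\<^bsub>\<C>\<^esub> a\<rbrakk>
       \<Longrightarrow> \<exists>c \<in> mor \<C> C C'. push \<C> \<E> C a \<delta> = pull \<C> \<E> A' c \<delta>' \<and> c \<bullet>\<^bsub>\<C>\<^esub> y = y' \<bullet>\<^bsub>\<C>\<^esub> b"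
    and ET3_op:
      "\<lbrakk>A \<in> Obj \<C>; C \<in> Obj \<C>; A' \<in> Obj \<C>; C' \<in> Obj \<C>;
        \<delta> \<in> ext \<E> C A; \<delta>' \<in> ext \<E> C' A';
        (x, B, y) \<in> \<s> C A \<delta>; (x', B', y') \<in> \<s> C' A' \<delta>';
        b \<in> mor \<C> B B'; c \<in> mor \<C> C C'; c \<bullet>\<^bsub>\<C>\<^esub> y = y' \<bullet>\<^bsub>\<C>\<^esub> b\<rbrakk>
       \<Longrightarrow> \<exists>a \<in> mor \<C> A A'. push \<C> \<E> C a \<delta> = pull \<C> \<E> A' c \<delta>' \<and> b \<bullet>\<^bsub>\<C>\<^esub> x = x' \<bullet>\<^bsub>\<C>\<^esub> a"
    and ET4:
      "\<lbrakk>A \<in> Obj \<C>; D \<in> Obj \<C>; B \<in> Obj \<C>; F \<in> Obj \<C>;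
        \<delta> \<in> ext \<E> D A; \<delta>' \<in> ext \<E> F B;
        (f, B, f') \<in> \<s> D A \<delta>; (g, C, g') \<in> \<s> F B \<delta>'\<rbrakk>
       \<Longrightarrow> \<exists>E \<in> Obj \<C>. \<exists>h' \<in> mor \<C> C E. \<exists>d \<in> mor \<C> D E. \<exists>e \<in> mor \<C> E F. \<exists>\<delta>'' \<in> ext \<E> E A.
             h' \<bullet>\<^bsub>\<C>\<^esub> g = d \<bullet>\<^bsub>\<C>\<^esub> f' \<and> e \<bullet>\<^bsub>\<C>\<^esub> h' = g' \<and>
             (g \<bullet>\<^bsub>\<C>\<^esub> f, C, h') \<in> \<s> E A \<delta>'' \<and>
             (d, E, e) \<in> \<s> F D (push \<C> \<E> F f' \<delta>') \<and>
             pull \<C> \<E> A d \<delta>'' = \<delta> \<and>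
             push \<C> \<E> E f \<delta>'' = pull \<C> \<E> B e \<delta>'"
    and ET4_op:
      "\<lbrakk>D \<in> Obj \<C>; B \<in> Obj \<C>; F \<in> Obj \<C>; C \<in> Obj \<C>;
        \<delta> \<in> ext \<E> B D; \<delta>' \<in> ext \<E> C F;
        (f', A, f) \<in> \<s> B D \<delta>; (g', B, g) \<in> \<s> C F \<delta>'\<rbrakk>
       \<Longrightarrow> \<exists>E \<in> Obj \<C>. \<exists>d \<in> mor \<C> D E. \<exists>e \<in> mor \<C> E F. \<exists>h' \<in> mor \<C> E A. \<exists>\<delta>'' \<in> ext \<E> C E.
             h' \<bullet>\<^bsub>\<C>\<^esub> d = f' \<and> f \<bullet>\<^bsub>\<C>\<^esub> h' = g' \<bullet>\<^bsub>\<C>\<^esub> e \<and>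
             (h', A, g \<bullet>\<^bsub>\<C>\<^esub> f) \<in> \<s> C E \<delta>'' \<and>
             (d, E, e) \<in> \<s> F D (pull \<C> \<E> D g' \<delta>) \<and>
             push \<C> \<E> C e \<delta>'' = \<delta>' \<and>
             push \<C> \<E> B d \<delta> = pull \<C> \<E> E g \<delta>''"

definition E_triangle ::
  "('o, 'm, 'k) lin_cat \<Rightarrow> ('o, 'm, 'e) bifunctor \<Rightarrow> ('o, 'm, 'e) realization \<Rightarrow>
   'o \<Rightarrow> 'm \<Rightarrow> 'o \<Rightarrow> 'm \<Rightarrow> 'o \<Rightarrow> 'e \<Rightarrow> bool" where
  "E_triangle \<C> \<E> \<s> A x B y C \<delta> \<longleftrightarrow>
     A \<in> Obj \<C> \<and> C \<in> Obj \<C> \<and> \<delta> \<in> ext \<E> C A \<and> (x, B, y) \<in> \<s> C A \<delta>"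


section \<open>Projectives, injectives and Frobenius categories\<close>

definition Proj ::
  "('o, 'm, 'k) lin_cat \<Rightarrow> ('o, 'm, 'e) bifunctor \<Rightarrow> ('o, 'm, 'e) realization \<Rightarrow> 'o set" where
  "Proj \<C> \<E> \<s> = {P \<in> Obj \<C>. \<forall>A x B y C \<delta>. E_triangle \<C> \<E> \<s> A x B y C \<delta> \<longrightarrow>
     (\<forall>u \<in> mor \<C> P C. \<exists>v \<in> mor \<C> P B. y \<bullet>\<^bsub>\<C>\<^esub> v = u)}"

definition Inj ::
  "('o, 'm, 'k) lin_cat \<Rightarrow> ('o, 'm, 'e) bifunctor \<Rightarrow> ('o, 'm, 'e) realization \<Rightarrow> 'o set" where
  "Inj \<C> \<E> \<s> = {I \<in> Obj \<C>. \<forall>A x B y C \<delta>. E_triangle \<C> \<E> \<s> A x B y C \<delta> \<longrightarrow>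
     (\<forall>u \<in> mor \<C> A I. \<exists>v \<in> mor \<C> B I. v \<bullet>\<^bsub>\<C>\<^esub> x = u)}"

definition enough_projectives ::
  "('o, 'm, 'k) lin_cat \<Rightarrow> ('o, 'm, 'e) bifunctor \<Rightarrow> ('o, 'm, 'e) realization \<Rightarrow> bool" where
  "enough_projectives \<C> \<E> \<s> \<longleftrightarrow>
     (\<forall>C \<in> Obj \<C>. \<exists>A x P y \<delta>. E_triangle \<C> \<E> \<s> A x P y C \<delta> \<and> P \<in> Proj \<C> \<E> \<s>)"

definition enough_injectives ::
  "('o, 'm, 'k) lin_cat \<Rightarrow> ('o, 'm, 'e) bifunctor \<Rightarrow> ('o, 'm, 'e) realization \<Rightarrow> bool" where
  "enough_injectives \<C> \<E> \<s> \<longleftrightarrow>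
     (\<forall>A \<in> Obj \<C>. \<exists>x I y C \<delta>. E_triangle \<C> \<E> \<s> A x I y C \<delta> \<and> I \<in> Inj \<C> \<E> \<s>)"

locale frobenius_extriangulated_category = extriangulated_category K \<C> \<E> \<s>
  for K :: "'k ring" and \<C> :: "('o, 'm, 'k) lin_cat"
    and \<E> :: "('o, 'm, 'e) bifunctor" and \<s> :: "('o, 'm, 'e) realization" +
  assumes enough_proj: "enough_projectives \<C> \<E> \<s>"
    and enough_inj: "enough_injectives \<C> \<E> \<s>"
    and Proj_eq_Inj: "Proj \<C> \<E> \<s> = Inj \<C> \<E> \<s>"


section \<open>Stable categories\<close>

definition factoring ::
  "('o, 'm, 'k) lin_cat \<Rightarrow> 'o set \<Rightarrow> 'o \<Rightarrow> 'o \<Rightarrow> 'm set" where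
  "factoring \<C> \<W> A B =
     {h \<bullet>\<^bsub>\<C>\<^esub> g | W g h. W \<in> \<W> \<and> g \<in> mor \<C> A W \<and> h \<in> mor \<C> W B}"

text \<open>The module of cosets of the submodule \<open>N\<close> of \<open>M\<close>.\<close>

definition quotient_module :: "('k, 'm) module \<Rightarrow> 'm set \<Rightarrow> ('k, 'm set) module" where
  "quotient_module M N =
     \<lparr>carrier = a_rcosets\<^bsub>M\<^esub> N, mult = undefined, one = undefined,
      zero = N, add = (\<lambda>F G. F <+>\<^bsub>M\<^esub> G),
      smult = (\<lambda>r F. \<Union>f \<in> F. N +>\<^bsub>M\<^esub> (r \<odot>\<^bsub>M\<^esub> f))\<rparr>"

text \<open>
  The quotient \<open>\<C>/\<W>\<close> by the ideal of the morphisms factoring through objects of \<open>\<W>\<close>.  Its morphisms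
  are cosets, and the composite of two cosets is the coset of the composite of representatives.
\<close>

definition stable_category ::
  "('o, 'm, 'k) lin_cat \<Rightarrow> 'o set \<Rightarrow> ('o, 'm set, 'k) lin_cat" where
  "stable_category \<C> \<W> =
     \<lparr>Obj = Obj \<C>,
      Hom = (\<lambda>A B. quotient_module (Hom \<C> A B) (factoring \<C> \<W> A B)),
      Ident = (\<lambda>A. factoring \<C> \<W> A A +>\<^bsub>Hom \<C> A A\<^esub> Ident \<C> A),
      Comp = (\<lambda>G F. {h. \<exists>A \<in> Obj \<C>. \<exists>B \<in> Obj \<C>. \<exists>C \<in> Obj \<C>.
        \<exists>f \<in> F \<inter> mor \<C> A B. \<exists>g \<in> G \<inter> mor \<C> B C.
          h \<in> factoring \<C> \<W> A C +>\<^bsub>Hom \<C> A C\<^esub> (g \<bullet>\<^bsub>\<C>\<^esub> f)})\<rparr>"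

definition stable_mor ::
  "('o, 'm, 'k) lin_cat \<Rightarrow> 'o set \<Rightarrow> 'o \<Rightarrow> 'o \<Rightarrow> 'm \<Rightarrow> 'm set" where
  "stable_mor \<C> \<W> A B f = factoring \<C> \<W> A B +>\<^bsub>Hom \<C> A B\<^esub> f"

definition additive_functor ::
  "('o, 'm, 'k) lin_cat \<Rightarrow> ('p, 'n, 'k) lin_cat \<Rightarrow> ('o \<Rightarrow> 'p) \<Rightarrow> ('m \<Rightarrow> 'n) \<Rightarrow> bool" where
  "additive_functor \<C> \<D> FO FM \<longleftrightarrow>
     (\<forall>A \<in> Obj \<C>. FO A \<in> Obj \<D>) \<and>
     (\<forall>A \<in> Obj \<C>. \<forall>B \<in> Obj \<C>. \<forall>f \<in> mor \<C> A B. FM f \<in> mor \<D> (FO A) (FO B)) \<and>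
     (\<forall>A \<in> Obj \<C>. FM (Ident \<C> A) = Ident \<D> (FO A)) \<and>
     (\<forall>A \<in> Obj \<C>. \<forall>B \<in> Obj \<C>. \<forall>C \<in> Obj \<C>. \<forall>f \<in> mor \<C> A B. \<forall>g \<in> mor \<C> B C.
        FM (g \<bullet>\<^bsub>\<C>\<^esub> f) = FM g \<bullet>\<^bsub>\<D>\<^esub> FM f) \<and>
     (\<forall>A \<in> Obj \<C>. \<forall>B \<in> Obj \<C>. \<forall>f \<in> mor \<C> A B. \<forall>g \<in> mor \<C> A B.
        FM (f \<oplus>\<^bsub>Hom \<C> A B\<^esub> g) = FM f \<oplus>\<^bsub>Hom \<D> (FO A) (FO B)\<^esub> FM g)"


section \<open>Auslander--Reiten theory\<close>

definition is_section :: "('o, 'm, 'k) lin_cat \<Rightarrow> 'o \<Rightarrow> 'o \<Rightarrow> 'm \<Rightarrow> bool" where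
  "is_section \<C> A B f \<longleftrightarrow> (\<exists>r \<in> mor \<C> B A. r \<bullet>\<^bsub>\<C>\<^esub> f = Ident \<C> A)"

definition is_retraction :: "('o, 'm, 'k) lin_cat \<Rightarrow> 'o \<Rightarrow> 'o \<Rightarrow> 'm \<Rightarrow> bool" where
  "is_retraction \<C> A B f \<longleftrightarrow> (\<exists>s \<in> mor \<C> B A. f \<bullet>\<^bsub>\<C>\<^esub> s = Ident \<C> B)"

definition source_morphism :: "('o, 'm, 'k) lin_cat \<Rightarrow> 'o \<Rightarrow> 'o \<Rightarrow> 'm \<Rightarrow> bool" where
  "source_morphism \<C> A B f \<longleftrightarrow> f \<in> mor \<C> A B \<and> \<not> is_section \<C> A B f \<and>
     (\<forall>C \<in> Obj \<C>. \<forall>u \<in> mor \<C> A C. \<not> is_section \<C> A C u \<longrightarrow>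
        (\<exists>v \<in> mor \<C> B C. v \<bullet>\<^bsub>\<C>\<^esub> f = u)) \<and>
     (\<forall>\<phi> \<in> mor \<C> B B. \<phi> \<bullet>\<^bsub>\<C>\<^esub> f = f \<longrightarrow> isomorphism \<C> B B \<phi>)"

definition sink_morphism :: "('o, 'm, 'k) lin_cat \<Rightarrow> 'o \<Rightarrow> 'o \<Rightarrow> 'm \<Rightarrow> bool" where
  "sink_morphism \<C> B C g \<longleftrightarrow> g \<in> mor \<C> B C \<and> \<not> is_retraction \<C> B C g \<and>
     (\<forall>A \<in> Obj \<C>. \<forall>u \<in> mor \<C> A C. \<not> is_retraction \<C> A C u \<longrightarrow>
        (\<exists>v \<in> mor \<C> A B. g \<bullet>\<^bsub>\<C>\<^esub> v = u)) \<and>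
     (\<forall>\<phi> \<in> mor \<C> B B. g \<bullet>\<^bsub>\<C>\<^esub> \<phi> = g \<longrightarrow> isomorphism \<C> B B \<phi>)"

definition AR_triangle_ends ::
  "('o, 'm, 'k) lin_cat \<Rightarrow> ('o, 'm, 'e) bifunctor \<Rightarrow> ('o, 'm, 'e) realization \<Rightarrow>
   'o \<Rightarrow> 'o \<Rightarrow> bool" where
  "AR_triangle_ends \<C> \<E> \<s> A C \<longleftrightarrow>
     (\<exists>f B g \<delta>. E_triangle \<C> \<E> \<s> A f B g C \<delta> \<and> source_morphism \<C> A B f \<and> sink_morphism \<C> B C g)"

text \<open>
  A choice of objects \<open>\<tau> C\<close> (determined up to isomorphism by the last three clauses) together with
  the action of \<open>\<tau>\<close> on morphisms as a functor \<open>\<C>/\<P> \<rightarrow> \<C>/\<I>\<close>; dually for \<open>\<tau>\<^sup>-\<^sup>1\<close>.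
\<close>

definition AR_translation ::
  "('o, 'm, 'k) lin_cat \<Rightarrow> ('o, 'm, 'e) bifunctor \<Rightarrow> ('o, 'm, 'e) realization \<Rightarrow>
   ('o \<Rightarrow> 'o) \<Rightarrow> ('m set \<Rightarrow> 'm set) \<Rightarrow> bool" where
  "AR_translation \<C> \<E> \<s> \<tau> \<tau>m \<longleftrightarrow>
     additive_functor (stable_category \<C> (Proj \<C> \<E> \<s>)) (stable_category \<C> (Inj \<C> \<E> \<s>)) \<tau> \<tau>m \<and>
     (\<forall>C. indecomposable \<C> C \<and> C \<notin> Proj \<C> \<E> \<s> \<longrightarrow> AR_triangle_ends \<C> \<E> \<s> (\<tau> C) C) \<and>
     (\<forall>P \<in> Proj \<C> \<E> \<s>. zero_object \<C> (\<tau> P)) \<and>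
     (\<forall>A B S. direct_sum \<C> A B S \<longrightarrow> direct_sum \<C> (\<tau> A) (\<tau> B) (\<tau> S))"

definition AR_cotranslation ::
  "('o, 'm, 'k) lin_cat \<Rightarrow> ('o, 'm, 'e) bifunctor \<Rightarrow> ('o, 'm, 'e) realization \<Rightarrow>
   ('o \<Rightarrow> 'o) \<Rightarrow> ('m set \<Rightarrow> 'm set) \<Rightarrow> bool" where
  "AR_cotranslation \<C> \<E> \<s> \<tau>' \<tau>m' \<longleftrightarrow>
     additive_functor (stable_category \<C> (Inj \<C> \<E> \<s>)) (stable_category \<C> (Proj \<C> \<E> \<s>)) \<tau>' \<tau>m' \<and>
     (\<forall>A. indecomposable \<C> A \<and> A \<notin> Inj \<C> \<E> \<s> \<longrightarrow> AR_triangle_ends \<C> \<E> \<s> A (\<tau>' A)) \<and>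
     (\<forall>I \<in> Inj \<C> \<E> \<s>. zero_object \<C> (\<tau>' I)) \<and>
     (\<forall>A B S. direct_sum \<C> A B S \<longrightarrow> direct_sum \<C> (\<tau>' A) (\<tau>' B) (\<tau>' S))"

text \<open>The additive group of \<open>D V = Hom\<^sub>K(V, K)\<close>.\<close>

definition dual_group :: "'k ring \<Rightarrow> ('k, 'v) module \<Rightarrow> ('v \<Rightarrow> 'k) monoid" where
  "dual_group K V =
     \<lparr>carrier = {\<phi> \<in> carrier V \<rightarrow>\<^sub>E carrier K.
        (\<forall>v \<in> carrier V. \<forall>w \<in> carrier V. \<phi> (v \<oplus>\<^bsub>V\<^esub> w) = \<phi> v \<oplus>\<^bsub>K\<^esub> \<phi> w) \<and>
        (\<forall>r \<in> carrier K. \<forall>v \<in> carrier V. \<phi> (r \<odot>\<^bsub>V\<^esub> v) = r \<otimes>\<^bsub>K\<^esub> \<phi> v)},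
      mult = (\<lambda>\<phi> \<psi>. \<lambda>v \<in> carrier V. \<phi> v \<oplus>\<^bsub>K\<^esub> \<psi> v),
      one = (\<lambda>v \<in> carrier V. \<zero>\<^bsub>K\<^esub>)\<rparr>"

text \<open>
  \<open>\<E>(A, B) \<simeq> D Hom\<^bsub>\<C>/\<I>\<^esub>(B, \<tau> A)\<close>, naturally in \<open>A\<close> and \<open>B\<close>: for \<open>a : A' \<rightarrow> A\<close> and
  \<open>b : B \<rightarrow> B'\<close> the map induced on the right-hand side sends a functional \<open>\<phi>\<close> to
  \<open>\<psi> \<mapsto> \<phi> (\<tau>(a) \<bullet> \<psi> \<bullet> b)\<close>.
\<close>

definition AR_duality ::
  "'k ring \<Rightarrow> ('o, 'm, 'k) lin_cat \<Rightarrow> ('o, 'm, 'e) bifunctor \<Rightarrow> ('o, 'm, 'e) realization \<Rightarrow>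
   ('o \<Rightarrow> 'o) \<Rightarrow> ('m set \<Rightarrow> 'm set) \<Rightarrow> bool" where
  "AR_duality K \<C> \<E> \<s> \<tau> \<tau>m \<longleftrightarrow>
     (let \<P> = Proj \<C> \<E> \<s>; \<I> = Inj \<C> \<E> \<s>; \<S> = stable_category \<C> \<I> in
      \<exists>\<Phi>.
       (\<forall>A \<in> Obj \<C>. \<forall>B \<in> Obj \<C>. \<Phi> A B \<in> iso (Ext \<E> A B) (dual_group K (Hom \<S> B (\<tau> A)))) \<and>
       (\<forall>A \<in> Obj \<C>. \<forall>B \<in> Obj \<C>. \<forall>A' \<in> Obj \<C>. \<forall>B' \<in> Obj \<C>.
          \<forall>a \<in> mor \<C> A' A. \<forall>b \<in> mor \<C> B B'. \<forall>\<delta> \<in> ext \<E> A B. \<forall>\<psi> \<in> mor \<S> B' (\<tau> A').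
            \<Phi> A' B' (ExtMap \<E> a b \<delta>) \<psi> =
            \<Phi> A B \<delta> (\<tau>m (stable_mor \<C> \<P> A' A a) \<bullet>\<^bsub>\<S>\<^esub> \<psi> \<bullet>\<^bsub>\<S>\<^esub> stable_mor \<C> \<I> B B' b)))"

text \<open>\<open>\<E>(A, B) \<simeq> D Hom\<^bsub>\<C>/\<P>\<^esub>(\<tau>\<^sup>-\<^sup>1 B, A)\<close>, naturally in \<open>A\<close> and \<open>B\<close>.\<close>

definition AR_coduality ::
  "'k ring \<Rightarrow> ('o, 'm, 'k) lin_cat \<Rightarrow> ('o, 'm, 'e) bifunctor \<Rightarrow> ('o, 'm, 'e) realization \<Rightarrow>
   ('o \<Rightarrow> 'o) \<Rightarrow> ('m set \<Rightarrow> 'm set) \<Rightarrow> bool" where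
  "AR_coduality K \<C> \<E> \<s> \<tau>' \<tau>m' \<longleftrightarrow>
     (let \<P> = Proj \<C> \<E> \<s>; \<I> = Inj \<C> \<E> \<s>; \<S> = stable_category \<C> \<P> in
      \<exists>\<Psi>.
       (\<forall>A \<in> Obj \<C>. \<forall>B \<in> Obj \<C>. \<Psi> A B \<in> iso (Ext \<E> A B) (dual_group K (Hom \<S> (\<tau>' B) A))) \<and>
       (\<forall>A \<in> Obj \<C>. \<forall>B \<in> Obj \<C>. \<forall>A' \<in> Obj \<C>. \<forall>B' \<in> Obj \<C>.
          \<forall>a \<in> mor \<C> A' A. \<forall>b \<in> mor \<C> B B'. \<forall>\<delta> \<in> ext \<E> A B. \<forall>\<psi> \<in> mor \<S> (\<tau>' B') A'.
            \<Psi> A' B' (ExtMap \<E> a b \<delta>) \<psi> =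
            \<Psi> A B \<delta> (stable_mor \<C> \<P> A' A a \<bullet>\<^bsub>\<S>\<^esub> \<psi> \<bullet>\<^bsub>\<S>\<^esub> \<tau>m' (stable_mor \<C> \<I> B B' b))))"


section \<open>Approximations and the relative structure\<close>

definition monic_for :: "('o, 'm, 'k) lin_cat \<Rightarrow> 'o set \<Rightarrow> 'o \<Rightarrow> 'o \<Rightarrow> 'm \<Rightarrow> bool" where
  "monic_for \<C> \<X> A B f \<longleftrightarrow> f \<in> mor \<C> A B \<and>
     (\<forall>X \<in> \<X>. (\<lambda>v. v \<bullet>\<^bsub>\<C>\<^esub> f) ` mor \<C> B X = mor \<C> A X)"

definition left_approximation :: "('o, 'm, 'k) lin_cat \<Rightarrow> 'o set \<Rightarrow> 'o \<Rightarrow> 'o \<Rightarrow> 'm \<Rightarrow> bool" where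
  "left_approximation \<C> \<X> A X f \<longleftrightarrow> X \<in> \<X> \<and> f \<in> mor \<C> A X \<and>
     (\<forall>X' \<in> \<X>. \<forall>u \<in> mor \<C> A X'. \<exists>v \<in> mor \<C> X X'. v \<bullet>\<^bsub>\<C>\<^esub> f = u)"

definition right_approximation :: "('o, 'm, 'k) lin_cat \<Rightarrow> 'o set \<Rightarrow> 'o \<Rightarrow> 'o \<Rightarrow> 'm \<Rightarrow> bool" where
  "right_approximation \<C> \<X> X A g \<longleftrightarrow> X \<in> \<X> \<and> g \<in> mor \<C> X A \<and>
     (\<forall>X' \<in> \<X>. \<forall>u \<in> mor \<C> X' A. \<exists>v \<in> mor \<C> X' X. g \<bullet>\<^bsub>\<C>\<^esub> v = u)"

definition strongly_functorially_finite ::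
  "('o, 'm, 'k) lin_cat \<Rightarrow> ('o, 'm, 'e) bifunctor \<Rightarrow> ('o, 'm, 'e) realization \<Rightarrow> 'o set \<Rightarrow> bool"
  where
  "strongly_functorially_finite \<C> \<E> \<s> \<X> \<longleftrightarrow>
     (\<forall>C \<in> Obj \<C>.
       (\<exists>A x X g \<delta>. E_triangle \<C> \<E> \<s> A x X g C \<delta> \<and> right_approximation \<C> \<X> X C g) \<and>
       (\<exists>f X y L \<delta>. E_triangle \<C> \<E> \<s> C f X y L \<delta> \<and> left_approximation \<C> \<X> C X f))"

definition indecomposables_outside ::
  "('o, 'm, 'k) lin_cat \<Rightarrow> 'o set \<Rightarrow> 'o set \<Rightarrow> 'o set" where
  "indecomposables_outside \<C> \<X> \<W> = {X \<in> \<X>. indecomposable \<C> X \<and> X \<notin> \<W>}"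

definition relative_ext ::
  "('o, 'm, 'k) lin_cat \<Rightarrow> ('o, 'm, 'e) bifunctor \<Rightarrow> ('o, 'm, 'e) realization \<Rightarrow> 'o set \<Rightarrow>
   ('o, 'm, 'e) bifunctor" where
  "relative_ext \<C> \<E> \<s> \<X> =
     \<lparr>Ext = (\<lambda>C A. (Ext \<E> C A)
        \<lparr>carrier := {\<delta> \<in> ext \<E> C A. \<forall>f B g. (f, B, g) \<in> \<s> C A \<delta> \<longrightarrow> monic_for \<C> \<X> A B f}\<rparr>),
      ExtMap = ExtMap \<E>\<rparr>"

text \<open>
  The restriction of \<open>\<s>\<close> to the extensions in \<open>\<E>\<close>; the value outside \<open>\<E>\<close> is an unused default.
\<close>

definition restrict_realization ::
  "('o, 'm, 'e) bifunctor \<Rightarrow> ('o, 'm, 'e) realization \<Rightarrow> ('o, 'm, 'e) realization" where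
  "restrict_realization \<E> \<s> = (\<lambda>C A. \<lambda>\<delta> \<in> ext \<E> C A. \<s> C A \<delta>)"

end

theory Submission
  imports Defs
begin

text \<open>
  By the long exact sequence, \<open>\<E>'(C, A)\<close> consists of the \<open>\<delta>\<close> with \<open>u\<^sub>* \<delta> = 0\<close> for all
  \<open>u : A \<rightarrow> X\<close> with \<open>X \<in> \<X>\<close>.  This is an additive subfunctor whose inflations and deflations are
  closed under composition, so \<open>(\<C>, \<E>', \<s>')\<close> is extriangulated, for any \<open>\<X>\<close>.

  The two dualities make the condition self-dual.  Under \<open>\<E>(C, A) \<simeq> D Hom\<^bsub>\<C>/\<I>\<^esub>(A, \<tau> C)\<close> it says
  that the functional of \<open>\<delta>\<close> kills the morphisms that factor through \<open>\<X>\<close>; for \<open>v : X \<rightarrow> C\<close>, the functional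
  of \<open>v\<^sup>* \<delta>\<close> is evaluated at \<open>\<psi> : A \<rightarrow> \<tau> X\<close> by composing with \<open>\<tau> v\<close>, and \<open>\<tau> X \<in> \<X>\<close>, so
  \<open>v\<^sup>* \<delta> = 0\<close>.  The other duality and \<open>\<tau>\<^sup>-\<^sup>1 \<X> \<subseteq> \<X>\<close> give the converse.  Hence the objects of \<open>\<X>\<close> are both
  projective and injective for \<open>\<E>'\<close>, the approximation triangles belong to \<open>\<E>'\<close>, and every relative
  projective or injective object lies in \<open>\<X>\<close>, since its approximation triangle splits.
\<close>

section \<open>Linear categories\<close>

text \<open>The hypothesis on \<X> speaks of \<open>\<tau>\<close> alone, and \<open>\<tau>\<close>
  and \<open>\<tau>'\<close> are separate choices of objects. That \<X> is stable under
  \<open>\<tau>'\<close> therefore rests on the fact that the starting term of an Auslander-Reiten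
  triangle determines its end term up to isomorphism: a non-injective indecomposable of \<X> is
  isomorphic to some \<open>\<tau> Y\<close> with Y in \<X>, so its image under
  \<open>\<tau>'\<close> is isomorphic to Y. Both stability statements are obtained for
  indecomposables and spread over \<X> by Krull-Schmidt decompositions.

  The dualities take values on Hom-sets modulo an ideal, while membership in \<open>\<E>'\<close> is
  tested on morphisms of \<C> itself. The bridge is that every stable morphism has a representative
  and that stable composites can be computed on representatives; this in turn requires the morphisms
  factoring through projectives, or through injectives, to be closed under addition.\<close>

context linear_category
begin

lemma Hom_abelian: "\<lbrakk>A \<in> Obj \<C>; B \<in> Obj \<C>\<rbrakk> \<Longrightarrow> abelian_group (Hom \<C> A B)"
  by (rule module.axioms(2)[OF Hom_module])

lemma zero_mor: "\<lbrakk>A \<in> Obj \<C>; B \<in> Obj \<C>\<rbrakk> \<Longrightarrow> \<zero>\<^bsub>Hom \<C> A B\<^esub> \<in> mor \<C> A B"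
  by (rule abelian_monoid.zero_closed[OF abelian_group.axioms(1)[OF Hom_abelian]])

lemma add_mor:
  "\<lbrakk>A \<in> Obj \<C>; B \<in> Obj \<C>; f \<in> mor \<C> A B; g \<in> mor \<C> A B\<rbrakk> \<Longrightarrow> f \<oplus>\<^bsub>Hom \<C> A B\<^esub> g \<in> mor \<C> A B"
  by (rule abelian_monoid.a_closed[OF abelian_group.axioms(1)[OF Hom_abelian]])

lemma uminus_mor:
  "\<lbrakk>A \<in> Obj \<C>; B \<in> Obj \<C>; f \<in> mor \<C> A B\<rbrakk> \<Longrightarrow> \<ominus>\<^bsub>Hom \<C> A B\<^esub> f \<in> mor \<C> A B"
  by (rule abelian_group.a_inv_closed[OF Hom_abelian])

text \<open>An additive map sends zero to an element equal to its own double. Through this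
  cancellation the bilinearity of composition yields the two laws for composing with a zero
  morphism.\<close>

lemma add_self_eq_zero:
  assumes "A \<in> Obj \<C>" "B \<in> Obj \<C>" "f \<in> mor \<C> A B" "f \<oplus>\<^bsub>Hom \<C> A B\<^esub> f = f"
  shows "f = \<zero>\<^bsub>Hom \<C> A B\<^esub>"
proof -
  interpret abelian_group "Hom \<C> A B" using assms by (simp add: Hom_abelian)
  show ?thesis using assms by (metis add.r_cancel_one')
qed

lemma zero_comp:
  assumes "A \<in> Obj \<C>" "B \<in> Obj \<C>" "C \<in> Obj \<C>" "f \<in> mor \<C> A B"
  shows "\<zero>\<^bsub>Hom \<C> B C\<^esub> \<bullet>\<^bsub>\<C>\<^esub> f = \<zero>\<^bsub>Hom \<C> A C\<^esub>"
proof -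
  interpret abelian_group "Hom \<C> B C" using assms by (simp add: Hom_abelian)
  show ?thesis
    using assms zero_mor Comp_mor
    by (intro add_self_eq_zero) (auto simp flip: Comp_add_left)
qed

lemma comp_zero:
  assumes "A \<in> Obj \<C>" "B \<in> Obj \<C>" "C \<in> Obj \<C>" "g \<in> mor \<C> B C"
  shows "g \<bullet>\<^bsub>\<C>\<^esub> \<zero>\<^bsub>Hom \<C> A B\<^esub> = \<zero>\<^bsub>Hom \<C> A C\<^esub>"
proof -
  interpret abelian_group "Hom \<C> A B" using assms by (simp add: Hom_abelian)
  show ?thesis
    using assms zero_mor Comp_mor
    by (intro add_self_eq_zero) (auto simp flip: Comp_add_right)
qed

lemma uminus_comp:
  assumes "A \<in> Obj \<C>" "B \<in> Obj \<C>" "C \<in> Obj \<C>" "f \<in> mor \<C> A B" "g \<in> mor \<C> B C"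
  shows "(\<ominus>\<^bsub>Hom \<C> B C\<^esub> g) \<bullet>\<^bsub>\<C>\<^esub> f = \<ominus>\<^bsub>Hom \<C> A C\<^esub> (g \<bullet>\<^bsub>\<C>\<^esub> f)"
proof -
  interpret BC: abelian_group "Hom \<C> B C" using assms by (simp add: Hom_abelian)
  interpret AC: abelian_group "Hom \<C> A C" using assms by (simp add: Hom_abelian)
  have "(\<ominus>\<^bsub>Hom \<C> B C\<^esub> g) \<bullet>\<^bsub>\<C>\<^esub> f \<oplus>\<^bsub>Hom \<C> A C\<^esub> g \<bullet>\<^bsub>\<C>\<^esub> f = \<zero>\<^bsub>Hom \<C> A C\<^esub>"
    using assms by (simp add: zero_comp BC.l_neg flip: Comp_add_left)
  then show ?thesis
    using assms by (metis AC.minus_equality BC.a_inv_closed Comp_mor)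
qed

lemma isomorphism_Ident: "A \<in> Obj \<C> \<Longrightarrow> isomorphism \<C> A A (Ident \<C> A)"
  unfolding isomorphism_def by (metis Ident_mor Ident_left)

lemma isomorphic_refl: "A \<in> Obj \<C> \<Longrightarrow> isomorphic \<C> A A"
  unfolding isomorphic_def by (metis isomorphism_Ident)

text \<open>Invertibility of the two composites supplies f with a left and a right inverse, and
  these agree. It serves for comparison maps between Auslander-Reiten triangles, whose composites
  are known to be automorphisms but need not be identities.\<close>

lemma isomorphism_factor_left:
  assumes "A \<in> Obj \<C>" "B \<in> Obj \<C>" "f \<in> mor \<C> A B" "g \<in> mor \<C> B A"
    and "isomorphism \<C> A A (g \<bullet>\<^bsub>\<C>\<^esub> f)" "isomorphism \<C> B B (f \<bullet>\<^bsub>\<C>\<^esub> g)"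
  shows "isomorphism \<C> A B f"
proof -
  obtain u where u: "u \<in> mor \<C> A A" "u \<bullet>\<^bsub>\<C>\<^esub> (g \<bullet>\<^bsub>\<C>\<^esub> f) = Ident \<C> A"
    using assms(5) unfolding isomorphism_def by blast
  obtain v where v: "v \<in> mor \<C> B B" "(f \<bullet>\<^bsub>\<C>\<^esub> g) \<bullet>\<^bsub>\<C>\<^esub> v = Ident \<C> B"
    using assms(6) unfolding isomorphism_def by blast
  define l where "l = u \<bullet>\<^bsub>\<C>\<^esub> g"
  define r where "r = g \<bullet>\<^bsub>\<C>\<^esub> v"
  have l: "l \<in> mor \<C> B A" "l \<bullet>\<^bsub>\<C>\<^esub> f = Ident \<C> A"
    using assms(1-4) u Comp_mor Comp_assoc[of A B A A f g u] unfolding l_def by auto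
  have r: "r \<in> mor \<C> B A" "f \<bullet>\<^bsub>\<C>\<^esub> r = Ident \<C> B"
    using assms(1-4) v Comp_mor Comp_assoc[of B B A B v g f] unfolding r_def by auto
  have "l = r"
    using assms(1-4) l r Comp_assoc[of B A B A r f l] Ident_left[of B A r] Ident_right[of B A l] by auto
  then show ?thesis
    using assms(3) l r unfolding isomorphism_def by blast
qed

section \<open>Zero objects, biproducts and indecomposables\<close>

lemma zero_object_Obj: "zero_object \<C> Z \<Longrightarrow> Z \<in> Obj \<C>"
  unfolding zero_object_def by blast

lemma zero_object_to: "\<lbrakk>zero_object \<C> Z; A \<in> Obj \<C>; f \<in> mor \<C> A Z\<rbrakk> \<Longrightarrow> f = \<zero>\<^bsub>Hom \<C> A Z\<^esub>"
  unfolding zero_object_def by blast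

lemma zero_object_if_Ident_zero:
  assumes "Z \<in> Obj \<C>" "Ident \<C> Z = \<zero>\<^bsub>Hom \<C> Z Z\<^esub>"
  shows "zero_object \<C> Z"
  unfolding zero_object_def
proof (intro conjI ballI)
  fix A assume A: "A \<in> Obj \<C>"
  have "f = \<zero>\<^bsub>Hom \<C> Z A\<^esub>" if "f \<in> mor \<C> Z A" for f
    using that assms A Ident_right comp_zero by metis
  then show "mor \<C> Z A = {\<zero>\<^bsub>Hom \<C> Z A\<^esub>}" using assms A zero_mor by blast
  have "f = \<zero>\<^bsub>Hom \<C> A Z\<^esub>" if "f \<in> mor \<C> A Z" for f
    using that assms A Ident_left zero_comp by metis
  then show "mor \<C> A Z = {\<zero>\<^bsub>Hom \<C> A Z\<^esub>}" using assms A zero_mor by blast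
qed (use assms in auto)

text \<open>Makes \<open>A \<rightarrow> A \<rightarrow> Z\<close> a realization of the zero
  extension, one of the two test triangles for exactness. The mirrored lemma provides
  \<open>Z \<rightarrow> A \<rightarrow> A\<close>.\<close>

lemma biproduct_zero_right:
  assumes "A \<in> Obj \<C>" "zero_object \<C> Z"
  shows "biproduct \<C> A Z A (Ident \<C> A) \<zero>\<^bsub>Hom \<C> Z A\<^esub> (Ident \<C> A) \<zero>\<^bsub>Hom \<C> A Z\<^esub>"
proof -
  have Z: "Z \<in> Obj \<C>" using assms(2) by (rule zero_object_Obj)
  interpret abelian_group "Hom \<C> A A" using assms by (simp add: Hom_abelian)
  show ?thesis
    unfolding biproduct_def
    using assms Z zero_object_to[OF assms(2) Z Ident_mor[OF Z]]
    by (simp add: Ident_mor zero_mor Ident_left Ident_right zero_comp comp_zero)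
qed

lemma biproduct_zero_left:
  assumes "A \<in> Obj \<C>" "zero_object \<C> Z"
  shows "biproduct \<C> Z A A \<zero>\<^bsub>Hom \<C> Z A\<^esub> (Ident \<C> A) \<zero>\<^bsub>Hom \<C> A Z\<^esub> (Ident \<C> A)"
proof -
  have Z: "Z \<in> Obj \<C>" using assms(2) by (rule zero_object_Obj)
  interpret abelian_group "Hom \<C> A A" using assms by (simp add: Hom_abelian)
  show ?thesis
    unfolding biproduct_def
    using assms Z zero_object_to[OF assms(2) Z Ident_mor[OF Z]]
    by (simp add: Ident_mor zero_mor Ident_left Ident_right zero_comp comp_zero)
qed

text \<open>Injections are transported along b, projections along its inverse c. The need arises
  because a realization determines its middle term only up to isomorphism, while a split extension
  is known to be realized by a chosen biproduct.\<close>

lemma direct_sum_isomorphic: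
  assumes "direct_sum \<C> A B S" "T \<in> Obj \<C>" "isomorphism \<C> S T b"
  shows "direct_sum \<C> A B T"
proof -
  obtain i j p q where bp: "biproduct \<C> A B S i j p q"
    using assms(1) unfolding direct_sum_def by blast
  then have ob: "A \<in> Obj \<C>" "B \<in> Obj \<C>" "S \<in> Obj \<C>"
    and m: "i \<in> mor \<C> A S" "j \<in> mor \<C> B S" "p \<in> mor \<C> S A" "q \<in> mor \<C> S B"
    and e: "p \<bullet>\<^bsub>\<C>\<^esub> i = Ident \<C> A" "q \<bullet>\<^bsub>\<C>\<^esub> j = Ident \<C> B"
      "p \<bullet>\<^bsub>\<C>\<^esub> j = \<zero>\<^bsub>Hom \<C> B A\<^esub>" "q \<bullet>\<^bsub>\<C>\<^esub> i = \<zero>\<^bsub>Hom \<C> A B\<^esub>"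
      "(i \<bullet>\<^bsub>\<C>\<^esub> p) \<oplus>\<^bsub>Hom \<C> S S\<^esub> (j \<bullet>\<^bsub>\<C>\<^esub> q) = Ident \<C> S"
    unfolding biproduct_def by auto
  obtain c where b: "b \<in> mor \<C> S T" and c: "c \<in> mor \<C> T S"
    and cb: "c \<bullet>\<^bsub>\<C>\<^esub> b = Ident \<C> S" and bc: "b \<bullet>\<^bsub>\<C>\<^esub> c = Ident \<C> T"
    using assms(3) unfolding isomorphism_def by blast
  note [simp] = ob m b c assms(2)
  \<comment> \<open>An inner c followed by b disappears, which reduces the four equations between
    transported projections and injections to those of S.\<close>
  have cancel: "(s \<bullet>\<^bsub>\<C>\<^esub> c) \<bullet>\<^bsub>\<C>\<^esub> (b \<bullet>\<^bsub>\<C>\<^esub> r) = s \<bullet>\<^bsub>\<C>\<^esub> r"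
    if [simp]: "R \<in> Obj \<C>" "R' \<in> Obj \<C>" "r \<in> mor \<C> R S" "s \<in> mor \<C> S R'" for R R' r s
  proof -
    have "(s \<bullet>\<^bsub>\<C>\<^esub> c) \<bullet>\<^bsub>\<C>\<^esub> (b \<bullet>\<^bsub>\<C>\<^esub> r) = ((s \<bullet>\<^bsub>\<C>\<^esub> c) \<bullet>\<^bsub>\<C>\<^esub> b) \<bullet>\<^bsub>\<C>\<^esub> r"
      by (rule Comp_assoc[of R S T R']) (auto intro: Comp_mor[of T S R'])
    also have "(s \<bullet>\<^bsub>\<C>\<^esub> c) \<bullet>\<^bsub>\<C>\<^esub> b = s \<bullet>\<^bsub>\<C>\<^esub> (c \<bullet>\<^bsub>\<C>\<^esub> b)"
      by (rule Comp_assoc[of S T S R', symmetric]) auto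
    also have "\<dots> = s" using cb Ident_right[of S R' s] by simp
    finally show ?thesis .
  qed
  \<comment> \<open>Exposes each transported idempotent as a conjugate by b, so that the
    decomposition of the identity of T follows from the one for S by additivity.\<close>
  have conj: "(b \<bullet>\<^bsub>\<C>\<^esub> r) \<bullet>\<^bsub>\<C>\<^esub> (s \<bullet>\<^bsub>\<C>\<^esub> c) = b \<bullet>\<^bsub>\<C>\<^esub> (r \<bullet>\<^bsub>\<C>\<^esub> s) \<bullet>\<^bsub>\<C>\<^esub> c"
    if [simp]: "R \<in> Obj \<C>" "r \<in> mor \<C> R S" "s \<in> mor \<C> S R" for R r s
  proof -
    have "b \<bullet>\<^bsub>\<C>\<^esub> (r \<bullet>\<^bsub>\<C>\<^esub> s) = (b \<bullet>\<^bsub>\<C>\<^esub> r) \<bullet>\<^bsub>\<C>\<^esub> s" by (rule Comp_assoc[of S R S T]) auto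
    then show ?thesis
      by (metis Comp_assoc[of T S R T c s "b \<bullet>\<^bsub>\<C>\<^esub> r"] Comp_mor[of R S T r b] that ob c b assms(2))
  qed
  have ip: "i \<bullet>\<^bsub>\<C>\<^esub> p \<in> mor \<C> S S" and jq: "j \<bullet>\<^bsub>\<C>\<^esub> q \<in> mor \<C> S S"
    by (rule Comp_mor[of S A S] Comp_mor[of S B S]; simp)+
  have "b \<bullet>\<^bsub>\<C>\<^esub> (i \<bullet>\<^bsub>\<C>\<^esub> p) \<bullet>\<^bsub>\<C>\<^esub> c \<oplus>\<^bsub>Hom \<C> T T\<^esub> b \<bullet>\<^bsub>\<C>\<^esub> (j \<bullet>\<^bsub>\<C>\<^esub> q) \<bullet>\<^bsub>\<C>\<^esub> c
      = (b \<bullet>\<^bsub>\<C>\<^esub> (i \<bullet>\<^bsub>\<C>\<^esub> p) \<oplus>\<^bsub>Hom \<C> S T\<^esub> b \<bullet>\<^bsub>\<C>\<^esub> (j \<bullet>\<^bsub>\<C>\<^esub> q)) \<bullet>\<^bsub>\<C>\<^esub> c"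
    using Comp_add_left[of T S T c "b \<bullet>\<^bsub>\<C>\<^esub> (i \<bullet>\<^bsub>\<C>\<^esub> p)" "b \<bullet>\<^bsub>\<C>\<^esub> (j \<bullet>\<^bsub>\<C>\<^esub> q)"]
      Comp_mor[of S S T _ b] ip jq by simp
  also have "b \<bullet>\<^bsub>\<C>\<^esub> (i \<bullet>\<^bsub>\<C>\<^esub> p) \<oplus>\<^bsub>Hom \<C> S T\<^esub> b \<bullet>\<^bsub>\<C>\<^esub> (j \<bullet>\<^bsub>\<C>\<^esub> q) = b"
    using Comp_add_right[of S S T "i \<bullet>\<^bsub>\<C>\<^esub> p" "j \<bullet>\<^bsub>\<C>\<^esub> q" b] ip jq e Ident_right[of S T b] by simp
  finally have sum: "b \<bullet>\<^bsub>\<C>\<^esub> (i \<bullet>\<^bsub>\<C>\<^esub> p) \<bullet>\<^bsub>\<C>\<^esub> c \<oplus>\<^bsub>Hom \<C> T T\<^esub> b \<bullet>\<^bsub>\<C>\<^esub> (j \<bullet>\<^bsub>\<C>\<^esub> q) \<bullet>\<^bsub>\<C>\<^esub> c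
      = Ident \<C> T" using bc by simp
  have "b \<bullet>\<^bsub>\<C>\<^esub> i \<in> mor \<C> A T" "b \<bullet>\<^bsub>\<C>\<^esub> j \<in> mor \<C> B T" "p \<bullet>\<^bsub>\<C>\<^esub> c \<in> mor \<C> T A" "q \<bullet>\<^bsub>\<C>\<^esub> c \<in> mor \<C> T B"
    by (rule Comp_mor[of _ S]; simp)+
  then have "biproduct \<C> A B T (b \<bullet>\<^bsub>\<C>\<^esub> i) (b \<bullet>\<^bsub>\<C>\<^esub> j) (p \<bullet>\<^bsub>\<C>\<^esub> c) (q \<bullet>\<^bsub>\<C>\<^esub> c)"
    unfolding biproduct_def using sum e by (simp add: cancel[of A A] cancel[of B B] cancel[of A B] cancel[of B A] conj[of A] conj[of B])
  then show ?thesis unfolding direct_sum_def by blast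
qed

text \<open>Connects the Krull-Schmidt hypothesis, phrased with local endomorphism rings, to the
  Auslander-Reiten conditions, phrased for indecomposables. For a decomposition of A the identity is
  the sum of the idempotents \<open>i p\<close> and \<open>j q\<close>, and locality makes one of
  them invertible.\<close>

lemma local_End_indecomposable:
  assumes "local_End \<C> A"
  shows "indecomposable \<C> A"
proof -
  have A: "A \<in> Obj \<C>" and nz: "Ident \<C> A \<noteq> \<zero>\<^bsub>Hom \<C> A A\<^esub>"
    and loc: "\<And>f g. \<lbrakk>f \<in> mor \<C> A A; g \<in> mor \<C> A A; isomorphism \<C> A A (f \<oplus>\<^bsub>Hom \<C> A A\<^esub> g)\<rbrakk>
      \<Longrightarrow> isomorphism \<C> A A f \<or> isomorphism \<C> A A g"
    using assms unfolding local_End_def by auto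
  \<comment> \<open>if the idempotent \<open>i p\<close> of a decomposition is invertible, then the complementary projection \<open>q\<close>,
    which satisfies \<open>q (i p) = 0\<close>, vanishes\<close>
  have key: "zero_object \<C> C"
    if bp: "biproduct \<C> B C A i j p q" and iso: "isomorphism \<C> A A (i \<bullet>\<^bsub>\<C>\<^esub> p)" for B C i j p q
  proof -
    have ob: "B \<in> Obj \<C>" "C \<in> Obj \<C>"
      and m: "i \<in> mor \<C> B A" "j \<in> mor \<C> C A" "p \<in> mor \<C> A B" "q \<in> mor \<C> A C"
      and e: "q \<bullet>\<^bsub>\<C>\<^esub> j = Ident \<C> C" "q \<bullet>\<^bsub>\<C>\<^esub> i = \<zero>\<^bsub>Hom \<C> B C\<^esub>"
      using bp unfolding biproduct_def by auto
    obtain k where k: "k \<in> mor \<C> A A" "(i \<bullet>\<^bsub>\<C>\<^esub> p) \<bullet>\<^bsub>\<C>\<^esub> k = Ident \<C> A"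
      using iso unfolding isomorphism_def by blast
    have pk: "p \<bullet>\<^bsub>\<C>\<^esub> k \<in> mor \<C> A B" using Comp_mor[of A A B k p] A ob m k by simp
    have "q = q \<bullet>\<^bsub>\<C>\<^esub> (i \<bullet>\<^bsub>\<C>\<^esub> (p \<bullet>\<^bsub>\<C>\<^esub> k))"
      using k Comp_assoc[of A A B A k p i] Ident_right[of A C q] A ob m by simp
    also have "\<dots> = \<zero>\<^bsub>Hom \<C> B C\<^esub> \<bullet>\<^bsub>\<C>\<^esub> (p \<bullet>\<^bsub>\<C>\<^esub> k)"
      using e Comp_assoc[of A B A C "p \<bullet>\<^bsub>\<C>\<^esub> k" i q] A ob m pk by simp
    also have "\<dots> = \<zero>\<^bsub>Hom \<C> A C\<^esub>" using zero_comp A ob pk by simp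
    finally have "Ident \<C> C = \<zero>\<^bsub>Hom \<C> C C\<^esub>"
      using e zero_comp[of C A C j] A ob m by simp
    then show ?thesis using ob zero_object_if_Ident_zero by blast
  qed
  have "zero_object \<C> B \<or> zero_object \<C> C" if ds: "direct_sum \<C> B C A" for B C
  proof -
    obtain i j p q where bp: "biproduct \<C> B C A i j p q"
      using ds unfolding direct_sum_def by blast
    then have ob: "B \<in> Obj \<C>" "C \<in> Obj \<C>"
      and m: "i \<in> mor \<C> B A" "j \<in> mor \<C> C A" "p \<in> mor \<C> A B" "q \<in> mor \<C> A C"
      and e: "(i \<bullet>\<^bsub>\<C>\<^esub> p) \<oplus>\<^bsub>Hom \<C> A A\<^esub> (j \<bullet>\<^bsub>\<C>\<^esub> q) = Ident \<C> A"
      unfolding biproduct_def by auto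
    interpret abelian_group "Hom \<C> A A" using A by (simp add: Hom_abelian)
    have ip: "i \<bullet>\<^bsub>\<C>\<^esub> p \<in> mor \<C> A A" "j \<bullet>\<^bsub>\<C>\<^esub> q \<in> mor \<C> A A"
      using A ob m Comp_mor by blast+
    \<comment> \<open>The auxiliary fact treats the idempotent of the left summand; exchanging the
      summands covers the other case.\<close>
    have bp': "biproduct \<C> C B A j i q p"
      using bp ip a_comm[of "i \<bullet>\<^bsub>\<C>\<^esub> p" "j \<bullet>\<^bsub>\<C>\<^esub> q"] unfolding biproduct_def by simp
    have "isomorphism \<C> A A (i \<bullet>\<^bsub>\<C>\<^esub> p) \<or> isomorphism \<C> A A (j \<bullet>\<^bsub>\<C>\<^esub> q)"
      using loc ip e A isomorphism_Ident by metis
    then show ?thesis using key[OF bp] key[OF bp'] by blast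
  qed
  moreover have "\<not> zero_object \<C> A"
    using zero_object_to[of A A] A Ident_mor nz by blast
  ultimately show ?thesis using A unfolding indecomposable_def by blast
qed

lemma subcategory_Obj: "subcategory \<C> \<X> \<Longrightarrow> \<X> \<subseteq> Obj \<C>"
  unfolding subcategory_def by blast

end

section \<open>Extriangulated categories\<close>

lemma seq_classI:
  assumes "B' \<in> Obj \<C>" "x' \<in> mor \<C> A B'" "y' \<in> mor \<C> B' C"
    and "isomorphism \<C> B B' b" "b \<bullet>\<^bsub>\<C>\<^esub> x = x'" "y' \<bullet>\<^bsub>\<C>\<^esub> b = y"
  shows "(x', B', y') \<in> seq_class \<C> A C (x, B, y)"
  using assms unfolding seq_class_def sequences_def by auto

context extriangulated_category
begin

section \<open>Calculus of pushforwards and pullbacks of extensions\<close>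

lemma Ext_comm_group: "\<lbrakk>C \<in> Obj \<C>; A \<in> Obj \<C>\<rbrakk> \<Longrightarrow> comm_group (Ext \<E> C A)"
  using ET1 unfolding biadditive_functor_def by (elim conjE) blast

lemma Ext_group: "\<lbrakk>C \<in> Obj \<C>; A \<in> Obj \<C>\<rbrakk> \<Longrightarrow> group (Ext \<E> C A)"
  by (rule comm_group.axioms(2)[OF Ext_comm_group])

lemma Ext_one: "\<lbrakk>C \<in> Obj \<C>; A \<in> Obj \<C>\<rbrakk> \<Longrightarrow> \<one>\<^bsub>Ext \<E> C A\<^esub> \<in> ext \<E> C A"
  by (rule monoid.one_closed[OF group.is_monoid[OF Ext_group]])

lemma ExtMap_hom:
  "\<lbrakk>C \<in> Obj \<C>; A \<in> Obj \<C>; C' \<in> Obj \<C>; A' \<in> Obj \<C>; c \<in> mor \<C> C' C; a \<in> mor \<C> A A'\<rbrakk>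
   \<Longrightarrow> ExtMap \<E> c a \<in> hom (Ext \<E> C A) (Ext \<E> C' A')"
  using ET1 unfolding biadditive_functor_def by (elim conjE) blast

lemma ExtMap_closed:
  "\<lbrakk>C \<in> Obj \<C>; A \<in> Obj \<C>; C' \<in> Obj \<C>; A' \<in> Obj \<C>; c \<in> mor \<C> C' C; a \<in> mor \<C> A A'; \<delta> \<in> ext \<E> C A\<rbrakk>
   \<Longrightarrow> ExtMap \<E> c a \<delta> \<in> ext \<E> C' A'"
  by (rule hom_in_carrier[OF ExtMap_hom])

lemma ExtMap_one:
  "\<lbrakk>C \<in> Obj \<C>; A \<in> Obj \<C>; C' \<in> Obj \<C>; A' \<in> Obj \<C>; c \<in> mor \<C> C' C; a \<in> mor \<C> A A'\<rbrakk>
   \<Longrightarrow> ExtMap \<E> c a \<one>\<^bsub>Ext \<E> C A\<^esub> = \<one>\<^bsub>Ext \<E> C' A'\<^esub>"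
  using hom_one[OF ExtMap_hom Ext_group Ext_group] by blast

lemma ExtMap_Ident:
  "\<lbrakk>C \<in> Obj \<C>; A \<in> Obj \<C>; \<delta> \<in> ext \<E> C A\<rbrakk> \<Longrightarrow> ExtMap \<E> (Ident \<C> C) (Ident \<C> A) \<delta> = \<delta>"
  using ET1 unfolding biadditive_functor_def by (elim conjE) blast

lemma ExtMap_Comp:
  "\<lbrakk>C \<in> Obj \<C>; A \<in> Obj \<C>; C' \<in> Obj \<C>; A' \<in> Obj \<C>; C'' \<in> Obj \<C>; A'' \<in> Obj \<C>;
    c \<in> mor \<C> C' C; a \<in> mor \<C> A A'; c' \<in> mor \<C> C'' C'; a' \<in> mor \<C> A' A''; \<delta> \<in> ext \<E> C A\<rbrakk>
   \<Longrightarrow> ExtMap \<E> c' a' (ExtMap \<E> c a \<delta>) = ExtMap \<E> (c \<bullet>\<^bsub>\<C>\<^esub> c') (a' \<bullet>\<^bsub>\<C>\<^esub> a) \<delta>"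
  using ET1 unfolding biadditive_functor_def by (elim conjE) simp

lemma ExtMap_add_right:
  "\<lbrakk>C \<in> Obj \<C>; A \<in> Obj \<C>; C' \<in> Obj \<C>; A' \<in> Obj \<C>; c \<in> mor \<C> C' C; a \<in> mor \<C> A A';
    a' \<in> mor \<C> A A'; \<delta> \<in> ext \<E> C A\<rbrakk>
   \<Longrightarrow> ExtMap \<E> c (a \<oplus>\<^bsub>Hom \<C> A A'\<^esub> a') \<delta> =
       ExtMap \<E> c a \<delta> \<otimes>\<^bsub>Ext \<E> C' A'\<^esub> ExtMap \<E> c a' \<delta>"
  using ET1 unfolding biadditive_functor_def by (elim conjE) simp

lemma ExtMap_add_left:
  "\<lbrakk>C \<in> Obj \<C>; A \<in> Obj \<C>; C' \<in> Obj \<C>; A' \<in> Obj \<C>; c \<in> mor \<C> C' C; c' \<in> mor \<C> C' C;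
    a \<in> mor \<C> A A'; \<delta> \<in> ext \<E> C A\<rbrakk>
   \<Longrightarrow> ExtMap \<E> (c \<oplus>\<^bsub>Hom \<C> C' C\<^esub> c') a \<delta> =
       ExtMap \<E> c a \<delta> \<otimes>\<^bsub>Ext \<E> C' A'\<^esub> ExtMap \<E> c' a \<delta>"
  using ET1 unfolding biadditive_functor_def by (elim conjE) simp

lemma push_closed:
  "\<lbrakk>C \<in> Obj \<C>; A \<in> Obj \<C>; A' \<in> Obj \<C>; a \<in> mor \<C> A A'; \<delta> \<in> ext \<E> C A\<rbrakk>
   \<Longrightarrow> push \<C> \<E> C a \<delta> \<in> ext \<E> C A'"
  unfolding push_def by (rule ExtMap_closed[of C A]) (auto intro: Ident_mor)

lemma pull_closed:
  "\<lbrakk>C \<in> Obj \<C>; A \<in> Obj \<C>; C' \<in> Obj \<C>; c \<in> mor \<C> C' C; \<delta> \<in> ext \<E> C A\<rbrakk>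
   \<Longrightarrow> pull \<C> \<E> A c \<delta> \<in> ext \<E> C' A"
  unfolding pull_def by (rule ExtMap_closed[of C A]) (auto intro: Ident_mor)

lemma push_one:
  "\<lbrakk>C \<in> Obj \<C>; A \<in> Obj \<C>; A' \<in> Obj \<C>; a \<in> mor \<C> A A'\<rbrakk>
   \<Longrightarrow> push \<C> \<E> C a \<one>\<^bsub>Ext \<E> C A\<^esub> = \<one>\<^bsub>Ext \<E> C A'\<^esub>"
  unfolding push_def by (rule ExtMap_one) (auto intro: Ident_mor)

lemma pull_one:
  "\<lbrakk>C \<in> Obj \<C>; A \<in> Obj \<C>; C' \<in> Obj \<C>; c \<in> mor \<C> C' C\<rbrakk>
   \<Longrightarrow> pull \<C> \<E> A c \<one>\<^bsub>Ext \<E> C A\<^esub> = \<one>\<^bsub>Ext \<E> C' A\<^esub>"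
  unfolding pull_def by (rule ExtMap_one) (auto intro: Ident_mor)

lemma push_Ident: "\<lbrakk>C \<in> Obj \<C>; A \<in> Obj \<C>; \<delta> \<in> ext \<E> C A\<rbrakk> \<Longrightarrow> push \<C> \<E> C (Ident \<C> A) \<delta> = \<delta>"
  unfolding push_def by (rule ExtMap_Ident)

lemma pull_Ident: "\<lbrakk>C \<in> Obj \<C>; A \<in> Obj \<C>; \<delta> \<in> ext \<E> C A\<rbrakk> \<Longrightarrow> pull \<C> \<E> A (Ident \<C> C) \<delta> = \<delta>"
  unfolding pull_def by (rule ExtMap_Ident)

lemma push_push:
  "\<lbrakk>C \<in> Obj \<C>; A \<in> Obj \<C>; A' \<in> Obj \<C>; A'' \<in> Obj \<C>; a \<in> mor \<C> A A'; a' \<in> mor \<C> A' A''; \<delta> \<in> ext \<E> C A\<rbrakk>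
   \<Longrightarrow> push \<C> \<E> C a' (push \<C> \<E> C a \<delta>) = push \<C> \<E> C (a' \<bullet>\<^bsub>\<C>\<^esub> a) \<delta>"
  unfolding push_def
  using ExtMap_Comp[of C A C A' C A'' "Ident \<C> C" a "Ident \<C> C" a' \<delta>]
  by (simp add: Ident_mor Ident_left[of C C])

lemma pull_pull:
  "\<lbrakk>C \<in> Obj \<C>; A \<in> Obj \<C>; C' \<in> Obj \<C>; C'' \<in> Obj \<C>; c \<in> mor \<C> C' C; c' \<in> mor \<C> C'' C'; \<delta> \<in> ext \<E> C A\<rbrakk>
   \<Longrightarrow> pull \<C> \<E> A c' (pull \<C> \<E> A c \<delta>) = pull \<C> \<E> A (c \<bullet>\<^bsub>\<C>\<^esub> c') \<delta>"
  unfolding pull_def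
  using ExtMap_Comp[of C A C' A C'' A c "Ident \<C> A" c' "Ident \<C> A" \<delta>]
  by (simp add: Ident_mor Ident_left[of A A])

lemma ExtMap_eq_pull_push:
  "\<lbrakk>C \<in> Obj \<C>; A \<in> Obj \<C>; C' \<in> Obj \<C>; A' \<in> Obj \<C>; c \<in> mor \<C> C' C; a \<in> mor \<C> A A'; \<delta> \<in> ext \<E> C A\<rbrakk>
   \<Longrightarrow> ExtMap \<E> c a \<delta> = pull \<C> \<E> A' c (push \<C> \<E> C a \<delta>)"
  unfolding pull_def push_def
  using ExtMap_Comp[of C A C A' C' A' "Ident \<C> C" a c "Ident \<C> A'" \<delta>]
  by (simp add: Ident_mor Ident_left[of A A'] Ident_left[of C' C])

lemma ExtMap_eq_push_pull:
  "\<lbrakk>C \<in> Obj \<C>; A \<in> Obj \<C>; C' \<in> Obj \<C>; A' \<in> Obj \<C>; c \<in> mor \<C> C' C; a \<in> mor \<C> A A'; \<delta> \<in> ext \<E> C A\<rbrakk>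
   \<Longrightarrow> ExtMap \<E> c a \<delta> = push \<C> \<E> C' a (pull \<C> \<E> A c \<delta>)"
  unfolding pull_def push_def
  using ExtMap_Comp[of C A C' A C' A' c "Ident \<C> A" "Ident \<C> C'" a \<delta>]
  by (simp add: Ident_mor Ident_right[of A A'] Ident_right[of C' C])

lemma push_pull:
  "\<lbrakk>C \<in> Obj \<C>; A \<in> Obj \<C>; C' \<in> Obj \<C>; A' \<in> Obj \<C>; c \<in> mor \<C> C' C; a \<in> mor \<C> A A'; \<delta> \<in> ext \<E> C A\<rbrakk>
   \<Longrightarrow> push \<C> \<E> C' a (pull \<C> \<E> A c \<delta>) = pull \<C> \<E> A' c (push \<C> \<E> C a \<delta>)"
  using ExtMap_eq_push_pull ExtMap_eq_pull_push by metis

lemma push_add: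
  "\<lbrakk>C \<in> Obj \<C>; A \<in> Obj \<C>; A' \<in> Obj \<C>; a \<in> mor \<C> A A'; a' \<in> mor \<C> A A'; \<delta> \<in> ext \<E> C A\<rbrakk>
   \<Longrightarrow> push \<C> \<E> C (a \<oplus>\<^bsub>Hom \<C> A A'\<^esub> a') \<delta> = push \<C> \<E> C a \<delta> \<otimes>\<^bsub>Ext \<E> C A'\<^esub> push \<C> \<E> C a' \<delta>"
  unfolding push_def by (rule ExtMap_add_right) (auto intro: Ident_mor)

lemma pull_add:
  "\<lbrakk>C \<in> Obj \<C>; A \<in> Obj \<C>; C' \<in> Obj \<C>; c \<in> mor \<C> C' C; c' \<in> mor \<C> C' C; \<delta> \<in> ext \<E> C A\<rbrakk>
   \<Longrightarrow> pull \<C> \<E> A (c \<oplus>\<^bsub>Hom \<C> C' C\<^esub> c') \<delta> = pull \<C> \<E> A c \<delta> \<otimes>\<^bsub>Ext \<E> C' A\<^esub> pull \<C> \<E> A c' \<delta>"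
  unfolding pull_def by (rule ExtMap_add_left) (auto intro: Ident_mor)

section \<open>Realizations and exactness\<close>

lemma realization_mor:
  assumes "C \<in> Obj \<C>" "A \<in> Obj \<C>" "\<delta> \<in> ext \<E> C A" "(x, B, y) \<in> \<s> C A \<delta>"
  shows "B \<in> Obj \<C>" "x \<in> mor \<C> A B" "y \<in> mor \<C> B C"
proof -
  have "(x, B, y) \<in> sequences \<C> A C"
    using ET2_class[OF assms(1-3)] assms(4) unfolding seq_class_def by auto
  then show "B \<in> Obj \<C>" "x \<in> mor \<C> A B" "y \<in> mor \<C> B C" unfolding sequences_def by auto
qed

lemma realization_exists:
  assumes "C \<in> Obj \<C>" "A \<in> Obj \<C>" "\<delta> \<in> ext \<E> C A"
  obtains x B y where "(x, B, y) \<in> \<s> C A \<delta>"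
proof -
  obtain x B y where t: "(x, B, y) \<in> sequences \<C> A C" "\<s> C A \<delta> = seq_class \<C> A C (x, B, y)"
    using ET2_class[OF assms] by auto
  then have "(x, B, y) \<in> seq_class \<C> A C (x, B, y)"
    using assms Ident_left Ident_right isomorphism_Ident
    by (intro seq_classI[where b = "Ident \<C> B"]) (auto simp: sequences_def)
  then show ?thesis using that t by blast
qed

lemma realization_biproduct:
  assumes "biproduct \<C> A C S i j p q"
  shows "(i, S, q) \<in> \<s> C A \<one>\<^bsub>Ext \<E> C A\<^esub>"
proof -
  have "S \<in> Obj \<C>" "A \<in> Obj \<C>" "C \<in> Obj \<C>" "i \<in> mor \<C> A S" "q \<in> mor \<C> S C"
    using assms unfolding biproduct_def by auto
  then show ?thesis
    unfolding ET2_zero[OF assms]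
    using Ident_left Ident_right isomorphism_Ident by (intro seq_classI[where b = "Ident \<C> S"]) auto
qed

text \<open>Comparing a triangle with \<open>X \<rightarrow> X \<rightarrow> 0\<close> yields the part
  \<open>\<C>(C, X) \<rightarrow> \<C>(B, X) \<rightarrow> \<C>(A, X) \<rightarrow> \<E>(C, X)\<close> of the long exact sequence; dually below with \<open>0 \<rightarrow> W \<rightarrow> W\<close>.\<close>

lemma push_eq_one_iff:
  assumes "C \<in> Obj \<C>" "A \<in> Obj \<C>" "\<delta> \<in> ext \<E> C A" "(x, B, y) \<in> \<s> C A \<delta>"
    and "X \<in> Obj \<C>" "u \<in> mor \<C> A X"
  shows "push \<C> \<E> C u \<delta> = \<one>\<^bsub>Ext \<E> C X\<^esub> \<longleftrightarrow> (\<exists>v \<in> mor \<C> B X. v \<bullet>\<^bsub>\<C>\<^esub> x = u)"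
proof -
  obtain Z where zo: "zero_object \<C> Z" using zero_exists by blast
  then have Z: "Z \<in> Obj \<C>" by (rule zero_object_Obj)
  note bp = realization_biproduct[OF biproduct_zero_right[OF assms(5) zo]]
  note B = realization_mor[OF assms(1-4)]
  show ?thesis
  proof
    assume "push \<C> \<E> C u \<delta> = \<one>\<^bsub>Ext \<E> C X\<^esub>"
    \<comment> \<open>Both sides are zero, so u and the zero morphism
      \<open>C \<rightarrow> Z\<close> form a morphism from \<delta> to the zero extension realized
      by \<open>X \<rightarrow> X \<rightarrow> Z\<close>. The middle map realizing it is the
      desired extension of u along x.\<close>
    then have "push \<C> \<E> C u \<delta> = pull \<C> \<E> X \<zero>\<^bsub>Hom \<C> C Z\<^esub> \<one>\<^bsub>Ext \<E> Z X\<^esub>"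
      using pull_one[of Z X C] assms Z zero_mor by simp
    then obtain b where "b \<in> mor \<C> B X" "b \<bullet>\<^bsub>\<C>\<^esub> x = Ident \<C> X \<bullet>\<^bsub>\<C>\<^esub> u"
      using ET2_morphism[OF assms(2,1,5) Z assms(3) _ assms(6) _ _ assms(4) bp] Ext_one zero_mor assms Z
      by blast
    then show "\<exists>v \<in> mor \<C> B X. v \<bullet>\<^bsub>\<C>\<^esub> x = u" using Ident_left assms by metis
  next
    assume "\<exists>v \<in> mor \<C> B X. v \<bullet>\<^bsub>\<C>\<^esub> x = u"
    then obtain v where v: "v \<in> mor \<C> B X" "v \<bullet>\<^bsub>\<C>\<^esub> x = Ident \<C> X \<bullet>\<^bsub>\<C>\<^esub> u"
      using Ident_left assms by metis
    \<comment> \<open>Conversely, (ET3) completes the square given by v, and it presents the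
      pushforward as a pullback of a zero extension.\<close>
    obtain c where "c \<in> mor \<C> C Z" "push \<C> \<E> C u \<delta> = pull \<C> \<E> X c \<one>\<^bsub>Ext \<E> Z X\<^esub>"
      using ET3[OF assms(2,1,5) Z assms(3) _ assms(4) bp assms(6) v] Ext_one assms Z by blast
    then show "push \<C> \<E> C u \<delta> = \<one>\<^bsub>Ext \<E> C X\<^esub>" using pull_one assms Z by simp
  qed
qed

lemma pull_eq_one_iff:
  assumes "C \<in> Obj \<C>" "A \<in> Obj \<C>" "\<delta> \<in> ext \<E> C A" "(x, B, y) \<in> \<s> C A \<delta>"
    and "W \<in> Obj \<C>" "w \<in> mor \<C> W C"
  shows "pull \<C> \<E> A w \<delta> = \<one>\<^bsub>Ext \<E> W A\<^esub> \<longleftrightarrow> (\<exists>v \<in> mor \<C> W B. y \<bullet>\<^bsub>\<C>\<^esub> v = w)"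
proof -
  obtain Z where zo: "zero_object \<C> Z" using zero_exists by blast
  then have Z: "Z \<in> Obj \<C>" by (rule zero_object_Obj)
  note bp = realization_biproduct[OF biproduct_zero_left[OF assms(5) zo]]
  note B = realization_mor[OF assms(1-4)]
  show ?thesis
  proof
    assume "pull \<C> \<E> A w \<delta> = \<one>\<^bsub>Ext \<E> W A\<^esub>"
    then have "push \<C> \<E> W \<zero>\<^bsub>Hom \<C> Z A\<^esub> \<one>\<^bsub>Ext \<E> W Z\<^esub> = pull \<C> \<E> A w \<delta>"
      using push_one[of W Z A] assms Z zero_mor by simp
    then obtain b where "b \<in> mor \<C> W B" "y \<bullet>\<^bsub>\<C>\<^esub> b = w \<bullet>\<^bsub>\<C>\<^esub> Ident \<C> W"
      using ET2_morphism[OF Z assms(5,2,1) _ assms(3) _ assms(6) _ bp assms(4)] Ext_one zero_mor assms Z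
      by blast
    then show "\<exists>v \<in> mor \<C> W B. y \<bullet>\<^bsub>\<C>\<^esub> v = w" using Ident_right assms by metis
  next
    assume "\<exists>v \<in> mor \<C> W B. y \<bullet>\<^bsub>\<C>\<^esub> v = w"
    then obtain v where v: "v \<in> mor \<C> W B" "w \<bullet>\<^bsub>\<C>\<^esub> Ident \<C> W = y \<bullet>\<^bsub>\<C>\<^esub> v"
      using Ident_right assms by metis
    obtain a where "a \<in> mor \<C> Z A" "push \<C> \<E> W a \<one>\<^bsub>Ext \<E> W Z\<^esub> = pull \<C> \<E> A w \<delta>"
      using ET3_op[OF Z assms(5,2,1) _ assms(3) bp assms(4) v(1) assms(6) v(2)] Ext_one assms Z by blast
    then show "pull \<C> \<E> A w \<delta> = \<one>\<^bsub>Ext \<E> W A\<^esub>" using push_one assms Z by simp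
  qed
qed

text \<open>Exactness at the middle term. Since \<open>u x\<close> is zero it factors through the
  zero object, so u is the middle map of a square from the triangle to
  \<open>Z \<rightarrow> X \<rightarrow> X\<close>, and (ET3) supplies the map on end terms. Only
  existence is obtained: y is a weak cokernel of x.\<close>

lemma factor_through_deflation:
  assumes "C \<in> Obj \<C>" "A \<in> Obj \<C>" "\<delta> \<in> ext \<E> C A" "(x, B, y) \<in> \<s> C A \<delta>"
    and "X \<in> Obj \<C>" "u \<in> mor \<C> B X" "u \<bullet>\<^bsub>\<C>\<^esub> x = \<zero>\<^bsub>Hom \<C> A X\<^esub>"
  obtains w where "w \<in> mor \<C> C X" "w \<bullet>\<^bsub>\<C>\<^esub> y = u"
proof -
  obtain Z where zo: "zero_object \<C> Z" using zero_exists by blast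
  then have Z: "Z \<in> Obj \<C>" by (rule zero_object_Obj)
  note bp = realization_biproduct[OF biproduct_zero_left[OF assms(5) zo]]
  have "u \<bullet>\<^bsub>\<C>\<^esub> x = \<zero>\<^bsub>Hom \<C> Z X\<^esub> \<bullet>\<^bsub>\<C>\<^esub> \<zero>\<^bsub>Hom \<C> A Z\<^esub>"
    using zero_comp[of A Z X] assms Z zero_mor by simp
  then obtain c where "c \<in> mor \<C> C X" "c \<bullet>\<^bsub>\<C>\<^esub> y = Ident \<C> X \<bullet>\<^bsub>\<C>\<^esub> u"
    using ET3[OF assms(2,1) Z assms(5,3) Ext_one[OF assms(5) Z] assms(4) bp zero_mor[OF assms(2) Z]
        assms(6)] by blast
  then show ?thesis using that Ident_left[of B X u] realization_mor[OF assms(1-4)] assms by simp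
qed

text \<open>Lifting the identity of P splits every triangle ending in P, and the pullback criterion
  turns such a splitting into the vanishing of \<delta>. The resulting description mentions
  extension groups alone, which makes it convenient for the original and for the relative
  structure.\<close>

lemma Proj_iff:
  "P \<in> Proj \<C> \<E> \<s> \<longleftrightarrow> P \<in> Obj \<C> \<and> (\<forall>A \<in> Obj \<C>. \<forall>\<delta> \<in> ext \<E> P A. \<delta> = \<one>\<^bsub>Ext \<E> P A\<^esub>)"
proof (intro iffI conjI ballI)
  assume P: "P \<in> Proj \<C> \<E> \<s>"
  then show PO: "P \<in> Obj \<C>" unfolding Proj_def by blast
  fix A \<delta> assume A: "A \<in> Obj \<C>" and d: "\<delta> \<in> ext \<E> P A"
  obtain x B y where t: "(x, B, y) \<in> \<s> P A \<delta>" using realization_exists[OF PO A d] .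
  then have "\<exists>v \<in> mor \<C> P B. y \<bullet>\<^bsub>\<C>\<^esub> v = Ident \<C> P"
    using P PO A d Ident_mor unfolding Proj_def E_triangle_def by blast
  then show "\<delta> = \<one>\<^bsub>Ext \<E> P A\<^esub>"
    using pull_eq_one_iff[OF PO A d t PO Ident_mor[OF PO]] pull_Ident PO A d by simp
next
  assume "P \<in> Obj \<C> \<and> (\<forall>A \<in> Obj \<C>. \<forall>\<delta> \<in> ext \<E> P A. \<delta> = \<one>\<^bsub>Ext \<E> P A\<^esub>)"
  then show "P \<in> Proj \<C> \<E> \<s>"
    unfolding Proj_def E_triangle_def using pull_eq_one_iff pull_closed by blast
qed

lemma Inj_iff:
  "I \<in> Inj \<C> \<E> \<s> \<longleftrightarrow> I \<in> Obj \<C> \<and> (\<forall>C \<in> Obj \<C>. \<forall>\<delta> \<in> ext \<E> C I. \<delta> = \<one>\<^bsub>Ext \<E> C I\<^esub>)"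
proof (intro iffI conjI ballI)
  assume I: "I \<in> Inj \<C> \<E> \<s>"
  then show IO: "I \<in> Obj \<C>" unfolding Inj_def by blast
  fix C \<delta> assume C: "C \<in> Obj \<C>" and d: "\<delta> \<in> ext \<E> C I"
  obtain x B y where t: "(x, B, y) \<in> \<s> C I \<delta>" using realization_exists[OF C IO d] .
  then have "\<exists>v \<in> mor \<C> B I. v \<bullet>\<^bsub>\<C>\<^esub> x = Ident \<C> I"
    using I IO C d Ident_mor unfolding Inj_def E_triangle_def by blast
  then show "\<delta> = \<one>\<^bsub>Ext \<E> C I\<^esub>"
    using push_eq_one_iff[OF C IO d t IO Ident_mor[OF IO]] push_Ident IO C d by simp
next
  assume "I \<in> Obj \<C> \<and> (\<forall>C \<in> Obj \<C>. \<forall>\<delta> \<in> ext \<E> C I. \<delta> = \<one>\<^bsub>Ext \<E> C I\<^esub>)"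
  then show "I \<in> Inj \<C> \<E> \<s>"
    unfolding Inj_def E_triangle_def using push_eq_one_iff push_closed by blast
qed

text \<open>Any two realizations of zero have isomorphic middle terms, and one of them is a
  biproduct. This is what exhibits a relative projective or injective object as a direct summand of
  its approximation.\<close>

lemma split_triangle_direct_sum:
  assumes "A \<in> Obj \<C>" "C \<in> Obj \<C>" "(x, B, y) \<in> \<s> C A \<one>\<^bsub>Ext \<E> C A\<^esub>"
  shows "direct_sum \<C> A C B"
proof -
  obtain S i j p q where bp: "biproduct \<C> A C S i j p q"
    using direct_sum_exists[OF assms(1,2)] unfolding direct_sum_def by blast
  then have "(x, B, y) \<in> seq_class \<C> A C (i, S, q)"
    using assms(3) ET2_zero by blast
  then obtain b where "isomorphism \<C> S B b" "B \<in> Obj \<C>"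
    unfolding seq_class_def sequences_def by blast
  moreover have "direct_sum \<C> A C S" using bp unfolding direct_sum_def by blast
  ultimately show ?thesis using direct_sum_isomorphic by blast
qed

lemma Ident_zero_object_add:
  assumes "zero_object \<C> Z"
  shows "Ident \<C> Z \<oplus>\<^bsub>Hom \<C> Z Z\<^esub> Ident \<C> Z = Ident \<C> Z"
  using assms zero_object_Obj zero_object_to Ident_mor add_mor by metis

text \<open>The identity of Z equals its own double, so additivity of the extension functor in this
  variable gives \<open>\<delta> + \<delta> = \<delta>\<close>.\<close>

lemma zero_object_Inj:
  assumes "zero_object \<C> Z" shows "Z \<in> Inj \<C> \<E> \<s>"
  unfolding Inj_iff
proof (intro conjI ballI)
  show Z: "Z \<in> Obj \<C>" using assms by (rule zero_object_Obj)
  fix C \<delta> assume C: "C \<in> Obj \<C>" and d: "\<delta> \<in> ext \<E> C Z"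
  interpret G: group "Ext \<E> C Z" using Ext_group C Z by blast
  have "\<delta> \<otimes>\<^bsub>Ext \<E> C Z\<^esub> \<delta> = \<delta>"
    using push_add[OF C Z Z Ident_mor[OF Z] Ident_mor[OF Z] d] Ident_zero_object_add[OF assms]
      push_Ident[OF C Z d] by simp
  then show "\<delta> = \<one>\<^bsub>Ext \<E> C Z\<^esub>" using d G.l_cancel_one' by metis
qed

lemma zero_object_Proj:
  assumes "zero_object \<C> Z" shows "Z \<in> Proj \<C> \<E> \<s>"
  unfolding Proj_iff
proof (intro conjI ballI)
  show Z: "Z \<in> Obj \<C>" using assms by (rule zero_object_Obj)
  fix A \<delta> assume A: "A \<in> Obj \<C>" and d: "\<delta> \<in> ext \<E> Z A"
  interpret G: group "Ext \<E> Z A" using Ext_group A Z by blast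
  have "\<delta> \<otimes>\<^bsub>Ext \<E> Z A\<^esub> \<delta> = \<delta>"
    using pull_add[OF Z A Z Ident_mor[OF Z] Ident_mor[OF Z] d] Ident_zero_object_add[OF assms]
      pull_Ident[OF Z A d] by simp
  then show "\<delta> = \<one>\<^bsub>Ext \<E> Z A\<^esub>" using d G.l_cancel_one' by metis
qed

text \<open>The identity of S is \<open>i p + j q\<close>, so \<delta> is the sum of its
  pushforwards along these idempotents. Each passes through an extension group of A or B in the
  second variable, which vanishes.\<close>

lemma direct_sum_Inj:
  assumes "direct_sum \<C> A B S" "A \<in> Inj \<C> \<E> \<s>" "B \<in> Inj \<C> \<E> \<s>"
  shows "S \<in> Inj \<C> \<E> \<s>"
  unfolding Inj_iff
proof (intro conjI ballI)
  obtain i j p q where bp: "biproduct \<C> A B S i j p q" using assms unfolding direct_sum_def by blast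
  then have ob: "A \<in> Obj \<C>" "B \<in> Obj \<C>" "S \<in> Obj \<C>"
    and m: "i \<in> mor \<C> A S" "j \<in> mor \<C> B S" "p \<in> mor \<C> S A" "q \<in> mor \<C> S B"
    and e: "(i \<bullet>\<^bsub>\<C>\<^esub> p) \<oplus>\<^bsub>Hom \<C> S S\<^esub> (j \<bullet>\<^bsub>\<C>\<^esub> q) = Ident \<C> S"
    unfolding biproduct_def by auto
  show "S \<in> Obj \<C>" by fact
  fix C \<delta> assume C: "C \<in> Obj \<C>" and d: "\<delta> \<in> ext \<E> C S"
  interpret G: group "Ext \<E> C S" using Ext_group C ob by blast
  have z: "push \<C> \<E> C p \<delta> = \<one>\<^bsub>Ext \<E> C A\<^esub>" "push \<C> \<E> C q \<delta> = \<one>\<^bsub>Ext \<E> C B\<^esub>"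
    using assms(2,3) push_closed[OF C ob(3) ob(1) m(3) d] push_closed[OF C ob(3) ob(2) m(4) d] C
    unfolding Inj_iff by auto
  have "\<delta> = push \<C> \<E> C ((i \<bullet>\<^bsub>\<C>\<^esub> p) \<oplus>\<^bsub>Hom \<C> S S\<^esub> (j \<bullet>\<^bsub>\<C>\<^esub> q)) \<delta>"
    using push_Ident C ob d e by simp
  also have "\<dots> = push \<C> \<E> C i (push \<C> \<E> C p \<delta>) \<otimes>\<^bsub>Ext \<E> C S\<^esub> push \<C> \<E> C j (push \<C> \<E> C q \<delta>)"
    using push_add[OF C ob(3) ob(3) Comp_mor[of S A S p i] Comp_mor[of S B S q j] d]
      push_push[of C S A S p i] push_push[of C S B S q j] C ob m d by simp
  also have "\<dots> = \<one>\<^bsub>Ext \<E> C S\<^esub>" using z push_one C ob m by simp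
  finally show "\<delta> = \<one>\<^bsub>Ext \<E> C S\<^esub>" .
qed

lemma direct_sum_Proj:
  assumes "direct_sum \<C> A B S" "A \<in> Proj \<C> \<E> \<s>" "B \<in> Proj \<C> \<E> \<s>"
  shows "S \<in> Proj \<C> \<E> \<s>"
  unfolding Proj_iff
proof (intro conjI ballI)
  obtain i j p q where bp: "biproduct \<C> A B S i j p q" using assms unfolding direct_sum_def by blast
  then have ob: "A \<in> Obj \<C>" "B \<in> Obj \<C>" "S \<in> Obj \<C>"
    and m: "i \<in> mor \<C> A S" "j \<in> mor \<C> B S" "p \<in> mor \<C> S A" "q \<in> mor \<C> S B"
    and e: "(i \<bullet>\<^bsub>\<C>\<^esub> p) \<oplus>\<^bsub>Hom \<C> S S\<^esub> (j \<bullet>\<^bsub>\<C>\<^esub> q) = Ident \<C> S"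
    unfolding biproduct_def by auto
  show "S \<in> Obj \<C>" by fact
  fix D \<delta> assume D: "D \<in> Obj \<C>" and d: "\<delta> \<in> ext \<E> S D"
  interpret G: group "Ext \<E> S D" using Ext_group D ob by blast
  have z: "pull \<C> \<E> D i \<delta> = \<one>\<^bsub>Ext \<E> A D\<^esub>" "pull \<C> \<E> D j \<delta> = \<one>\<^bsub>Ext \<E> B D\<^esub>"
    using assms(2,3) pull_closed[OF ob(3) D ob(1) m(1) d] pull_closed[OF ob(3) D ob(2) m(2) d] D
    unfolding Proj_iff by auto
  have "\<delta> = pull \<C> \<E> D ((i \<bullet>\<^bsub>\<C>\<^esub> p) \<oplus>\<^bsub>Hom \<C> S S\<^esub> (j \<bullet>\<^bsub>\<C>\<^esub> q)) \<delta>"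
    using pull_Ident D ob d e by simp
  also have "\<dots> = pull \<C> \<E> D p (pull \<C> \<E> D i \<delta>) \<otimes>\<^bsub>Ext \<E> S D\<^esub> pull \<C> \<E> D q (pull \<C> \<E> D j \<delta>)"
    using pull_add[OF ob(3) D ob(3) Comp_mor[of S A S p i] Comp_mor[of S B S q j] d]
      pull_pull[of S D A S i p] pull_pull[of S D B S j q] D ob m d by simp
  also have "\<dots> = \<one>\<^bsub>Ext \<E> S D\<^esub>" using z pull_one D ob m by simp
  finally show "\<delta> = \<one>\<^bsub>Ext \<E> S D\<^esub>" .
qed

end

section \<open>The relative structure\<close>

locale relative_structure = extriangulated_category K \<C> \<E> \<s>
  for K :: "'k ring" and \<C> :: "('o, 'm, 'k) lin_cat"
    and \<E> :: "('o, 'm, 'e) bifunctor" and \<s> :: "('o, 'm, 'e) realization" +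
  fixes \<X> :: "'o set"
  assumes \<X>_Obj: "\<X> \<subseteq> Obj \<C>"
begin

abbreviation "\<E>' \<equiv> relative_ext \<C> \<E> \<s> \<X>"

abbreviation "\<s>' \<equiv> restrict_realization \<E>' \<s>"

text \<open>Exactness translates \<X>-monicity of an inflation into a vanishing condition on
  \<delta>. As the condition no longer mentions the sequence, either all realizations of \<delta>
  have an \<X>-monic inflation or none has; at least one realization exists, so the universal
  quantifier in the definition is not vacuous.\<close>

lemma relative_ext_iff:
  assumes "C \<in> Obj \<C>" "A \<in> Obj \<C>"
  shows "\<delta> \<in> ext \<E>' C A \<longleftrightarrow>
    \<delta> \<in> ext \<E> C A \<and> (\<forall>X \<in> \<X>. \<forall>u \<in> mor \<C> A X. push \<C> \<E> C u \<delta> = \<one>\<^bsub>Ext \<E> C X\<^esub>)"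
proof -
  \<comment> \<open>\<open>monic_for\<close> asks that an image equal a whole Hom-set. One inclusion
    comes from closure under composition, so surjectivity is what remains.\<close>
  have image_eq_iff: "F ` S = T \<longleftrightarrow> (\<forall>u \<in> T. \<exists>v \<in> S. F v = u)" if "F ` S \<subseteq> T" for F :: "'m \<Rightarrow> 'm" and S T
    using that unfolding set_eq_subset subset_iff image_iff by metis
  have "monic_for \<C> \<X> A B f \<longleftrightarrow> (\<forall>X \<in> \<X>. \<forall>u \<in> mor \<C> A X. push \<C> \<E> C u \<delta> = \<one>\<^bsub>Ext \<E> C X\<^esub>)"
    if d: "\<delta> \<in> ext \<E> C A" and t: "(f, B, g) \<in> \<s> C A \<delta>" for f B g
  proof -
    note B = realization_mor[OF assms d t]
    have "(\<lambda>v. v \<bullet>\<^bsub>\<C>\<^esub> f) ` mor \<C> B X = mor \<C> A X \<longleftrightarrow>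
      (\<forall>u \<in> mor \<C> A X. push \<C> \<E> C u \<delta> = \<one>\<^bsub>Ext \<E> C X\<^esub>)" if X: "X \<in> \<X>" for X
    proof -
      have XO: "X \<in> Obj \<C>" using X \<X>_Obj by (rule rev_subsetD)
      have "(\<lambda>v. v \<bullet>\<^bsub>\<C>\<^esub> f) ` mor \<C> B X \<subseteq> mor \<C> A X"
        using Comp_mor[OF assms(2) B(1) XO B(2)] by (rule image_subsetI)
      from image_eq_iff[OF this] show ?thesis using push_eq_one_iff[OF assms d t XO] by simp
    qed
    then show ?thesis unfolding monic_for_def using B(2) by simp
  qed
  moreover have "\<exists>f B g. (f, B, g) \<in> \<s> C A \<delta>" if "\<delta> \<in> ext \<E> C A"
    using realization_exists[OF assms that] by metis
  moreover have "\<delta> \<in> ext \<E>' C A \<longleftrightarrow>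
      \<delta> \<in> ext \<E> C A \<and> (\<forall>f B g. (f, B, g) \<in> \<s> C A \<delta> \<longrightarrow> monic_for \<C> \<X> A B f)"
    unfolding relative_ext_def by simp
  ultimately show ?thesis by metis
qed

lemma relative_extD: "\<delta> \<in> ext \<E>' C A \<Longrightarrow> \<delta> \<in> ext \<E> C A"
  unfolding relative_ext_def by simp

lemma relative_ext_push:
  "\<lbrakk>C \<in> Obj \<C>; A \<in> Obj \<C>; \<delta> \<in> ext \<E>' C A; X \<in> \<X>; u \<in> mor \<C> A X\<rbrakk>
   \<Longrightarrow> push \<C> \<E> C u \<delta> = \<one>\<^bsub>Ext \<E> C X\<^esub>"
  using relative_ext_iff by blast

lemma ExtMap_relative: "ExtMap \<E>' = ExtMap \<E>"
  unfolding relative_ext_def by simp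

lemma push_relative: "push \<C> \<E>' = push \<C> \<E>"
  unfolding push_def[abs_def] by (simp add: ExtMap_relative)

lemma pull_relative: "pull \<C> \<E>' = pull \<C> \<E>"
  unfolding pull_def[abs_def] by (simp add: ExtMap_relative)

lemma one_relative: "\<one>\<^bsub>Ext \<E>' C A\<^esub> = \<one>\<^bsub>Ext \<E> C A\<^esub>"
  unfolding relative_ext_def by simp

lemma mult_relative: "(\<otimes>\<^bsub>Ext \<E>' C A\<^esub>) = (\<otimes>\<^bsub>Ext \<E> C A\<^esub>)"
  unfolding relative_ext_def by simp

lemma realization_relative: "\<delta> \<in> ext \<E>' C A \<Longrightarrow> \<s>' C A \<delta> = \<s> C A \<delta>"
  unfolding restrict_realization_def by simp

lemmas relative_simps = ExtMap_relative push_relative pull_relative one_relative mult_relative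

text \<open>The relative extensions form an intersection of kernels: those of the homomorphisms
  induced on extension groups by the morphisms u from A to objects of \<X>.\<close>

lemma relative_subgroup:
  assumes "C \<in> Obj \<C>" "A \<in> Obj \<C>"
  shows "subgroup (ext \<E>' C A) (Ext \<E> C A)"
proof -
  interpret G: group "Ext \<E> C A" using assms by (rule Ext_group)
  have "push \<C> \<E> C u \<in> hom (Ext \<E> C A) (Ext \<E> C X)" if "X \<in> \<X>" "u \<in> mor \<C> A X" for X u
    unfolding push_def[abs_def] using that assms \<X>_Obj Ident_mor by (intro ExtMap_hom) auto
  then have hom: "group_hom (Ext \<E> C A) (Ext \<E> C X) (push \<C> \<E> C u)" if "X \<in> \<X>" "u \<in> mor \<C> A X" for X u
    using that assms \<X>_Obj Ext_group unfolding group_hom_def group_hom_axioms_def by blast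
  show ?thesis
  proof
    show "ext \<E>' C A \<subseteq> ext \<E> C A" using relative_extD by blast
  next
    fix \<delta> \<epsilon> assume d: "\<delta> \<in> ext \<E>' C A" "\<epsilon> \<in> ext \<E>' C A"
    have "push \<C> \<E> C u (\<delta> \<otimes>\<^bsub>Ext \<E> C A\<^esub> \<epsilon>) = \<one>\<^bsub>Ext \<E> C X\<^esub>" if X: "X \<in> \<X>" "u \<in> mor \<C> A X" for X u
    proof -
      interpret h: group_hom "Ext \<E> C A" "Ext \<E> C X" "push \<C> \<E> C u" using X by (rule hom)
      show ?thesis using d relative_ext_push[OF assms _ X] relative_extD by simp
    qed
    then show "\<delta> \<otimes>\<^bsub>Ext \<E> C A\<^esub> \<epsilon> \<in> ext \<E>' C A"
      using d relative_extD by (simp add: relative_ext_iff[OF assms])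
  next
    show "\<one>\<^bsub>Ext \<E> C A\<^esub> \<in> ext \<E>' C A"
      using group_hom.hom_one[OF hom] by (simp add: relative_ext_iff[OF assms])
  next
    fix \<delta> assume d: "\<delta> \<in> ext \<E>' C A"
    have "push \<C> \<E> C u (inv\<^bsub>Ext \<E> C A\<^esub> \<delta>) = \<one>\<^bsub>Ext \<E> C X\<^esub>" if X: "X \<in> \<X>" "u \<in> mor \<C> A X" for X u
    proof -
      interpret h: group_hom "Ext \<E> C A" "Ext \<E> C X" "push \<C> \<E> C u" using X by (rule hom)
      show ?thesis using d relative_ext_push[OF assms _ X] relative_extD by simp
    qed
    then show "inv\<^bsub>Ext \<E> C A\<^esub> \<delta> \<in> ext \<E>' C A"
      using d relative_extD by (simp add: relative_ext_iff[OF assms])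
  qed
qed

lemma Ext_relative: "Ext \<E>' C A = (Ext \<E> C A)\<lparr>carrier := ext \<E>' C A\<rparr>"
  unfolding relative_ext_def by simp

lemma relative_comm_group:
  assumes "C \<in> Obj \<C>" "A \<in> Obj \<C>"
  shows "comm_group (Ext \<E>' C A)"
proof -
  interpret G: comm_group "Ext \<E> C A" using assms by (rule Ext_comm_group)
  have "group (Ext \<E>' C A)"
    by (subst Ext_relative) (rule G.subgroup_imp_group[OF relative_subgroup[OF assms]])
  then show ?thesis
    by (rule group.group_comm_groupI) (use relative_extD G.m_comm in \<open>simp add: mult_relative\<close>)
qed

text \<open>Pushing along u after applying \<open>ExtMap \<E> c a\<close> is the same as pushing
  \<delta> along \<open>u a\<close> and pulling back along c. Since \<open>u a\<close> is again a
  morphism from A into \<X>, the result is zero.\<close>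

lemma relative_ExtMap_closed:
  assumes "C \<in> Obj \<C>" "A \<in> Obj \<C>" "C' \<in> Obj \<C>" "A' \<in> Obj \<C>" "c \<in> mor \<C> C' C" "a \<in> mor \<C> A A'"
    and \<delta>: "\<delta> \<in> ext \<E>' C A"
  shows "ExtMap \<E> c a \<delta> \<in> ext \<E>' C' A'"
  unfolding relative_ext_iff[OF assms(3,4)]
proof (intro conjI ballI)
  show "ExtMap \<E> c a \<delta> \<in> ext \<E> C' A'"
    using ExtMap_closed[OF assms(1-6)] relative_extD[OF \<delta>] .
  fix X u assume X: "X \<in> \<X>" and u: "u \<in> mor \<C> A' X"
  then have XO: "X \<in> Obj \<C>" using \<X>_Obj by blast
  have ua: "u \<bullet>\<^bsub>\<C>\<^esub> a \<in> mor \<C> A X" using assms XO u Comp_mor by blast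
  have "push \<C> \<E> C' u (ExtMap \<E> c a \<delta>) = push \<C> \<E> C' u (pull \<C> \<E> A' c (push \<C> \<E> C a \<delta>))"
    using ExtMap_eq_pull_push[OF assms(1-6) relative_extD[OF \<delta>]] by simp
  also have "\<dots> = pull \<C> \<E> X c (push \<C> \<E> C u (push \<C> \<E> C a \<delta>))"
    using assms XO u push_closed relative_extD[OF \<delta>] by (intro push_pull) auto
  also have "push \<C> \<E> C u (push \<C> \<E> C a \<delta>) = push \<C> \<E> C (u \<bullet>\<^bsub>\<C>\<^esub> a) \<delta>"
    using assms XO u relative_extD[OF \<delta>] by (intro push_push) auto
  also have "\<dots> = \<one>\<^bsub>Ext \<E> C X\<^esub>" using relative_ext_push[OF assms(1,2) \<delta> X ua] .
  finally show "push \<C> \<E> C' u (ExtMap \<E> c a \<delta>) = \<one>\<^bsub>Ext \<E> C' X\<^esub>"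
    using pull_one assms XO by simp
qed

lemma relative_push_closed:
  "\<lbrakk>C \<in> Obj \<C>; A \<in> Obj \<C>; A' \<in> Obj \<C>; a \<in> mor \<C> A A'; \<delta> \<in> ext \<E>' C A\<rbrakk>
   \<Longrightarrow> push \<C> \<E> C a \<delta> \<in> ext \<E>' C A'"
  unfolding push_def by (rule relative_ExtMap_closed[of C A]) (auto intro: Ident_mor)

lemma relative_pull_closed:
  "\<lbrakk>C \<in> Obj \<C>; A \<in> Obj \<C>; C' \<in> Obj \<C>; c \<in> mor \<C> C' C; \<delta> \<in> ext \<E>' C A\<rbrakk>
   \<Longrightarrow> pull \<C> \<E> A c \<delta> \<in> ext \<E>' C' A"
  unfolding pull_def by (rule relative_ExtMap_closed[of C A]) (auto intro: Ident_mor)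

lemma relative_one: "\<lbrakk>C \<in> Obj \<C>; A \<in> Obj \<C>\<rbrakk> \<Longrightarrow> \<one>\<^bsub>Ext \<E> C A\<^esub> \<in> ext \<E>' C A"
  by (rule subgroup.one_closed[OF relative_subgroup])

lemma relative_mult:
  "\<lbrakk>C \<in> Obj \<C>; A \<in> Obj \<C>; \<delta> \<in> ext \<E>' C A; \<epsilon> \<in> ext \<E>' C A\<rbrakk>
   \<Longrightarrow> \<delta> \<otimes>\<^bsub>Ext \<E> C A\<^esub> \<epsilon> \<in> ext \<E>' C A"
  by (rule subgroup.m_closed[OF relative_subgroup])

lemma relative_biadditive: "biadditive_functor \<C> \<E>'"
  unfolding biadditive_functor_def relative_simps
proof (intro conjI ballI)
  fix C A C' A' c a
  assume h: "C \<in> Obj \<C>" "A \<in> Obj \<C>" "C' \<in> Obj \<C>" "A' \<in> Obj \<C>" "c \<in> mor \<C> C' C" "a \<in> mor \<C> A A'"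
  show "ExtMap \<E> c a \<in> hom (Ext \<E>' C A) (Ext \<E>' C' A')"
    using relative_ExtMap_closed[OF h] hom_mult[OF ExtMap_hom[OF h]] relative_extD
    by (intro homI) (auto simp: mult_relative)
next
  fix C A \<delta> assume "C \<in> Obj \<C>" "A \<in> Obj \<C>" "\<delta> \<in> ext \<E>' C A"
  then show "ExtMap \<E> (Ident \<C> C) (Ident \<C> A) \<delta> = \<delta>" by (simp add: ExtMap_Ident relative_extD)
next
  fix C A C' A' C'' A'' c a c' a' \<delta>
  assume "C \<in> Obj \<C>" "A \<in> Obj \<C>" "C' \<in> Obj \<C>" "A' \<in> Obj \<C>" "C'' \<in> Obj \<C>" "A'' \<in> Obj \<C>"
    "c \<in> mor \<C> C' C" "a \<in> mor \<C> A A'" "c' \<in> mor \<C> C'' C'" "a' \<in> mor \<C> A' A''" "\<delta> \<in> ext \<E>' C A"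
  then show "ExtMap \<E> (c \<bullet>\<^bsub>\<C>\<^esub> c') (a' \<bullet>\<^bsub>\<C>\<^esub> a) \<delta> = ExtMap \<E> c' a' (ExtMap \<E> c a \<delta>)"
    using ExtMap_Comp[of C A C' A' C'' A'' c a c' a' \<delta>] by (simp add: relative_extD)
qed (simp_all add: relative_comm_group relative_extD ExtMap_add_left ExtMap_add_right)

text \<open>In (ET4) the inflation of \<open>\<delta>''\<close> is a composite of \<open>\<X>\<close>-monic inflations.\<close>

lemma relative_ET4:
  assumes ob: "A \<in> Obj \<C>" "D \<in> Obj \<C>" "B \<in> Obj \<C>" "F \<in> Obj \<C>" "E \<in> Obj \<C>"
    and \<delta>: "\<delta> \<in> ext \<E>' D A" and \<delta>': "\<delta>' \<in> ext \<E>' F B" and \<delta>'': "\<delta>'' \<in> ext \<E> E A"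
    and t: "(f, B, f') \<in> \<s> D A \<delta>" and t': "(g, C, g') \<in> \<s> F B \<delta>'"
    and t'': "(g \<bullet>\<^bsub>\<C>\<^esub> f, C, h') \<in> \<s> E A \<delta>''"
  shows "\<delta>'' \<in> ext \<E>' E A"
  unfolding relative_ext_iff[OF ob(5,1)]
proof (intro conjI ballI \<delta>'')
  fix X u assume X: "X \<in> \<X>" and u: "u \<in> mor \<C> A X"
  then have XO: "X \<in> Obj \<C>" using \<X>_Obj by blast
  note B = realization_mor[OF ob(2,1) relative_extD[OF \<delta>] t]
  note C = realization_mor[OF ob(4,3) relative_extD[OF \<delta>'] t']
  obtain v where v: "v \<in> mor \<C> B X" "v \<bullet>\<^bsub>\<C>\<^esub> f = u"
    using relative_ext_push[OF ob(2,1) \<delta> X u] push_eq_one_iff[OF ob(2,1) relative_extD[OF \<delta>] t XO u] by blast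
  obtain w where w: "w \<in> mor \<C> C X" "w \<bullet>\<^bsub>\<C>\<^esub> g = v"
    using relative_ext_push[OF ob(4,3) \<delta>' X v(1)]
      push_eq_one_iff[OF ob(4,3) relative_extD[OF \<delta>'] t' XO v(1)] by blast
  have "w \<bullet>\<^bsub>\<C>\<^esub> (g \<bullet>\<^bsub>\<C>\<^esub> f) = u"
    using Comp_assoc[of A B C X f g w] ob XO B C v w by simp
  then show "push \<C> \<E> E u \<delta>'' = \<one>\<^bsub>Ext \<E> E X\<^esub>"
    using push_eq_one_iff[OF ob(5,1) \<delta>'' t'' XO u] w by blast
qed

text \<open>For \<open>u : E \<rightarrow> X\<close>, the composite \<open>u d\<close> extends along \<open>f' = h' d\<close> to some \<open>v\<close>, and \<open>u - v h'\<close>, which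
  kills \<open>d\<close>, factors through \<open>e\<close>.  Both \<open>h'\<^sub>* \<delta>''\<close> and \<open>(w e)\<^sub>* \<delta>'' = w\<^sub>* \<delta>'\<close> vanish.\<close>

lemma relative_ET4_op:
  assumes ob: "D \<in> Obj \<C>" "B \<in> Obj \<C>" "F \<in> Obj \<C>" "C \<in> Obj \<C>" "E \<in> Obj \<C>"
    and \<delta>: "\<delta> \<in> ext \<E>' B D" and \<delta>': "\<delta>' \<in> ext \<E>' C F" and \<delta>'': "\<delta>'' \<in> ext \<E> C E"
    and t: "(f', A, f) \<in> \<s> B D \<delta>" and t'': "(h', A, k) \<in> \<s> C E \<delta>''"
    and d: "d \<in> mor \<C> D E" and e: "e \<in> mor \<C> E F" and hd: "h' \<bullet>\<^bsub>\<C>\<^esub> d = f'"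
    and \<epsilon>: "\<epsilon> \<in> ext \<E> F D" and de: "(d, E, e) \<in> \<s> F D \<epsilon>" and push: "push \<C> \<E> C e \<delta>'' = \<delta>'"
  shows "\<delta>'' \<in> ext \<E>' C E"
  unfolding relative_ext_iff[OF ob(4,5)]
proof (intro conjI ballI \<delta>'')
  fix X u assume X: "X \<in> \<X>" and u: "u \<in> mor \<C> E X"
  then have XO: "X \<in> Obj \<C>" using \<X>_Obj by blast
  note A = realization_mor[OF ob(2,1) relative_extD[OF \<delta>] t]
  note h = realization_mor[OF ob(4,5) \<delta>'' t'']
  interpret DX: abelian_group "Hom \<C> D X" using Hom_abelian ob XO by blast
  interpret EX: abelian_group "Hom \<C> E X" using Hom_abelian ob XO by blast
  interpret G: group "Ext \<E> C X" using Ext_group ob XO by blast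
  have ud: "u \<bullet>\<^bsub>\<C>\<^esub> d \<in> mor \<C> D X" using Comp_mor ob XO u d by blast
  obtain v where v: "v \<in> mor \<C> A X" "v \<bullet>\<^bsub>\<C>\<^esub> f' = u \<bullet>\<^bsub>\<C>\<^esub> d"
    using relative_ext_push[OF ob(2,1) \<delta> X ud] push_eq_one_iff[OF ob(2,1) relative_extD[OF \<delta>] t XO ud] by blast
  define m where "m = v \<bullet>\<^bsub>\<C>\<^esub> h'"
  have m: "m \<in> mor \<C> E X" unfolding m_def using Comp_mor ob XO A h v by blast
  have md: "m \<bullet>\<^bsub>\<C>\<^esub> d = u \<bullet>\<^bsub>\<C>\<^esub> d"
    unfolding m_def using Comp_assoc[of D E A X d h' v] ob XO A h v d hd by simp
  have um: "u \<ominus>\<^bsub>Hom \<C> E X\<^esub> m \<in> mor \<C> E X" using u m by simp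
  have "(u \<ominus>\<^bsub>Hom \<C> E X\<^esub> m) \<bullet>\<^bsub>\<C>\<^esub> d = \<zero>\<^bsub>Hom \<C> D X\<^esub>"
    unfolding a_minus_def using ob XO d u m md ud
    by (simp add: Comp_add_left[of D E X] uminus_comp[of D E X] DX.r_neg)
  then obtain w where w: "w \<in> mor \<C> F X" "w \<bullet>\<^bsub>\<C>\<^esub> e = u \<ominus>\<^bsub>Hom \<C> E X\<^esub> m"
    using factor_through_deflation[OF ob(3,1) \<epsilon> de XO um] by blast
  have "push \<C> \<E> C (w \<bullet>\<^bsub>\<C>\<^esub> e) \<delta>'' = push \<C> \<E> C w \<delta>'"
    using push_push[of C E F X e w \<delta>''] ob XO e w \<delta>'' push by simp
  also have "\<dots> = \<one>\<^bsub>Ext \<E> C X\<^esub>" using relative_ext_push[OF ob(4,3) \<delta>' X w(1)] .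
  finally have 1: "push \<C> \<E> C (u \<ominus>\<^bsub>Hom \<C> E X\<^esub> m) \<delta>'' = \<one>\<^bsub>Ext \<E> C X\<^esub>" using w by simp
  have 2: "push \<C> \<E> C m \<delta>'' = \<one>\<^bsub>Ext \<E> C X\<^esub>"
    using push_eq_one_iff[OF ob(4,5) \<delta>'' t'' XO m] v(1) m_def by blast
  have "u = (u \<ominus>\<^bsub>Hom \<C> E X\<^esub> m) \<oplus>\<^bsub>Hom \<C> E X\<^esub> m"
    unfolding a_minus_def using u m by (simp add: EX.a_assoc EX.l_neg)
  then have "push \<C> \<E> C u \<delta>'' =
      push \<C> \<E> C (u \<ominus>\<^bsub>Hom \<C> E X\<^esub> m) \<delta>'' \<otimes>\<^bsub>Ext \<E> C X\<^esub> push \<C> \<E> C m \<delta>''"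
    using push_add[OF ob(4,5) XO um m \<delta>''] by simp
  then show "push \<C> \<E> C u \<delta>'' = \<one>\<^bsub>Ext \<E> C X\<^esub>" using 1 2 by simp
qed

text \<open>The realizing sequences are unchanged, so each axiom supplies the required morphisms and
  sequences as before. What has to be checked is that the extensions occurring in its conclusion
  stay in \<open>\<E>'\<close>: zero and direct sums in (ET2), and \<open>\<delta>''\<close>
  together with the extension realized by \<open>D \<rightarrow> E \<rightarrow> F\<close> in (ET4)
  and its dual.\<close>

theorem relative_extriangulated: "extriangulated_category K \<C> \<E>' \<s>'"
proof (rule extriangulated_category.intro, rule additive_category_axioms,
    rule extriangulated_category_axioms.intro, unfold relative_simps)
  show "biadditive_functor \<C> \<E>'" by (rule relative_biadditive)
next
  fix C A \<delta> assume "C \<in> Obj \<C>" "A \<in> Obj \<C>" "\<delta> \<in> ext \<E>' C A"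
  then show "\<exists>t \<in> sequences \<C> A C. \<s>' C A \<delta> = seq_class \<C> A C t"
    using ET2_class relative_extD by (simp add: realization_relative)
next
  fix A C A' C' \<delta> \<delta>' a c x B y x' B' y'
  assume "A \<in> Obj \<C>" "C \<in> Obj \<C>" "A' \<in> Obj \<C>" "C' \<in> Obj \<C>" "\<delta> \<in> ext \<E>' C A" "\<delta>' \<in> ext \<E>' C' A'"
    "a \<in> mor \<C> A A'" "c \<in> mor \<C> C C'" "push \<C> \<E> C a \<delta> = pull \<C> \<E> A' c \<delta>'"
    "(x, B, y) \<in> \<s>' C A \<delta>" "(x', B', y') \<in> \<s>' C' A' \<delta>'"
  then show "\<exists>b \<in> mor \<C> B B'. b \<bullet>\<^bsub>\<C>\<^esub> x = x' \<bullet>\<^bsub>\<C>\<^esub> a \<and> y' \<bullet>\<^bsub>\<C>\<^esub> b = c \<bullet>\<^bsub>\<C>\<^esub> y"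
    using ET2_morphism[of A C A' C' \<delta> \<delta>'] relative_extD by (simp add: realization_relative)
next
  fix A C S i j p q assume bp: "biproduct \<C> A C S i j p q"
  then have "\<one>\<^bsub>Ext \<E> C A\<^esub> \<in> ext \<E>' C A" unfolding biproduct_def by (simp add: relative_one)
  then show "\<s>' C A \<one>\<^bsub>Ext \<E> C A\<^esub> = seq_class \<C> A C (i, S, q)"
    using ET2_zero[OF bp] by (simp add: realization_relative)
next
  fix A A' SA iA jA pA qA B B' SB iB jB pB qB C C' SC iC jC pC qC \<delta> \<delta>' x y x' y'
  assume A: "biproduct \<C> A A' SA iA jA pA qA" and B: "biproduct \<C> B B' SB iB jB pB qB"
    and C: "biproduct \<C> C C' SC iC jC pC qC"
    and d: "\<delta> \<in> ext \<E>' C A" "\<delta>' \<in> ext \<E>' C' A'"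
    and t: "(x, B, y) \<in> \<s>' C A \<delta>" "(x', B', y') \<in> \<s>' C' A' \<delta>'"
  have "ExtMap \<E> pC iA \<delta> \<otimes>\<^bsub>Ext \<E> SC SA\<^esub> ExtMap \<E> qC jA \<delta>' \<in> ext \<E>' SC SA"
    using A C d unfolding biproduct_def
    by (intro relative_mult relative_ExtMap_closed[of C A] relative_ExtMap_closed[of C' A']) auto
  then show "\<s>' SC SA (ExtMap \<E> pC iA \<delta> \<otimes>\<^bsub>Ext \<E> SC SA\<^esub> ExtMap \<E> qC jA \<delta>') =
           seq_class \<C> SA SC
             ((iB \<bullet>\<^bsub>\<C>\<^esub> x \<bullet>\<^bsub>\<C>\<^esub> pA) \<oplus>\<^bsub>Hom \<C> SA SB\<^esub> (jB \<bullet>\<^bsub>\<C>\<^esub> x' \<bullet>\<^bsub>\<C>\<^esub> qA), SB,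
              (iC \<bullet>\<^bsub>\<C>\<^esub> y \<bullet>\<^bsub>\<C>\<^esub> pB) \<oplus>\<^bsub>Hom \<C> SB SC\<^esub> (jC \<bullet>\<^bsub>\<C>\<^esub> y' \<bullet>\<^bsub>\<C>\<^esub> qB))"
    using ET2_sum[OF A B C relative_extD[OF d(1)] relative_extD[OF d(2)]] t d
    by (simp add: realization_relative)
next
  fix A C A' C' \<delta> \<delta>' x B y x' B' y' a b
  assume "A \<in> Obj \<C>" "C \<in> Obj \<C>" "A' \<in> Obj \<C>" "C' \<in> Obj \<C>" "\<delta> \<in> ext \<E>' C A" "\<delta>' \<in> ext \<E>' C' A'"
    "(x, B, y) \<in> \<s>' C A \<delta>" "(x', B', y') \<in> \<s>' C' A' \<delta>'"
    "a \<in> mor \<C> A A'" "b \<in> mor \<C> B B'" "b \<bullet>\<^bsub>\<C>\<^esub> x = x' \<bullet>\<^bsub>\<C>\<^esub> a"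
  then show "\<exists>c \<in> mor \<C> C C'. push \<C> \<E> C a \<delta> = pull \<C> \<E> A' c \<delta>' \<and> c \<bullet>\<^bsub>\<C>\<^esub> y = y' \<bullet>\<^bsub>\<C>\<^esub> b"
    using ET3[of A C A' C' \<delta> \<delta>'] relative_extD by (simp add: realization_relative)
next
  fix A C A' C' \<delta> \<delta>' x B y x' B' y' b c
  assume "A \<in> Obj \<C>" "C \<in> Obj \<C>" "A' \<in> Obj \<C>" "C' \<in> Obj \<C>" "\<delta> \<in> ext \<E>' C A" "\<delta>' \<in> ext \<E>' C' A'"
    "(x, B, y) \<in> \<s>' C A \<delta>" "(x', B', y') \<in> \<s>' C' A' \<delta>'"
    "b \<in> mor \<C> B B'" "c \<in> mor \<C> C C'" "c \<bullet>\<^bsub>\<C>\<^esub> y = y' \<bullet>\<^bsub>\<C>\<^esub> b"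
  then show "\<exists>a \<in> mor \<C> A A'. push \<C> \<E> C a \<delta> = pull \<C> \<E> A' c \<delta>' \<and> b \<bullet>\<^bsub>\<C>\<^esub> x = x' \<bullet>\<^bsub>\<C>\<^esub> a"
    using ET3_op[of A C A' C' \<delta> \<delta>'] relative_extD by (simp add: realization_relative)
next
  fix A D B F \<delta> \<delta>' f f' g C g'
  assume ob: "A \<in> Obj \<C>" "D \<in> Obj \<C>" "B \<in> Obj \<C>" "F \<in> Obj \<C>"
    and d: "\<delta> \<in> ext \<E>' D A" "\<delta>' \<in> ext \<E>' F B"
    and "(f, B, f') \<in> \<s>' D A \<delta>" "(g, C, g') \<in> \<s>' F B \<delta>'"
  then have t: "(f, B, f') \<in> \<s> D A \<delta>" "(g, C, g') \<in> \<s> F B \<delta>'" by (auto simp: realization_relative)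
  note f' = realization_mor[OF ob(2,1) relative_extD[OF d(1)] t(1)]
  obtain E h' d' e \<delta>'' where E: "E \<in> Obj \<C>" "h' \<in> mor \<C> C E" "d' \<in> mor \<C> D E" "e \<in> mor \<C> E F"
      "\<delta>'' \<in> ext \<E> E A" "h' \<bullet>\<^bsub>\<C>\<^esub> g = d' \<bullet>\<^bsub>\<C>\<^esub> f'" "e \<bullet>\<^bsub>\<C>\<^esub> h' = g'"
      "(g \<bullet>\<^bsub>\<C>\<^esub> f, C, h') \<in> \<s> E A \<delta>''" "(d', E, e) \<in> \<s> F D (push \<C> \<E> F f' \<delta>')"
      "pull \<C> \<E> A d' \<delta>'' = \<delta>" "push \<C> \<E> E f \<delta>'' = pull \<C> \<E> B e \<delta>'"
    using ET4[OF ob relative_extD[OF d(1)] relative_extD[OF d(2)] t] by blast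
  have d'': "\<delta>'' \<in> ext \<E>' E A" by (rule relative_ET4[OF ob E(1) d E(5) t E(8)])
  \<comment> \<open>\<open>\<s>'\<close> is a restricted function and is known to agree with \<s>
    only on \<open>\<E>'\<close>, so this membership is what allows the sequence through E to be
    read in \<open>\<s>'\<close>.\<close>
  have "push \<C> \<E> F f' \<delta>' \<in> ext \<E>' F D" by (rule relative_push_closed[OF ob(4,3,2) f'(3) d(2)])
  then show "\<exists>E \<in> Obj \<C>. \<exists>h' \<in> mor \<C> C E. \<exists>d \<in> mor \<C> D E. \<exists>e \<in> mor \<C> E F. \<exists>\<delta>'' \<in> ext \<E>' E A.
             h' \<bullet>\<^bsub>\<C>\<^esub> g = d \<bullet>\<^bsub>\<C>\<^esub> f' \<and> e \<bullet>\<^bsub>\<C>\<^esub> h' = g' \<and>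
             (g \<bullet>\<^bsub>\<C>\<^esub> f, C, h') \<in> \<s>' E A \<delta>'' \<and>
             (d, E, e) \<in> \<s>' F D (push \<C> \<E> F f' \<delta>') \<and>
             pull \<C> \<E> A d \<delta>'' = \<delta> \<and>
             push \<C> \<E> E f \<delta>'' = pull \<C> \<E> B e \<delta>'"
    using E d'' realization_relative by metis
next
  fix D B F C \<delta> \<delta>' f' A f g' g
  assume ob: "D \<in> Obj \<C>" "B \<in> Obj \<C>" "F \<in> Obj \<C>" "C \<in> Obj \<C>"
    and d: "\<delta> \<in> ext \<E>' B D" "\<delta>' \<in> ext \<E>' C F"
    and "(f', A, f) \<in> \<s>' B D \<delta>" "(g', B, g) \<in> \<s>' C F \<delta>'"
  then have t: "(f', A, f) \<in> \<s> B D \<delta>" "(g', B, g) \<in> \<s> C F \<delta>'" by (auto simp: realization_relative)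
  note g' = realization_mor[OF ob(4,3) relative_extD[OF d(2)] t(2)]
  obtain E d' e h' \<delta>'' where E: "E \<in> Obj \<C>" "d' \<in> mor \<C> D E" "e \<in> mor \<C> E F" "h' \<in> mor \<C> E A"
      "\<delta>'' \<in> ext \<E> C E" "h' \<bullet>\<^bsub>\<C>\<^esub> d' = f'" "f \<bullet>\<^bsub>\<C>\<^esub> h' = g' \<bullet>\<^bsub>\<C>\<^esub> e"
      "(h', A, g \<bullet>\<^bsub>\<C>\<^esub> f) \<in> \<s> C E \<delta>''" "(d', E, e) \<in> \<s> F D (pull \<C> \<E> D g' \<delta>)"
      "push \<C> \<E> C e \<delta>'' = \<delta>'" "push \<C> \<E> B d' \<delta> = pull \<C> \<E> E g \<delta>''"
    using ET4_op[OF ob relative_extD[OF d(1)] relative_extD[OF d(2)] t] by blast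
  have g'\<delta>: "pull \<C> \<E> D g' \<delta> \<in> ext \<E>' F D" by (rule relative_pull_closed[OF ob(2,1,3) g'(2) d(1)])
  have d'': "\<delta>'' \<in> ext \<E>' C E"
    by (rule relative_ET4_op[OF ob E(1) d E(5) t(1) E(8) E(2,3,6) relative_extD[OF g'\<delta>] E(9,10)])
  show "\<exists>E \<in> Obj \<C>. \<exists>d \<in> mor \<C> D E. \<exists>e \<in> mor \<C> E F. \<exists>h' \<in> mor \<C> E A. \<exists>\<delta>'' \<in> ext \<E>' C E.
             h' \<bullet>\<^bsub>\<C>\<^esub> d = f' \<and> f \<bullet>\<^bsub>\<C>\<^esub> h' = g' \<bullet>\<^bsub>\<C>\<^esub> e \<and>
             (h', A, g \<bullet>\<^bsub>\<C>\<^esub> f) \<in> \<s>' C E \<delta>'' \<and>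
             (d, E, e) \<in> \<s>' F D (pull \<C> \<E> D g' \<delta>) \<and>
             push \<C> \<E> C e \<delta>'' = \<delta>' \<and>
             push \<C> \<E> B d \<delta> = pull \<C> \<E> E g \<delta>''"
    using E d'' g'\<delta> realization_relative by metis
qed

end

section \<open>Stable categories\<close>

text \<open>Closure conditions on \<W> under which the morphisms factoring through \<W> form an
  additive ideal, so that cosets compose as in a quotient category. The instances are the
  projectives and the injectives.\<close>

locale additive_ideal = additive_category K \<C>
  for K :: "'k ring" and \<C> :: "('o, 'm, 'k) lin_cat" +
  fixes \<W> :: "'o set"
  assumes \<W>_Obj: "\<W> \<subseteq> Obj \<C>"
    and zero_\<W>: "zero_object \<C> Z \<Longrightarrow> Z \<in> \<W>"
    and direct_sum_\<W>: "\<lbrakk>direct_sum \<C> A B S; A \<in> \<W>; B \<in> \<W>\<rbrakk> \<Longrightarrow> S \<in> \<W>"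
begin

abbreviation "\<S> \<equiv> stable_category \<C> \<W>"

lemma factoringE:
  assumes "h \<in> factoring \<C> \<W> A B"
  obtains W f g where "W \<in> \<W>" "W \<in> Obj \<C>" "f \<in> mor \<C> A W" "g \<in> mor \<C> W B" "h = g \<bullet>\<^bsub>\<C>\<^esub> f"
  using assms \<W>_Obj unfolding factoring_def by auto

lemma factoringI:
  "\<lbrakk>W \<in> \<W>; f \<in> mor \<C> A W; g \<in> mor \<C> W B\<rbrakk> \<Longrightarrow> g \<bullet>\<^bsub>\<C>\<^esub> f \<in> factoring \<C> \<W> A B"
  unfolding factoring_def by auto

lemma factoring_mor:
  assumes "A \<in> Obj \<C>" "B \<in> Obj \<C>" "h \<in> factoring \<C> \<W> A B"
  shows "h \<in> mor \<C> A B"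
  using assms(3) Comp_mor assms(1,2) by (elim factoringE) simp

lemma factoring_comp_left:
  assumes "A \<in> Obj \<C>" "B \<in> Obj \<C>" "C \<in> Obj \<C>" "h \<in> factoring \<C> \<W> A B" "g \<in> mor \<C> B C"
  shows "g \<bullet>\<^bsub>\<C>\<^esub> h \<in> factoring \<C> \<W> A C"
proof -
  obtain W f k where "W \<in> \<W>" "W \<in> Obj \<C>" "f \<in> mor \<C> A W" "k \<in> mor \<C> W B" "h = k \<bullet>\<^bsub>\<C>\<^esub> f"
    using factoringE[OF assms(4)] .
  then show ?thesis
    using assms factoringI[of W f A "g \<bullet>\<^bsub>\<C>\<^esub> k" C] Comp_assoc[of A W B C f k g] Comp_mor[of W B C k g] by simp
qed

lemma factoring_comp_right:
  assumes "A \<in> Obj \<C>" "B \<in> Obj \<C>" "C \<in> Obj \<C>" "h \<in> factoring \<C> \<W> B C" "f \<in> mor \<C> A B"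
  shows "h \<bullet>\<^bsub>\<C>\<^esub> f \<in> factoring \<C> \<W> A C"
proof -
  obtain W g k where "W \<in> \<W>" "W \<in> Obj \<C>" "g \<in> mor \<C> B W" "k \<in> mor \<C> W C" "h = k \<bullet>\<^bsub>\<C>\<^esub> g"
    using factoringE[OF assms(4)] .
  then show ?thesis
    using assms factoringI[of W "g \<bullet>\<^bsub>\<C>\<^esub> f" A k C] Comp_assoc[of A B W C f g k] Comp_mor[of A B W f g] by simp
qed

text \<open>The sum of two composites through V and W is one composite through their direct sum,
  which lies in \<W>.\<close>

lemma factoring_add:
  assumes AB: "A \<in> Obj \<C>" "B \<in> Obj \<C>" and "h \<in> factoring \<C> \<W> A B" "k \<in> factoring \<C> \<W> A B"
  shows "h \<oplus>\<^bsub>Hom \<C> A B\<^esub> k \<in> factoring \<C> \<W> A B"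
proof -
  obtain V f g where V: "V \<in> \<W>" "V \<in> Obj \<C>" "f \<in> mor \<C> A V" "g \<in> mor \<C> V B" "h = g \<bullet>\<^bsub>\<C>\<^esub> f"
    using factoringE[OF assms(3)] .
  obtain W f' g' where W: "W \<in> \<W>" "W \<in> Obj \<C>" "f' \<in> mor \<C> A W" "g' \<in> mor \<C> W B" "k = g' \<bullet>\<^bsub>\<C>\<^esub> f'"
    using factoringE[OF assms(4)] .
  obtain S i j p q where bp: "biproduct \<C> V W S i j p q"
    using direct_sum_exists V W unfolding direct_sum_def by blast
  then have S: "S \<in> \<W>" using direct_sum_\<W> V W unfolding direct_sum_def by blast
  have [simp]: "S \<in> Obj \<C>" "i \<in> mor \<C> V S" "j \<in> mor \<C> W S" "p \<in> mor \<C> S V" "q \<in> mor \<C> S W"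
    and e: "p \<bullet>\<^bsub>\<C>\<^esub> i = Ident \<C> V" "q \<bullet>\<^bsub>\<C>\<^esub> j = Ident \<C> W"
      "p \<bullet>\<^bsub>\<C>\<^esub> j = \<zero>\<^bsub>Hom \<C> W V\<^esub>" "q \<bullet>\<^bsub>\<C>\<^esub> i = \<zero>\<^bsub>Hom \<C> V W\<^esub>"
    using bp unfolding biproduct_def by auto
  note [simp] = AB V(2-4) W(2-4)
  interpret VB: abelian_group "Hom \<C> V B" using Hom_abelian by simp
  interpret WB: abelian_group "Hom \<C> W B" using Hom_abelian by simp
  \<comment> \<open>As matrices, r is the row with entries g and g', and s is the column with
    entries f and f'; their product is \<open>g f + g' f'\<close>.\<close>
  define r where "r = (g \<bullet>\<^bsub>\<C>\<^esub> p) \<oplus>\<^bsub>Hom \<C> S B\<^esub> (g' \<bullet>\<^bsub>\<C>\<^esub> q)"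
  define s where "s = (i \<bullet>\<^bsub>\<C>\<^esub> f) \<oplus>\<^bsub>Hom \<C> A S\<^esub> (j \<bullet>\<^bsub>\<C>\<^esub> f')"
  have m [simp]: "g \<bullet>\<^bsub>\<C>\<^esub> p \<in> mor \<C> S B" "g' \<bullet>\<^bsub>\<C>\<^esub> q \<in> mor \<C> S B" "i \<bullet>\<^bsub>\<C>\<^esub> f \<in> mor \<C> A S" "j \<bullet>\<^bsub>\<C>\<^esub> f' \<in> mor \<C> A S"
    by (rule Comp_mor[of _ V] Comp_mor[of _ W]; simp)+
  have r [simp]: "r \<in> mor \<C> S B" and s: "s \<in> mor \<C> A S" unfolding r_def s_def by (simp_all add: add_mor)
  have "r \<bullet>\<^bsub>\<C>\<^esub> i = g \<bullet>\<^bsub>\<C>\<^esub> p \<bullet>\<^bsub>\<C>\<^esub> i \<oplus>\<^bsub>Hom \<C> V B\<^esub> g' \<bullet>\<^bsub>\<C>\<^esub> q \<bullet>\<^bsub>\<C>\<^esub> i"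
    unfolding r_def by (rule Comp_add_left) simp_all
  also have "\<dots> = g"
    using e Comp_assoc[of V S V B i p g, symmetric] Comp_assoc[of V S W B i q g', symmetric]
      Ident_right[of V B g] comp_zero[of V W B g'] by simp
  finally have ri: "r \<bullet>\<^bsub>\<C>\<^esub> i = g" .
  have "r \<bullet>\<^bsub>\<C>\<^esub> j = g \<bullet>\<^bsub>\<C>\<^esub> p \<bullet>\<^bsub>\<C>\<^esub> j \<oplus>\<^bsub>Hom \<C> W B\<^esub> g' \<bullet>\<^bsub>\<C>\<^esub> q \<bullet>\<^bsub>\<C>\<^esub> j"
    unfolding r_def by (rule Comp_add_left) simp_all
  also have "\<dots> = g'"
    using e Comp_assoc[of W S V B j p g, symmetric] Comp_assoc[of W S W B j q g', symmetric]
      Ident_right[of W B g'] comp_zero[of W V B g] by simp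
  finally have rj: "r \<bullet>\<^bsub>\<C>\<^esub> j = g'" .
  have "r \<bullet>\<^bsub>\<C>\<^esub> s = r \<bullet>\<^bsub>\<C>\<^esub> (i \<bullet>\<^bsub>\<C>\<^esub> f) \<oplus>\<^bsub>Hom \<C> A B\<^esub> r \<bullet>\<^bsub>\<C>\<^esub> (j \<bullet>\<^bsub>\<C>\<^esub> f')"
    unfolding s_def by (rule Comp_add_right[of A S B]) simp_all
  also have "\<dots> = h \<oplus>\<^bsub>Hom \<C> A B\<^esub> k"
    using Comp_assoc[of A V S B f i r] Comp_assoc[of A W S B f' j r] ri rj V(5) W(5) by simp
  finally show ?thesis using factoringI[OF S s r] by simp
qed

lemma factoring_subgroup:
  assumes AB: "A \<in> Obj \<C>" "B \<in> Obj \<C>"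
  shows "abelian_subgroup (factoring \<C> \<W> A B) (Hom \<C> A B)"
proof (intro abelian_subgroupI3 additive_subgroupI)
  show "abelian_group (Hom \<C> A B)" using AB by (rule Hom_abelian)
  then interpret abelian_group "Hom \<C> A B" .
  show "subgroup (factoring \<C> \<W> A B) (add_monoid (Hom \<C> A B))"
  proof (rule add.subgroupI)
    show "factoring \<C> \<W> A B \<subseteq> mor \<C> A B" using factoring_mor[OF AB] by (rule subsetI)
    obtain Z where "zero_object \<C> Z" using zero_exists by blast
    then show "factoring \<C> \<W> A B \<noteq> {}"
      using zero_\<W> zero_mor[of A Z] zero_mor[of Z B] zero_object_Obj AB factoringI by blast
  next
    fix h assume "h \<in> factoring \<C> \<W> A B"
    then obtain W f g where "W \<in> \<W>" "W \<in> Obj \<C>" "f \<in> mor \<C> A W" "g \<in> mor \<C> W B" "h = g \<bullet>\<^bsub>\<C>\<^esub> f"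
      by (rule factoringE)
    then show "\<ominus>\<^bsub>Hom \<C> A B\<^esub> h \<in> factoring \<C> \<W> A B"
      using uminus_comp[of A W B f g] uminus_mor[of W B g] factoringI[of W f A "\<ominus>\<^bsub>Hom \<C> W B\<^esub> g" B] AB by simp
  qed (rule factoring_add[OF AB])
qed

lemma stable_category_simps:
  "Obj \<S> = Obj \<C>" "Ident \<S> A = stable_mor \<C> \<W> A A (Ident \<C> A)"
  unfolding stable_category_def stable_mor_def by simp_all

text \<open>Every stable morphism has a representative, which lets the duality arguments compute
  with morphisms of \<C>.\<close>

lemma mor_stable:
  assumes "A \<in> Obj \<C>" "B \<in> Obj \<C>"
  shows "mor \<S> A B = stable_mor \<C> \<W> A B ` mor \<C> A B"
proof -
  interpret abelian_group "Hom \<C> A B" using assms by (rule Hom_abelian)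
  show ?thesis unfolding stable_category_def stable_mor_def quotient_module_def A_RCOSETS_def' by auto
qed

lemma stable_mor_mem:
  assumes "A \<in> Obj \<C>" "B \<in> Obj \<C>" "f \<in> mor \<C> A B" "f' \<in> stable_mor \<C> \<W> A B f"
  obtains n where "n \<in> factoring \<C> \<W> A B" "f' = n \<oplus>\<^bsub>Hom \<C> A B\<^esub> f"
  using assms(4) unfolding stable_mor_def a_r_coset_def' by auto

lemma stable_mor_subset:
  assumes "A \<in> Obj \<C>" "B \<in> Obj \<C>" "f \<in> mor \<C> A B"
  shows "stable_mor \<C> \<W> A B f \<subseteq> mor \<C> A B"
  using stable_mor_mem[OF assms] factoring_mor add_mor assms by (metis subsetI)

lemma stable_mor_self:
  assumes "A \<in> Obj \<C>" "B \<in> Obj \<C>" "f \<in> mor \<C> A B"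
  shows "f \<in> stable_mor \<C> \<W> A B f"
  unfolding stable_mor_def
  by (rule abelian_subgroup.a_rcos_self[OF factoring_subgroup]) (use assms in auto)

text \<open>Stable composition is defined as a union over all composable representatives. With
  \<open>f' = n + f\<close> and \<open>g' = m + g\<close> for n and m in the ideal, the composite of
  g' and f' is \<open>(m f' + g n) + g f\<close>, so every pair contributes the same coset.\<close>

lemma stable_mor_comp:
  assumes ob: "A \<in> Obj \<C>" "B \<in> Obj \<C>" "C \<in> Obj \<C>" and f: "f \<in> mor \<C> A B" and g: "g \<in> mor \<C> B C"
  shows "stable_mor \<C> \<W> B C g \<bullet>\<^bsub>\<S>\<^esub> stable_mor \<C> \<W> A B f = stable_mor \<C> \<W> A C (g \<bullet>\<^bsub>\<C>\<^esub> f)"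
proof -
  have gf: "g \<bullet>\<^bsub>\<C>\<^esub> f \<in> mor \<C> A C" using Comp_mor ob f g by blast
  interpret AC: abelian_group "Hom \<C> A C" using Hom_abelian ob by blast
  have eq: "stable_mor \<C> \<W> A C (g' \<bullet>\<^bsub>\<C>\<^esub> f') = stable_mor \<C> \<W> A C (g \<bullet>\<^bsub>\<C>\<^esub> f)"
    if f': "f' \<in> stable_mor \<C> \<W> A B f" and g': "g' \<in> stable_mor \<C> \<W> B C g" for f' g'
  proof -
    obtain n where n: "n \<in> factoring \<C> \<W> A B" "f' = n \<oplus>\<^bsub>Hom \<C> A B\<^esub> f"
      using stable_mor_mem[OF ob(1,2) f f'] .
    obtain m where m: "m \<in> factoring \<C> \<W> B C" "g' = m \<oplus>\<^bsub>Hom \<C> B C\<^esub> g"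
      using stable_mor_mem[OF ob(2,3) g g'] .
    note nm = factoring_mor[OF ob(1,2) n(1)] factoring_mor[OF ob(2,3) m(1)]
    have f'm: "f' \<in> mor \<C> A B" using add_mor[OF ob(1,2)] n nm f by simp
    have 1: "m \<bullet>\<^bsub>\<C>\<^esub> f' \<in> factoring \<C> \<W> A C" "g \<bullet>\<^bsub>\<C>\<^esub> n \<in> factoring \<C> \<W> A C"
      using factoring_comp_right[OF ob m(1) f'm] factoring_comp_left[OF ob n(1) g] by auto
    have "g' \<bullet>\<^bsub>\<C>\<^esub> f' = (m \<bullet>\<^bsub>\<C>\<^esub> f' \<oplus>\<^bsub>Hom \<C> A C\<^esub> g \<bullet>\<^bsub>\<C>\<^esub> n) \<oplus>\<^bsub>Hom \<C> A C\<^esub> g \<bullet>\<^bsub>\<C>\<^esub> f"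
      using Comp_add_left[OF ob f'm nm(2) g] Comp_add_right[OF ob nm(1) f g] n(2) m(2)
        AC.a_assoc[OF factoring_mor[OF ob(1,3) 1(1)] factoring_mor[OF ob(1,3) 1(2)] gf] by simp
    then have "g' \<bullet>\<^bsub>\<C>\<^esub> f' \<in> stable_mor \<C> \<W> A C (g \<bullet>\<^bsub>\<C>\<^esub> f)"
      unfolding stable_mor_def a_r_coset_def' using factoring_add[OF ob(1,3) 1] by auto
    then show ?thesis
      unfolding stable_mor_def
      using AC.a_repr_independence[of _ "factoring \<C> \<W> A C"] gf
        abelian_subgroup.axioms(1)[OF factoring_subgroup[OF ob(1,3)]] additive_subgroup.a_subgroup by metis
  qed
  have sub: "stable_mor \<C> \<W> A B f \<subseteq> mor \<C> A B" "stable_mor \<C> \<W> B C g \<subseteq> mor \<C> B C"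
    using stable_mor_subset ob f g by auto
  have "h \<in> stable_mor \<C> \<W> B C g \<bullet>\<^bsub>\<S>\<^esub> stable_mor \<C> \<W> A B f \<longleftrightarrow>
      (\<exists>A' \<in> Obj \<C>. \<exists>B' \<in> Obj \<C>. \<exists>C' \<in> Obj \<C>. \<exists>f' \<in> stable_mor \<C> \<W> A B f \<inter> mor \<C> A' B'.
        \<exists>g' \<in> stable_mor \<C> \<W> B C g \<inter> mor \<C> B' C'. h \<in> stable_mor \<C> \<W> A' C' (g' \<bullet>\<^bsub>\<C>\<^esub> f'))" for h
    unfolding stable_category_def stable_mor_def by simp
  also have "\<dots> h \<longleftrightarrow> h \<in> stable_mor \<C> \<W> A C (g \<bullet>\<^bsub>\<C>\<^esub> f)" for h
  proof
    assume "\<exists>A' \<in> Obj \<C>. \<exists>B' \<in> Obj \<C>. \<exists>C' \<in> Obj \<C>. \<exists>f' \<in> stable_mor \<C> \<W> A B f \<inter> mor \<C> A' B'.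
        \<exists>g' \<in> stable_mor \<C> \<W> B C g \<inter> mor \<C> B' C'. h \<in> stable_mor \<C> \<W> A' C' (g' \<bullet>\<^bsub>\<C>\<^esub> f')"
    then obtain A' B' C' f' g' where *: "A' \<in> Obj \<C>" "B' \<in> Obj \<C>" "C' \<in> Obj \<C>"
        "f' \<in> stable_mor \<C> \<W> A B f" "f' \<in> mor \<C> A' B'" "g' \<in> stable_mor \<C> \<W> B C g" "g' \<in> mor \<C> B' C'"
        "h \<in> stable_mor \<C> \<W> A' C' (g' \<bullet>\<^bsub>\<C>\<^esub> f')" by blast
    \<comment> \<open>The definition of composition quantifies over objects; disjointness of
      Hom-sets forces them, since a morphism determines its source and target.\<close>
    then have "A' = A" "C' = C" using Hom_disjoint ob sub by blast+
    then show "h \<in> stable_mor \<C> \<W> A C (g \<bullet>\<^bsub>\<C>\<^esub> f)" using eq[OF *(4,6)] *(8) by simp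
  next
    assume "h \<in> stable_mor \<C> \<W> A C (g \<bullet>\<^bsub>\<C>\<^esub> f)"
    then show "\<exists>A' \<in> Obj \<C>. \<exists>B' \<in> Obj \<C>. \<exists>C' \<in> Obj \<C>. \<exists>f' \<in> stable_mor \<C> \<W> A B f \<inter> mor \<C> A' B'.
        \<exists>g' \<in> stable_mor \<C> \<W> B C g \<inter> mor \<C> B' C'. h \<in> stable_mor \<C> \<W> A' C' (g' \<bullet>\<^bsub>\<C>\<^esub> f')"
      using ob f g stable_mor_self by blast
  qed
  finally show ?thesis by blast
qed

end

section \<open>Auslander--Reiten triangles\<close>

context extriangulated_category
begin

text \<open>If \<phi> were not a retraction, it would factor through g, and the pullback of \<delta>
  along it, which is \<delta>, would vanish; but then g would be a retraction. So \<phi> has a right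
  inverse s, and s fixes \<delta> as well and has a right inverse for the same reason. Hence \<phi>
  is invertible on both sides.\<close>

lemma sink_endomorphism_iso:
  assumes C: "C \<in> Obj \<C>" and A: "A \<in> Obj \<C>" and \<delta>: "\<delta> \<in> ext \<E> C A" and t: "(f, B, g) \<in> \<s> C A \<delta>"
    and sink: "sink_morphism \<C> B C g"
    and \<phi>: "\<phi> \<in> mor \<C> C C" and fix_\<delta>: "pull \<C> \<E> A \<phi> \<delta> = \<delta>"
  shows "isomorphism \<C> C C \<phi>"
proof -
  have retr: "\<exists>s \<in> mor \<C> C C. \<phi> \<bullet>\<^bsub>\<C>\<^esub> s = Ident \<C> C"
    if p: "\<phi> \<in> mor \<C> C C" and pd: "pull \<C> \<E> A \<phi> \<delta> = \<delta>" for \<phi>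
  proof (rule ccontr)
    assume "\<not> ?thesis"
    then have "\<exists>v \<in> mor \<C> C B. g \<bullet>\<^bsub>\<C>\<^esub> v = \<phi>"
      using sink C p unfolding sink_morphism_def is_retraction_def by blast
    then have "\<delta> = \<one>\<^bsub>Ext \<E> C A\<^esub>" using pull_eq_one_iff[OF C A \<delta> t C p] pd by simp
    then have "\<exists>v \<in> mor \<C> C B. g \<bullet>\<^bsub>\<C>\<^esub> v = Ident \<C> C"
      using pull_eq_one_iff[OF C A \<delta> t C Ident_mor[OF C]] pull_Ident[OF C A \<delta>] by simp
    then show False using sink unfolding sink_morphism_def is_retraction_def by blast
  qed
  obtain s where s: "s \<in> mor \<C> C C" "\<phi> \<bullet>\<^bsub>\<C>\<^esub> s = Ident \<C> C" using retr[OF \<phi> fix_\<delta>] by blast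
  have "pull \<C> \<E> A s \<delta> = \<delta>"
    using pull_pull[OF C A C C \<phi> s(1) \<delta>] fix_\<delta> s(2) pull_Ident[OF C A \<delta>] by simp
  then obtain r where r: "r \<in> mor \<C> C C" "s \<bullet>\<^bsub>\<C>\<^esub> r = Ident \<C> C" using retr[OF s(1)] by blast
  have "\<phi> = r"
    using Comp_assoc[OF C C C C r(1) s(1) \<phi>] r s Ident_left[OF C C r(1)] Ident_right[OF C C \<phi>] by simp
  then show ?thesis using \<phi> r s unfolding isomorphism_def by blast
qed

text \<open>If k were a retraction of \<open>f' \<theta>\<close>, then \<open>k f'\<close> would be
  a left inverse of \<theta> and hence equal to the right inverse \<open>\<theta>'\<close>, so
  \<open>\<theta> k\<close> would be a retraction of f'. Thus \<open>f' \<theta>\<close> is not a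
  section, it factors through the source morphism f, and (ET3) yields the map on end terms.\<close>

lemma source_comparison:
  assumes t: "E_triangle \<C> \<E> \<s> A f B g C \<delta>" and t': "E_triangle \<C> \<E> \<s> A' f' B' g' C' \<delta>'"
    and src: "source_morphism \<C> A B f" and ns: "\<not> is_section \<C> A' B' f'"
    and \<theta>: "\<theta> \<in> mor \<C> A A'" "\<theta>' \<in> mor \<C> A' A" "\<theta> \<bullet>\<^bsub>\<C>\<^esub> \<theta>' = Ident \<C> A'"
  obtains c where "c \<in> mor \<C> C C'" "push \<C> \<E> C \<theta> \<delta> = pull \<C> \<E> A' c \<delta>'"
proof -
  have ob: "A \<in> Obj \<C>" "C \<in> Obj \<C>" "A' \<in> Obj \<C>" "C' \<in> Obj \<C>"
    and d: "\<delta> \<in> ext \<E> C A" "\<delta>' \<in> ext \<E> C' A'"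
    and r: "(f, B, g) \<in> \<s> C A \<delta>" "(f', B', g') \<in> \<s> C' A' \<delta>'"
    using t t' unfolding E_triangle_def by auto
  note B = realization_mor[OF ob(2,1) d(1) r(1)]
  note B' = realization_mor[OF ob(4,3) d(2) r(2)]
  have m: "f' \<bullet>\<^bsub>\<C>\<^esub> \<theta> \<in> mor \<C> A B'" using Comp_mor[OF ob(1,3) B'(1) \<theta>(1) B'(2)] .
  have "\<not> is_section \<C> A B' (f' \<bullet>\<^bsub>\<C>\<^esub> \<theta>)"
  proof
    assume "is_section \<C> A B' (f' \<bullet>\<^bsub>\<C>\<^esub> \<theta>)"
    then obtain k where k: "k \<in> mor \<C> B' A" "k \<bullet>\<^bsub>\<C>\<^esub> (f' \<bullet>\<^bsub>\<C>\<^esub> \<theta>) = Ident \<C> A"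
      unfolding is_section_def by blast
    have kf: "k \<bullet>\<^bsub>\<C>\<^esub> f' \<in> mor \<C> A' A" using Comp_mor[OF ob(3) B'(1) ob(1) B'(2) k(1)] .
    have "(k \<bullet>\<^bsub>\<C>\<^esub> f') \<bullet>\<^bsub>\<C>\<^esub> \<theta> = Ident \<C> A"
      using Comp_assoc[OF ob(1,3) B'(1) ob(1) \<theta>(1) B'(2) k(1)] k(2) by simp
    then have "k \<bullet>\<^bsub>\<C>\<^esub> f' = \<theta>'"
      using Comp_assoc[OF ob(3,1,3,1) \<theta>(2,1) kf] \<theta>(3) Ident_left[OF ob(3,1) \<theta>(2)] Ident_right[OF ob(3,1) kf]
      by simp
    then have "(\<theta> \<bullet>\<^bsub>\<C>\<^esub> k) \<bullet>\<^bsub>\<C>\<^esub> f' = Ident \<C> A'"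
      using Comp_assoc[OF ob(3) B'(1) ob(1,3) B'(2) k(1) \<theta>(1)] \<theta>(3) by simp
    moreover have "\<theta> \<bullet>\<^bsub>\<C>\<^esub> k \<in> mor \<C> B' A'" using Comp_mor[OF B'(1) ob(1,3) k(1) \<theta>(1)] .
    ultimately show False using ns unfolding is_section_def by blast
  qed
  then obtain b where b: "b \<in> mor \<C> B B'" "b \<bullet>\<^bsub>\<C>\<^esub> f = f' \<bullet>\<^bsub>\<C>\<^esub> \<theta>"
    using src m B'(1) unfolding source_morphism_def by blast
  then show ?thesis using that ET3[OF ob d r \<theta>(1) b] by blast
qed

text \<open>An isomorphism of starting terms induces comparison maps of end terms in both
  directions. Their composites fix the two extensions, hence are automorphisms by the sink property,
  so each comparison map is an isomorphism.\<close>

lemma AR_triangle_ends_unique: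
  assumes "AR_triangle_ends \<C> \<E> \<s> A C" "AR_triangle_ends \<C> \<E> \<s> A' C'" "isomorphic \<C> A A'"
  shows "isomorphic \<C> C C'"
proof -
  obtain f B g \<delta> where t: "E_triangle \<C> \<E> \<s> A f B g C \<delta>" "source_morphism \<C> A B f" "sink_morphism \<C> B C g"
    using assms(1) unfolding AR_triangle_ends_def by blast
  obtain f' B' g' \<delta>' where t': "E_triangle \<C> \<E> \<s> A' f' B' g' C' \<delta>'" "source_morphism \<C> A' B' f'"
      "sink_morphism \<C> B' C' g'"
    using assms(2) unfolding AR_triangle_ends_def by blast
  have ob: "A \<in> Obj \<C>" "C \<in> Obj \<C>" "A' \<in> Obj \<C>" "C' \<in> Obj \<C>"
    and d: "\<delta> \<in> ext \<E> C A" "\<delta>' \<in> ext \<E> C' A'"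
    and r: "(f, B, g) \<in> \<s> C A \<delta>" "(f', B', g') \<in> \<s> C' A' \<delta>'"
    using t(1) t'(1) unfolding E_triangle_def by auto
  obtain \<theta> \<theta>' where \<theta>: "\<theta> \<in> mor \<C> A A'" "\<theta>' \<in> mor \<C> A' A"
      "\<theta>' \<bullet>\<^bsub>\<C>\<^esub> \<theta> = Ident \<C> A" "\<theta> \<bullet>\<^bsub>\<C>\<^esub> \<theta>' = Ident \<C> A'"
    using assms(3) unfolding isomorphic_def isomorphism_def by blast
  have ns: "\<not> is_section \<C> A B f" "\<not> is_section \<C> A' B' f'"
    using t(2) t'(2) unfolding source_morphism_def by blast+
  obtain c where c: "c \<in> mor \<C> C C'" "push \<C> \<E> C \<theta> \<delta> = pull \<C> \<E> A' c \<delta>'"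
    using source_comparison[OF t(1) t'(1) t(2) ns(2) \<theta>(1,2,4)] .
  obtain c' where c': "c' \<in> mor \<C> C' C" "push \<C> \<E> C' \<theta>' \<delta>' = pull \<C> \<E> A c' \<delta>"
    using source_comparison[OF t'(1) t(1) t'(2) ns(1) \<theta>(2,1,3)] .
  \<comment> \<open>Because pushing and pulling commute, pulling \<delta> back along
    \<open>c' c\<close> becomes pushing it along \<open>\<theta>' \<theta>\<close>, which is the
    identity.\<close>
  have "pull \<C> \<E> A (c' \<bullet>\<^bsub>\<C>\<^esub> c) \<delta> = pull \<C> \<E> A c (push \<C> \<E> C' \<theta>' \<delta>')"
    using pull_pull[OF ob(2,1,4,2) c'(1) c(1) d(1)] c'(2) by simp
  also have "\<dots> = push \<C> \<E> C \<theta>' (push \<C> \<E> C \<theta> \<delta>)"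
    using push_pull[OF ob(4,3,2,1) c(1) \<theta>(2) d(2)] c(2) by simp
  also have "\<dots> = \<delta>"
    using push_push[OF ob(2,1,3,1) \<theta>(1,2) d(1)] \<theta>(3) push_Ident[OF ob(2,1) d(1)] by simp
  finally have 1: "pull \<C> \<E> A (c' \<bullet>\<^bsub>\<C>\<^esub> c) \<delta> = \<delta>" .
  have "pull \<C> \<E> A' (c \<bullet>\<^bsub>\<C>\<^esub> c') \<delta>' = pull \<C> \<E> A' c' (push \<C> \<E> C \<theta> \<delta>)"
    using pull_pull[OF ob(4,3,2,4) c(1) c'(1) d(2)] c(2) by simp
  also have "\<dots> = push \<C> \<E> C' \<theta> (push \<C> \<E> C' \<theta>' \<delta>')"
    using push_pull[OF ob(2,1,4,3) c'(1) \<theta>(1) d(1)] c'(2) by simp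
  also have "\<dots> = \<delta>'"
    using push_push[OF ob(4,3,1,3) \<theta>(2,1) d(2)] \<theta>(4) push_Ident[OF ob(4,3) d(2)] by simp
  finally have 2: "pull \<C> \<E> A' (c \<bullet>\<^bsub>\<C>\<^esub> c') \<delta>' = \<delta>'" .
  have "isomorphism \<C> C C (c' \<bullet>\<^bsub>\<C>\<^esub> c)"
    using sink_endomorphism_iso[OF ob(2,1) d(1) r(1) t(3) _ 1] Comp_mor[OF ob(2,4,2) c(1) c'(1)] by blast
  moreover have "isomorphism \<C> C' C' (c \<bullet>\<^bsub>\<C>\<^esub> c')"
    using sink_endomorphism_iso[OF ob(4,3) d(2) r(2) t'(3) _ 2] Comp_mor[OF ob(4,2,4) c'(1) c(1)] by blast
  ultimately have "isomorphism \<C> C C' c" using isomorphism_factor_left[OF ob(2,4) c(1) c'(1)] by blast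
  then show ?thesis unfolding isomorphic_def using ob by blast
qed

lemma additive_ideal_Inj: "additive_ideal K \<C> (Inj \<C> \<E> \<s>)"
  by unfold_locales (use Inj_iff zero_object_Inj direct_sum_Inj in blast)+

lemma additive_ideal_Proj: "additive_ideal K \<C> (Proj \<C> \<E> \<s>)"
  by unfold_locales (use Proj_iff zero_object_Proj direct_sum_Proj in blast)+

end

text \<open>Induction along a decomposition into objects with local endomorphism ring: closure under
  summands places every piece in \<X>, and closure under sums reassembles the images. T stands for
  either translation, of which only the action on objects matters here.\<close>

lemma (in krull_schmidt_category) subcategory_closed_additive:
  assumes sub: "subcategory \<C> \<X>"
    and add: "\<And>A B S. direct_sum \<C> A B S \<Longrightarrow> direct_sum \<C> (T A) (T B) (T S)"
    and zero: "\<And>Z. zero_object \<C> Z \<Longrightarrow> T Z \<in> \<X>"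
    and ind: "\<And>X. \<lbrakk>X \<in> \<X>; indecomposable \<C> X\<rbrakk> \<Longrightarrow> T X \<in> \<X>"
    and X: "X \<in> \<X>"
  shows "T X \<in> \<X>"
proof -
  have "finite_direct_sum \<C> (local_End \<C>) X"
    using krull_schmidt sub X unfolding subcategory_def by blast
  then show ?thesis using X
  proof (induction rule: finite_direct_sum.induct)
    case (empty Z)
    then show ?case using zero by blast
  next
    case (summand A B S)
    then have "A \<in> \<X>" "B \<in> \<X>" using sub unfolding subcategory_def by blast+
    then have "T A \<in> \<X>" "T B \<in> \<X>" using summand ind local_End_indecomposable by blast+
    then show ?case using add[OF summand(3)] sub unfolding subcategory_def by blast
  qed
qed

section \<open>Duality\<close>

text \<open>Evaluating the homomorphism law at \<chi> yields a scalar equal to its own double, hence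
  zero. Arguing pointwise avoids establishing beforehand that the dual is a group.\<close>

lemma dual_group_iso_one:
  assumes "field K" "group G" "\<Phi> \<in> iso G (dual_group K V)" "\<chi> \<in> carrier V"
  shows "\<Phi> \<one>\<^bsub>G\<^esub> \<chi> = \<zero>\<^bsub>K\<^esub>"
proof -
  interpret field K by fact
  interpret G: group G by fact
  have h: "\<Phi> \<in> hom G (dual_group K V)" using assms(3) unfolding iso_def by blast
  have "\<Phi> \<one>\<^bsub>G\<^esub> \<in> carrier (dual_group K V)" using hom_in_carrier[OF h G.one_closed] .
  then have k: "\<Phi> \<one>\<^bsub>G\<^esub> \<chi> \<in> carrier K" using assms(4) unfolding dual_group_def by auto
  have "\<Phi> (\<one>\<^bsub>G\<^esub> \<otimes>\<^bsub>G\<^esub> \<one>\<^bsub>G\<^esub>) = \<Phi> \<one>\<^bsub>G\<^esub> \<otimes>\<^bsub>dual_group K V\<^esub> \<Phi> \<one>\<^bsub>G\<^esub>"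
    using hom_mult[OF h G.one_closed G.one_closed] .
  then have "\<Phi> \<one>\<^bsub>G\<^esub> = (\<lambda>v \<in> carrier V. \<Phi> \<one>\<^bsub>G\<^esub> v \<oplus>\<^bsub>K\<^esub> \<Phi> \<one>\<^bsub>G\<^esub> v)"
    unfolding dual_group_def by simp
  from fun_cong[OF this, of \<chi>] have "\<Phi> \<one>\<^bsub>G\<^esub> \<chi> = \<Phi> \<one>\<^bsub>G\<^esub> \<chi> \<oplus>\<^bsub>K\<^esub> \<Phi> \<one>\<^bsub>G\<^esub> \<chi>"
    by (rule trans) (simp add: assms(4))
  then show ?thesis using k by (metis add.l_cancel_one')
qed

text \<open>Elements of the dual are extensional functions, so agreement on the carrier of V is
  equality, and injectivity of \<Phi> carries it back to G.\<close>

lemma dual_group_iso_eq_one: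
  assumes "field K" "group G" and iso: "\<Phi> \<in> iso G (dual_group K V)" and \<delta>: "\<delta> \<in> carrier G"
    and zero: "\<And>\<chi>. \<chi> \<in> carrier V \<Longrightarrow> \<Phi> \<delta> \<chi> = \<zero>\<^bsub>K\<^esub>"
  shows "\<delta> = \<one>\<^bsub>G\<^esub>"
proof -
  interpret G: group G by fact
  have h: "\<Phi> \<in> hom G (dual_group K V)" and inj: "inj_on \<Phi> (carrier G)"
    using iso unfolding iso_def bij_betw_def by auto
  have PiE: "\<Phi> \<epsilon> \<in> carrier V \<rightarrow>\<^sub>E carrier K" if "\<epsilon> \<in> carrier G" for \<epsilon>
    using hom_in_carrier[OF h that] unfolding dual_group_def by simp
  have "\<Phi> \<delta> = \<Phi> \<one>\<^bsub>G\<^esub>"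
    by (rule PiE_ext[OF PiE[OF \<delta>] PiE[OF G.one_closed]])
      (simp add: zero dual_group_iso_one[OF assms(1,2) iso])
  then show ?thesis using inj \<delta> by (meson G.one_closed inj_onD)
qed

context relative_structure
begin

text \<open>Let p represent \<psi> and t represent the translate of v. Naturality in the first
  variable and naturality in the second both lead to the functional of \<delta> at the class of
  \<open>t p\<close>: from the pullback along v evaluated at \<psi>, and from the pushforward along
  p evaluated at t. The pushforward is zero because p ends in \<open>\<tau> X\<close>, an object of
  \<X>.\<close>

lemma relative_ext_pull:
  assumes tr: "AR_translation \<C> \<E> \<s> \<tau> \<tau>m" and dual: "AR_duality K \<C> \<E> \<s> \<tau> \<tau>m"
    and \<tau>: "\<And>X. X \<in> \<X> \<Longrightarrow> \<tau> X \<in> \<X>"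
    and C: "C \<in> Obj \<C>" and A: "A \<in> Obj \<C>" and \<delta>: "\<delta> \<in> ext \<E>' C A"
    and X: "X \<in> \<X>" and v: "v \<in> mor \<C> X C"
  shows "pull \<C> \<E> A v \<delta> = \<one>\<^bsub>Ext \<E> X A\<^esub>"
proof -
  let ?P = "Proj \<C> \<E> \<s>" and ?I = "Inj \<C> \<E> \<s>"
  interpret P: additive_ideal K \<C> ?P by (rule additive_ideal_Proj)
  interpret I: additive_ideal K \<C> ?I by (rule additive_ideal_Inj)
  obtain \<Phi> where iso: "\<And>A B. \<lbrakk>A \<in> Obj \<C>; B \<in> Obj \<C>\<rbrakk>
        \<Longrightarrow> \<Phi> A B \<in> iso (Ext \<E> A B) (dual_group K (Hom I.\<S> B (\<tau> A)))"
    and nat: "\<And>A B A' B' a b \<delta> \<psi>. \<lbrakk>A \<in> Obj \<C>; B \<in> Obj \<C>; A' \<in> Obj \<C>; B' \<in> Obj \<C>;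
        a \<in> mor \<C> A' A; b \<in> mor \<C> B B'; \<delta> \<in> ext \<E> A B; \<psi> \<in> mor I.\<S> B' (\<tau> A')\<rbrakk>
        \<Longrightarrow> \<Phi> A' B' (ExtMap \<E> a b \<delta>) \<psi> =
            \<Phi> A B \<delta> (\<tau>m (stable_mor \<C> ?P A' A a) \<bullet>\<^bsub>I.\<S>\<^esub> \<psi> \<bullet>\<^bsub>I.\<S>\<^esub> stable_mor \<C> ?I B B' b)"
    using dual unfolding AR_duality_def Let_def
  proof (elim exE conjE, goal_cases)
    case (1 \<Phi>)
    show ?case by (rule 1(1)[of \<Phi>]) (use 1(2,3) in blast)+
  qed
  have F: "additive_functor P.\<S> I.\<S> \<tau> \<tau>m" using tr unfolding AR_translation_def by blast
  have FO: "\<tau> Y \<in> Obj \<C>" if "Y \<in> Obj \<C>" for Y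
    using F that unfolding additive_functor_def P.stable_category_simps I.stable_category_simps by simp
  have XO: "X \<in> Obj \<C>" using X \<X>_Obj by (rule rev_subsetD)
  note T = FO[OF XO] and U = FO[OF C]
  \<comment> \<open>Naturality in the second variable is the case of an identity on C; its image
    under the functor must be recognised as a stable identity before it can be cancelled.\<close>
  have FId: "\<tau>m (stable_mor \<C> ?P C C (Ident \<C> C)) = stable_mor \<C> ?I (\<tau> C) (\<tau> C) (Ident \<C> (\<tau> C))"
    using F C unfolding additive_functor_def P.stable_category_simps I.stable_category_simps by simp
  have "\<tau>m (stable_mor \<C> ?P X C v) \<in> mor I.\<S> (\<tau> X) (\<tau> C)"
    using F XO C v P.mor_stable[OF XO C]
    unfolding additive_functor_def P.stable_category_simps I.stable_category_simps by simp
  then obtain t where t: "t \<in> mor \<C> (\<tau> X) (\<tau> C)"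
      and tv: "\<tau>m (stable_mor \<C> ?P X C v) = stable_mor \<C> ?I (\<tau> X) (\<tau> C) t"
    unfolding I.mor_stable[OF T U] by blast
  note d = relative_extD[OF \<delta>]
  have "\<Phi> X A (pull \<C> \<E> A v \<delta>) \<psi> = \<zero>\<^bsub>K\<^esub>" if \<psi>: "\<psi> \<in> mor I.\<S> A (\<tau> X)" for \<psi>
  proof -
    obtain p where p: "p \<in> mor \<C> A (\<tau> X)" and \<psi>p: "\<psi> = stable_mor \<C> ?I A (\<tau> X) p"
      using \<psi> unfolding I.mor_stable[OF A T] by blast
    have tp: "t \<bullet>\<^bsub>\<C>\<^esub> p \<in> mor \<C> A (\<tau> C)" using Comp_mor[OF A T U p t] .
    \<comment> \<open>Naturality in the first variable, with the identity on A in the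
      second.\<close>
    have "\<Phi> X A (pull \<C> \<E> A v \<delta>) \<psi> = \<Phi> C A \<delta> (stable_mor \<C> ?I A (\<tau> C) (t \<bullet>\<^bsub>\<C>\<^esub> p))"
      unfolding pull_def nat[OF C A XO A v Ident_mor[OF A] d \<psi>] tv
      using \<psi>p I.stable_mor_comp[OF A T U p t] I.stable_mor_comp[OF A A U Ident_mor[OF A] tp]
        Ident_right[OF A U tp] by simp
    \<comment> \<open>Naturality in the second variable reaches the same value by moving p from the
      argument onto the extension.\<close>
    moreover have "\<Phi> C (\<tau> X) (push \<C> \<E> C p \<delta>) (stable_mor \<C> ?I (\<tau> X) (\<tau> C) t)
        = \<Phi> C A \<delta> (stable_mor \<C> ?I A (\<tau> C) (t \<bullet>\<^bsub>\<C>\<^esub> p))"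
      using nat[OF C A C T Ident_mor[OF C] p d, of "stable_mor \<C> ?I (\<tau> X) (\<tau> C) t"] t
        I.mor_stable[OF T U] FId I.stable_mor_comp[OF A T U p t]
        I.stable_mor_comp[OF T U U t Ident_mor[OF U]] Ident_left[OF T U t]
      unfolding push_def by simp
    moreover have "push \<C> \<E> C p \<delta> = \<one>\<^bsub>Ext \<E> C (\<tau> X)\<^esub>"
      using relative_ext_push[OF C A \<delta> \<tau>[OF X] p] .
    moreover have "\<Phi> C (\<tau> X) \<one>\<^bsub>Ext \<E> C (\<tau> X)\<^esub> (stable_mor \<C> ?I (\<tau> X) (\<tau> C) t) = \<zero>\<^bsub>K\<^esub>"
      using t I.mor_stable[OF T U] by (intro dual_group_iso_one[OF field_K Ext_group[OF C T] iso[OF C T]]) simp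
    ultimately show ?thesis by simp
  qed
  then show ?thesis
    by (rule dual_group_iso_eq_one[OF field_K Ext_group[OF XO A] iso[OF XO A] pull_closed[OF C A XO v d]])
qed

text \<open>The mirror computation modulo projectives. For q from \<open>\<tau>' X\<close> to C and
  t representing the translate of u, the pushforward along u evaluated at q and the pullback along q
  evaluated at t are both the functional of \<delta> at the class of \<open>q t\<close>. The
  pullback is zero because q starts in \<open>\<tau>' X\<close>, an object of \<X>.\<close>

lemma relative_extI_pull:
  assumes tr: "AR_cotranslation \<C> \<E> \<s> \<tau>' \<tau>m'" and dual: "AR_coduality K \<C> \<E> \<s> \<tau>' \<tau>m'"
    and \<tau>': "\<And>X. X \<in> \<X> \<Longrightarrow> \<tau>' X \<in> \<X>"
    and C: "C \<in> Obj \<C>" and A: "A \<in> Obj \<C>" and \<delta>: "\<delta> \<in> ext \<E> C A"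
    and pull: "\<And>X v. \<lbrakk>X \<in> \<X>; v \<in> mor \<C> X C\<rbrakk> \<Longrightarrow> pull \<C> \<E> A v \<delta> = \<one>\<^bsub>Ext \<E> X A\<^esub>"
  shows "\<delta> \<in> ext \<E>' C A"
  unfolding relative_ext_iff[OF C A]
proof (intro conjI ballI \<delta>)
  fix X u assume X: "X \<in> \<X>" and u: "u \<in> mor \<C> A X"
  let ?P = "Proj \<C> \<E> \<s>" and ?I = "Inj \<C> \<E> \<s>"
  interpret P: additive_ideal K \<C> ?P by (rule additive_ideal_Proj)
  interpret I: additive_ideal K \<C> ?I by (rule additive_ideal_Inj)
  obtain \<Psi> where iso: "\<And>A B. \<lbrakk>A \<in> Obj \<C>; B \<in> Obj \<C>\<rbrakk>
        \<Longrightarrow> \<Psi> A B \<in> iso (Ext \<E> A B) (dual_group K (Hom P.\<S> (\<tau>' B) A))"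
    and nat: "\<And>A B A' B' a b \<delta> \<psi>. \<lbrakk>A \<in> Obj \<C>; B \<in> Obj \<C>; A' \<in> Obj \<C>; B' \<in> Obj \<C>;
        a \<in> mor \<C> A' A; b \<in> mor \<C> B B'; \<delta> \<in> ext \<E> A B; \<psi> \<in> mor P.\<S> (\<tau>' B') A'\<rbrakk>
        \<Longrightarrow> \<Psi> A' B' (ExtMap \<E> a b \<delta>) \<psi> =
            \<Psi> A B \<delta> (stable_mor \<C> ?P A' A a \<bullet>\<^bsub>P.\<S>\<^esub> \<psi> \<bullet>\<^bsub>P.\<S>\<^esub> \<tau>m' (stable_mor \<C> ?I B B' b))"
    using dual unfolding AR_coduality_def Let_def
  proof (elim exE conjE, goal_cases)
    case (1 \<Psi>)
    show ?case by (rule 1(1)[of \<Psi>]) (use 1(2,3) in blast)+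
  qed
  have F: "additive_functor I.\<S> P.\<S> \<tau>' \<tau>m'" using tr unfolding AR_cotranslation_def by blast
  have FO: "\<tau>' Y \<in> Obj \<C>" if "Y \<in> Obj \<C>" for Y
    using F that unfolding additive_functor_def P.stable_category_simps I.stable_category_simps by simp
  have XO: "X \<in> Obj \<C>" using X \<X>_Obj by (rule rev_subsetD)
  note T = FO[OF XO] and U = FO[OF A]
  have FId: "\<tau>m' (stable_mor \<C> ?I A A (Ident \<C> A)) = stable_mor \<C> ?P (\<tau>' A) (\<tau>' A) (Ident \<C> (\<tau>' A))"
    using F A unfolding additive_functor_def P.stable_category_simps I.stable_category_simps by simp
  have "\<tau>m' (stable_mor \<C> ?I A X u) \<in> mor P.\<S> (\<tau>' A) (\<tau>' X)"
    using F XO A u I.mor_stable[OF A XO]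
    unfolding additive_functor_def P.stable_category_simps I.stable_category_simps by simp
  then obtain t where t: "t \<in> mor \<C> (\<tau>' A) (\<tau>' X)"
      and tu: "\<tau>m' (stable_mor \<C> ?I A X u) = stable_mor \<C> ?P (\<tau>' A) (\<tau>' X) t"
    unfolding P.mor_stable[OF U T] by blast
  have "\<Psi> C X (push \<C> \<E> C u \<delta>) \<psi> = \<zero>\<^bsub>K\<^esub>" if \<psi>: "\<psi> \<in> mor P.\<S> (\<tau>' X) C" for \<psi>
  proof -
    obtain q where q: "q \<in> mor \<C> (\<tau>' X) C" and \<psi>q: "\<psi> = stable_mor \<C> ?P (\<tau>' X) C q"
      using \<psi> unfolding P.mor_stable[OF T C] by blast
    have qt: "q \<bullet>\<^bsub>\<C>\<^esub> t \<in> mor \<C> (\<tau>' A) C" using Comp_mor[OF U T C t q] .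
    have "\<Psi> C X (push \<C> \<E> C u \<delta>) \<psi> = \<Psi> C A \<delta> (stable_mor \<C> ?P (\<tau>' A) C (q \<bullet>\<^bsub>\<C>\<^esub> t))"
      unfolding push_def nat[OF C A C XO Ident_mor[OF C] u \<delta> \<psi>] tu
      using \<psi>q P.stable_mor_comp[OF U T C t q] P.stable_mor_comp[OF T C C q Ident_mor[OF C]]
        Ident_left[OF T C q] by simp
    moreover have "\<Psi> (\<tau>' X) A (pull \<C> \<E> A q \<delta>) (stable_mor \<C> ?P (\<tau>' A) (\<tau>' X) t)
        = \<Psi> C A \<delta> (stable_mor \<C> ?P (\<tau>' A) C (q \<bullet>\<^bsub>\<C>\<^esub> t))"
      using nat[OF C A T A q Ident_mor[OF A] \<delta>, of "stable_mor \<C> ?P (\<tau>' A) (\<tau>' X) t"] t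
        P.mor_stable[OF U T] FId P.stable_mor_comp[OF U T C t q]
        P.stable_mor_comp[OF U U C Ident_mor[OF U] qt] Ident_right[OF U C qt]
      unfolding pull_def by simp
    moreover have "pull \<C> \<E> A q \<delta> = \<one>\<^bsub>Ext \<E> (\<tau>' X) A\<^esub>" using pull[OF \<tau>'[OF X] q] .
    moreover have "\<Psi> (\<tau>' X) A \<one>\<^bsub>Ext \<E> (\<tau>' X) A\<^esub> (stable_mor \<C> ?P (\<tau>' A) (\<tau>' X) t) = \<zero>\<^bsub>K\<^esub>"
      using t P.mor_stable[OF U T] by (intro dual_group_iso_one[OF field_K Ext_group[OF T A] iso[OF T A]]) simp
    ultimately show ?thesis by simp
  qed
  then show "push \<C> \<E> C u \<delta> = \<one>\<^bsub>Ext \<E> C X\<^esub>"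
    by (rule dual_group_iso_eq_one[OF field_K Ext_group[OF C XO] iso[OF C XO] push_closed[OF C A XO u \<delta>]])
qed

section \<open>The Frobenius property\<close>

lemma left_approximation_relative:
  assumes t: "E_triangle \<C> \<E> \<s> A f X y L \<delta>" and app: "left_approximation \<C> \<X> A X f"
  shows "\<delta> \<in> ext \<E>' L A"
proof -
  have ob: "L \<in> Obj \<C>" "A \<in> Obj \<C>" "\<delta> \<in> ext \<E> L A" "(f, X, y) \<in> \<s> L A \<delta>"
    using t unfolding E_triangle_def by auto
  have "push \<C> \<E> L u \<delta> = \<one>\<^bsub>Ext \<E> L X'\<^esub>" if "X' \<in> \<X>" "u \<in> mor \<C> A X'" for X' u
  proof -
    have "X' \<in> Obj \<C>" using that(1) \<X>_Obj by (rule rev_subsetD)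
    then show ?thesis
      using push_eq_one_iff[OF ob, of X' u] that app unfolding left_approximation_def by blast
  qed
  then show ?thesis using relative_ext_iff[OF ob(1,2)] ob(3) by blast
qed

text \<open>The approximation property is exactly the lifting condition in the pullback criterion.
  Unlike for left approximations, membership of \<delta> in \<open>\<E>'\<close> is not immediate
  from this; the duality has to convert the vanishing pullbacks into vanishing pushforwards.\<close>

lemma right_approximation_pull:
  assumes t: "E_triangle \<C> \<E> \<s> A x X g C \<delta>" and app: "right_approximation \<C> \<X> X C g"
    and X': "X' \<in> \<X>" and v: "v \<in> mor \<C> X' C"
  shows "pull \<C> \<E> A v \<delta> = \<one>\<^bsub>Ext \<E> X' A\<^esub>"
proof -
  have ob: "C \<in> Obj \<C>" "A \<in> Obj \<C>" "\<delta> \<in> ext \<E> C A" "(x, X, g) \<in> \<s> C A \<delta>"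
    using t unfolding E_triangle_def by auto
  have "X' \<in> Obj \<C>" using X' \<X>_Obj by (rule rev_subsetD)
  then show ?thesis using pull_eq_one_iff[OF ob, of X' v] app X' v unfolding right_approximation_def by blast
qed

lemma E_triangle_relative:
  "\<lbrakk>E_triangle \<C> \<E> \<s> A x B y C \<delta>; \<delta> \<in> ext \<E>' C A\<rbrakk> \<Longrightarrow> E_triangle \<C> \<E>' \<s>' A x B y C \<delta>"
  unfolding E_triangle_def by (simp add: realization_relative)

text \<open>The Auslander-Reiten input is condensed into \<open>pull\<close> and
  \<open>pullI\<close>, which together describe \<open>\<E>'\<close> by vanishing pullbacks from
  \<X>. With both descriptions at hand, right approximations provide enough projectives and left
  approximations enough injectives as soon as both classes are identified with \<X>.\<close>

theorem relative_frobenius: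
  assumes sub: "subcategory \<C> \<X>" and sff: "strongly_functorially_finite \<C> \<E> \<s> \<X>"
    and pull: "\<And>C A \<delta> X v. \<lbrakk>C \<in> Obj \<C>; A \<in> Obj \<C>; \<delta> \<in> ext \<E>' C A; X \<in> \<X>; v \<in> mor \<C> X C\<rbrakk>
      \<Longrightarrow> pull \<C> \<E> A v \<delta> = \<one>\<^bsub>Ext \<E> X A\<^esub>"
    and pullI: "\<And>C A \<delta>. \<lbrakk>C \<in> Obj \<C>; A \<in> Obj \<C>; \<delta> \<in> ext \<E> C A;
        \<And>X v. \<lbrakk>X \<in> \<X>; v \<in> mor \<C> X C\<rbrakk> \<Longrightarrow> pull \<C> \<E> A v \<delta> = \<one>\<^bsub>Ext \<E> X A\<^esub>\<rbrakk>
      \<Longrightarrow> \<delta> \<in> ext \<E>' C A"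
  shows "frobenius_extriangulated_category K \<C> \<E>' \<s>'"
proof -
  interpret R: extriangulated_category K \<C> \<E>' \<s>' by (rule relative_extriangulated)
  \<comment> \<open>The triangle is recorded in both structures: the relative one tests projectivity
    in \<open>\<E>'\<close>, while the splitting is performed with the original realization.\<close>
  have right: "\<exists>A x X g \<delta>. E_triangle \<C> \<E>' \<s>' A x X g C \<delta> \<and> E_triangle \<C> \<E> \<s> A x X g C \<delta> \<and> X \<in> \<X>"
    if C: "C \<in> Obj \<C>" for C
  proof -
    obtain A x X g \<delta> where t: "E_triangle \<C> \<E> \<s> A x X g C \<delta>" and app: "right_approximation \<C> \<X> X C g"
      using sff C unfolding strongly_functorially_finite_def by blast
    have "\<delta> \<in> ext \<E>' C A"
      using t right_approximation_pull[OF t app] unfolding E_triangle_def by (intro pullI) auto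
    then show ?thesis using t E_triangle_relative[OF t] app unfolding right_approximation_def by blast
  qed
  have left: "\<exists>f X y L \<delta>. E_triangle \<C> \<E>' \<s>' A f X y L \<delta> \<and> E_triangle \<C> \<E> \<s> A f X y L \<delta> \<and> X \<in> \<X>"
    if A: "A \<in> Obj \<C>" for A
  proof -
    obtain f X y L \<delta> where t: "E_triangle \<C> \<E> \<s> A f X y L \<delta>" and app: "left_approximation \<C> \<X> A X f"
      using sff A unfolding strongly_functorially_finite_def by blast
    then show ?thesis
      using E_triangle_relative[OF t left_approximation_relative[OF t app]]
      unfolding left_approximation_def by blast
  qed
  have proj: "Proj \<C> \<E>' \<s>' = \<X>"
  proof (intro equalityI subsetI)
    fix P assume "P \<in> Proj \<C> \<E>' \<s>'"
    then have P: "P \<in> Obj \<C>" "\<And>A \<delta>. \<lbrakk>A \<in> Obj \<C>; \<delta> \<in> ext \<E>' P A\<rbrakk> \<Longrightarrow> \<delta> = \<one>\<^bsub>Ext \<E> P A\<^esub>"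
      unfolding R.Proj_iff one_relative by auto
    obtain A x X g \<delta> where t: "E_triangle \<C> \<E>' \<s>' A x X g P \<delta>" "E_triangle \<C> \<E> \<s> A x X g P \<delta>" "X \<in> \<X>"
      using right[OF P(1)] by blast
    \<comment> \<open>Relative projectivity of P makes \<delta> zero, so the triangle splits and P
      is a direct summand of the approximating object X.\<close>
    then have "A \<in> Obj \<C>" "(x, X, g) \<in> \<s> P A \<one>\<^bsub>Ext \<E> P A\<^esub>"
      using P(2)[of A \<delta>] unfolding E_triangle_def by auto
    then show "P \<in> \<X>" using split_triangle_direct_sum P(1) sub t(3) unfolding subcategory_def by blast
  next
    fix X assume X: "X \<in> \<X>"
    then have XO: "X \<in> Obj \<C>" using \<X>_Obj by (rule rev_subsetD)
    \<comment> \<open>Pulling back along the identity of X, a morphism from an object of \<X>, kills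
      every relative extension ending in X.\<close>
    show "X \<in> Proj \<C> \<E>' \<s>'"
      unfolding R.Proj_iff one_relative
      using XO pull[OF XO _ _ X Ident_mor[OF XO]] pull_Ident[OF XO] relative_extD by simp
  qed
  have inj: "Inj \<C> \<E>' \<s>' = \<X>"
  proof (intro equalityI subsetI)
    fix I assume "I \<in> Inj \<C> \<E>' \<s>'"
    then have I: "I \<in> Obj \<C>" "\<And>C \<delta>. \<lbrakk>C \<in> Obj \<C>; \<delta> \<in> ext \<E>' C I\<rbrakk> \<Longrightarrow> \<delta> = \<one>\<^bsub>Ext \<E> C I\<^esub>"
      unfolding R.Inj_iff one_relative by auto
    obtain f X y L \<delta> where t: "E_triangle \<C> \<E>' \<s>' I f X y L \<delta>" "E_triangle \<C> \<E> \<s> I f X y L \<delta>" "X \<in> \<X>"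
      using left[OF I(1)] by blast
    then have "L \<in> Obj \<C>" "(f, X, y) \<in> \<s> L I \<one>\<^bsub>Ext \<E> L I\<^esub>"
      using I(2)[of L \<delta>] unfolding E_triangle_def by auto
    then show "I \<in> \<X>" using split_triangle_direct_sum I(1) sub t(3) unfolding subcategory_def by blast
  next
    fix X assume X: "X \<in> \<X>"
    then have XO: "X \<in> Obj \<C>" using \<X>_Obj by (rule rev_subsetD)
    show "X \<in> Inj \<C> \<E>' \<s>'"
      unfolding R.Inj_iff one_relative
      using XO relative_ext_push[OF _ XO _ X Ident_mor[OF XO]] push_Ident[OF _ XO] relative_extD by simp
  qed
  show ?thesis
  proof (rule frobenius_extriangulated_category.intro[OF relative_extriangulated], unfold_locales)
    show "enough_projectives \<C> \<E>' \<s>'" unfolding enough_projectives_def proj using right by blast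
    show "enough_injectives \<C> \<E>' \<s>'" unfolding enough_injectives_def inj using left by blast
    show "Proj \<C> \<E>' \<s>' = Inj \<C> \<E>' \<s>'" using proj inj by simp
  qed
qed

end

theorem theorem4p8:
  fixes K :: "'k ring" and \<C> :: "('o, 'm, 'k) lin_cat"
    and \<E> :: "('o, 'm, 'e) bifunctor" and \<s> :: "('o, 'm, 'e) realization"
    and \<tau> \<tau>' :: "'o \<Rightarrow> 'o" and \<tau>m \<tau>m' :: "'m set \<Rightarrow> 'm set"
    and \<X> :: "'o set"
  assumes "krull_schmidt_category K \<C>"
    and "extriangulated_category K \<C> \<E> \<s>"
    and "AR_translation \<C> \<E> \<s> \<tau> \<tau>m"
    and "AR_cotranslation \<C> \<E> \<s> \<tau>' \<tau>m'"
    and "subcategory \<C> \<X>"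
    and "strongly_functorially_finite \<C> \<E> \<s> \<X>"
    and "iso_closure \<C> (\<tau> ` indecomposables_outside \<C> \<X> (Proj \<C> \<E> \<s>)) =
         indecomposables_outside \<C> \<X> (Inj \<C> \<E> \<s>)"
    and "AR_duality K \<C> \<E> \<s> \<tau> \<tau>m"
    and "AR_coduality K \<C> \<E> \<s> \<tau>' \<tau>m'"
  shows "frobenius_extriangulated_category K \<C>
           (relative_ext \<C> \<E> \<s> \<X>)
           (restrict_realization (relative_ext \<C> \<E> \<s> \<X>) \<s>)"
proof -
  interpret krull_schmidt_category K \<C> by fact
  interpret extriangulated_category K \<C> \<E> \<s> by fact
  interpret relative_structure K \<C> \<E> \<s> \<X>
    using subcategory_Obj[OF assms(5)] by unfold_locales
  note sub = assms(5)[unfolded subcategory_def]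
  have AR: "\<And>C. \<lbrakk>indecomposable \<C> C; C \<notin> Proj \<C> \<E> \<s>\<rbrakk> \<Longrightarrow> AR_triangle_ends \<C> \<E> \<s> (\<tau> C) C"
    and \<tau>_zero: "\<And>P. P \<in> Proj \<C> \<E> \<s> \<Longrightarrow> zero_object \<C> (\<tau> P)"
    and \<tau>_sum: "\<And>A B S. direct_sum \<C> A B S \<Longrightarrow> direct_sum \<C> (\<tau> A) (\<tau> B) (\<tau> S)"
    using assms(3) unfolding AR_translation_def by blast+
  have AR': "\<And>A. \<lbrakk>indecomposable \<C> A; A \<notin> Inj \<C> \<E> \<s>\<rbrakk> \<Longrightarrow> AR_triangle_ends \<C> \<E> \<s> A (\<tau>' A)"
    and \<tau>'_zero: "\<And>I. I \<in> Inj \<C> \<E> \<s> \<Longrightarrow> zero_object \<C> (\<tau>' I)"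
    and \<tau>'_sum: "\<And>A B S. direct_sum \<C> A B S \<Longrightarrow> direct_sum \<C> (\<tau>' A) (\<tau>' B) (\<tau>' S)"
    using assms(4) unfolding AR_cotranslation_def by blast+
  \<comment> \<open>The hypothesis on \<X> handles the non-projective indecomposables; projectives
    are sent to zero objects, which belong to \<X>.\<close>
  have \<tau>: "\<tau> X \<in> \<X>" if "X \<in> \<X>" for X
  proof (rule subcategory_closed_additive[OF assms(5) \<tau>_sum _ _ that])
    show "\<tau> Z \<in> \<X>" if "zero_object \<C> Z" for Z
      using \<tau>_zero[OF zero_object_Proj[OF that]] sub by blast
  next
    fix X assume X: "X \<in> \<X>" "indecomposable \<C> X"
    show "\<tau> X \<in> \<X>"
    proof (cases "X \<in> Proj \<C> \<E> \<s>")
      case True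
      then show ?thesis using \<tau>_zero sub by blast
    next
      case False
      \<comment> \<open>As the starting term of a triangle, \<open>\<tau> X\<close> is an object,
        hence isomorphic to itself and contained in the closure under isomorphism.\<close>
      then have "\<tau> X \<in> Obj \<C>" using AR[OF X(2)] unfolding AR_triangle_ends_def E_triangle_def by blast
      then have "\<tau> X \<in> iso_closure \<C> (\<tau> ` indecomposables_outside \<C> \<X> (Proj \<C> \<E> \<s>))"
        unfolding iso_closure_def indecomposables_outside_def using X False isomorphic_refl by blast
      then have "\<tau> X \<in> indecomposables_outside \<C> \<X> (Inj \<C> \<E> \<s>)" unfolding assms(7) .
      then show ?thesis unfolding indecomposables_outside_def by simp
    qed
  qed
  have \<tau>': "\<tau>' X \<in> \<X>" if "X \<in> \<X>" for X
  proof (rule subcategory_closed_additive[OF assms(5) \<tau>'_sum _ _ that])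
    show "\<tau>' Z \<in> \<X>" if "zero_object \<C> Z" for Z
      using \<tau>'_zero[OF zero_object_Inj[OF that]] sub by blast
  next
    fix X assume X: "X \<in> \<X>" "indecomposable \<C> X"
    show "\<tau>' X \<in> \<X>"
    proof (cases "X \<in> Inj \<C> \<E> \<s>")
      case True
      then show ?thesis using \<tau>'_zero sub by blast
    next
      case False
      then have "X \<in> iso_closure \<C> (\<tau> ` indecomposables_outside \<C> \<X> (Proj \<C> \<E> \<s>))"
        unfolding assms(7) using X by (simp add: indecomposables_outside_def)
      then obtain Y where Y: "Y \<in> \<X>" "indecomposable \<C> Y" "Y \<notin> Proj \<C> \<E> \<s>" "isomorphic \<C> (\<tau> Y) X"
        unfolding iso_closure_def indecomposables_outside_def by blast
      \<comment> \<open>The Auslander-Reiten triangle ending in Y and the one starting in X have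
        isomorphic starting terms, so their end terms Y and \<open>\<tau>' X\<close> are
        isomorphic.\<close>
      have "isomorphic \<C> Y (\<tau>' X)"
        using AR_triangle_ends_unique[OF AR[OF Y(2,3)] AR'[OF X(2) False] Y(4)] .
      then show ?thesis using Y(1) sub by blast
    qed
  qed
  show ?thesis
  proof (rule relative_frobenius[OF assms(5,6)])
    fix C A \<delta> X v
    assume "C \<in> Obj \<C>" "A \<in> Obj \<C>" "\<delta> \<in> ext \<E>' C A" "X \<in> \<X>" "v \<in> mor \<C> X C"
    then show "pull \<C> \<E> A v \<delta> = \<one>\<^bsub>Ext \<E> X A\<^esub>"
      by (rule relative_ext_pull[OF assms(3,8), where C = C, rotated]) (rule \<tau>)
  next
    fix C A \<delta>
    assume "C \<in> Obj \<C>" "A \<in> Obj \<C>" "\<delta> \<in> ext \<E> C A"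
      and "\<And>X v. \<lbrakk>X \<in> \<X>; v \<in> mor \<C> X C\<rbrakk> \<Longrightarrow> pull \<C> \<E> A v \<delta> = \<one>\<^bsub>Ext \<E> X A\<^esub>"
    then show "\<delta> \<in> ext \<E>' C A"
      by (rule relative_extI_pull[OF assms(4,9), rotated]) (assumption | rule \<tau>')+
  qed
qed

end
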